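(* Let $\mathcal{C}$ be a locally solvable closed cone field on a smooth manifold $M$, with domain $\mathcal{D}$. Then $\mathcal{C}$ admits a locally solvable enlargement. More precisely, if $\mathcal{C}_1$ is an enlargement of $\mathcal{C}$, then there exists a closed neighborhood $F$ of $\mathcal{D}$ such that $\mathcal{C}':=\mathcal{C}_{1|F}$ is locally solvable. In the case where $\mathcal{C}$ has a smooth boundary, the closed neighborhood $F$ can be assumed to have smooth boundary too.
   Context: $M$ is a smooth manifold. A convex cone in a vector space $E$ is a (possibly empty) convex subset $C\subset E$ which is contained in an open half space $\{\ell>0\}$ and satisfies $tx\in C$ for all $t>0$, $x\in C$. A cone field on $M$ is a subset $\mathcal{C}\subset TM$ such that $\mathcal{C}(x):=\mathcal{C}\cap T_xM$ is a convex cone for each $x\in M$ (so $\mathcal{C}$ contains no zero vector). It is a closed cone field if $\mathcal{C}\cup T^0M$ is closed in $TM$, where $T^0M$ is the zero section. The domain $\mathcal{D}$ of $\mathcal{C}$ is the (closed) set of points $x$ with $\mathcal{C}(x)\neq\emptyset$. $\mathcal{C}$ has smooth boundary (smooth domain) if $\mathcal{D}$ is a smooth submanifold with (possibly empty) boundary of $M$, of the same dimension as $M$; similarly $F$ has smooth boundary if it is such a submanifold with boundary. An enlargement of a closed cone field $\mathcal{C}$ is a closed cone field which contains $\mathcal{C}$ in its interior (in $TM$). For a subset $F\subset M$, $\mathcal{C}_{1|F}$ is the cone field equal to $\mathcal{C}_1(x)$ at points $x\in F$ and empty at points $x\notin F$. A curve $\gamma:I\to M$ ($I$ an interval) is $\mathcal{C}$-causal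 if it is locally Lipschitz and $\dot\gamma(t)\in\mathcal{C}(\gamma(t))$ for almost all $t\in I$. $\mathcal{C}$ is locally solvable if for each $x$ in its domain there is a nonconstant $\mathcal{C}$-causal curve $\gamma:]-1,1[\to M$ with $\gamma(0)=x$. *)

theory Defs
  imports "HOL-Analysis.Analysis" "HOL-Library.Function_Algebras"
begin

instantiation "fun" :: (type, real_vector) real_vector
begin

definition scaleR_fun :: "real \<Rightarrow> ('a \<Rightarrow> 'b) \<Rightarrow> 'a \<Rightarrow> 'b" where
  "scaleR_fun r f = (\<lambda>x. r *\<^sub>R f x)"

instance
  by standard (auto simp: scaleR_fun_def plus_fun_def fun_eq_iff scaleR_add_right scaleR_add_left)

end


section \<open>Smooth manifolds\<close>

text \<open>\<open>C\<^sup>k\<close> maps on an \<^emph>\<open>open\<close> subset of a finite-dimensional space; there, continuity of all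
  iterated directional derivatives is equivalent to continuity of the iterated
  Frechet derivatives.\<close>

fun Ck_on :: "nat \<Rightarrow> 'a::real_normed_vector set \<Rightarrow> ('a \<Rightarrow> 'b::real_normed_vector) \<Rightarrow> bool" where
  "Ck_on 0 S f \<longleftrightarrow> continuous_on S f"
| "Ck_on (Suc k) S f \<longleftrightarrow>
     (\<forall>x\<in>S. f differentiable (at x)) \<and> (\<forall>v. Ck_on k S (\<lambda>x. frechet_derivative f (at x) v))"

definition smooth_on :: "'a::real_normed_vector set \<Rightarrow> ('a \<Rightarrow> 'b::real_normed_vector) \<Rightarrow> bool" where
  "smooth_on S f \<longleftrightarrow> (\<forall>k. Ck_on k S f)"

text \<open>A chart \<open>(U, \<phi>)\<close>; the values of \<open>\<phi>\<close> outside \<open>U\<close> are irrelevant.\<close>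

type_synonym ('m, 'e) chart = "'m set \<times> ('m \<Rightarrow> 'e)"

abbreviation dom_chart :: "('m, 'e) chart \<Rightarrow> 'm set" where
  "dom_chart \<equiv> fst"

abbreviation coord :: "('m, 'e) chart \<Rightarrow> 'm \<Rightarrow> 'e" where
  "coord \<equiv> snd"

definition is_chart :: "('m::topological_space, 'e::euclidean_space) chart \<Rightarrow> bool" where
  "is_chart c \<longleftrightarrow> open (dom_chart c) \<and> open (coord c ` dom_chart c) \<and>
     (\<exists>g. homeomorphism (dom_chart c) (coord c ` dom_chart c) (coord c) g)"

definition transition :: "('m, 'e) chart \<Rightarrow> ('m, 'e) chart \<Rightarrow> 'e \<Rightarrow> 'e" where
  "transition c d = coord d \<circ> inv_into (dom_chart c) (coord c)"

definition smoothly_compatible ::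
  "('m, 'e::euclidean_space) chart \<Rightarrow> ('m, 'e) chart \<Rightarrow> bool" where
  "smoothly_compatible c d \<longleftrightarrow>
     smooth_on (coord c ` (dom_chart c \<inter> dom_chart d)) (transition c d) \<and>
     smooth_on (coord d ` (dom_chart c \<inter> dom_chart d)) (transition d c)"

definition smooth_atlas :: "('m::topological_space, 'e::euclidean_space) chart set \<Rightarrow> bool" where
  "smooth_atlas A \<longleftrightarrow> (\<forall>c\<in>A. is_chart c) \<and> (\<Union>c\<in>A. dom_chart c) = UNIV \<and>
     (\<forall>c\<in>A. \<forall>d\<in>A. smoothly_compatible c d)"

definition maximal_atlas ::
  "('m::topological_space, 'e::euclidean_space) chart set \<Rightarrow> ('m, 'e) chart set" where
  "maximal_atlas A = {c. is_chart c \<and> (\<forall>d\<in>A. smoothly_compatible c d)}"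


section \<open>The tangent bundle\<close>

text \<open>A tangent vector at \<open>x\<close> is the family \<open>v\<close> of its coordinate expressions \<open>v c\<close> in the charts
  \<open>c\<close> of the atlas around \<open>x\<close>, which transform by the differentials of the transition maps. For
  uniqueness \<open>v\<close> vanishes at all other indices. The vector space structure is pointwise.\<close>

type_synonym ('m, 'e) tvec = "('m, 'e) chart \<Rightarrow> 'e"

definition tangent_space ::
  "('m, 'e::euclidean_space) chart set \<Rightarrow> 'm \<Rightarrow> ('m, 'e) tvec set" where
  "tangent_space A x = {v.
     (\<forall>c. \<not> (c \<in> A \<and> x \<in> dom_chart c) \<longrightarrow> v c = 0) \<and>
     (\<forall>c\<in>A. \<forall>d\<in>A. x \<in> dom_chart c \<longrightarrow> x \<in> dom_chart d \<longrightarrow>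
        v d = frechet_derivative (transition c d) (at (coord c x)) (v c))}"

definition tangent_bundle ::
  "('m, 'e::euclidean_space) chart set \<Rightarrow> ('m \<times> ('m, 'e) tvec) set" where
  "tangent_bundle A = {(x, v). v \<in> tangent_space A x}"

definition zero_section :: "('m \<times> ('m, 'e::euclidean_space) tvec) set" where
  "zero_section = {(x, 0) |x. True}"

text \<open>The manifold topology of \<open>TM\<close>, in which the maps \<open>(x, v) \<mapsto> (coord c x, v c)\<close> are charts.\<close>

definition tangent_topology ::
  "('m, 'e::euclidean_space) chart set \<Rightarrow> ('m \<times> ('m, 'e) tvec) topology" where
  "tangent_topology A = topology_generated_by
     {{(x, v). (x, v) \<in> tangent_bundle A \<and> x \<in> dom_chart c \<and> (coord c x, v c) \<in> W}
       |c W. c \<in> A \<and> open W}"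

lemma topspace_tangent_topology:
  fixes A :: "('m::topological_space, 'e::euclidean_space) chart set"
  assumes "smooth_atlas A"
  shows "topspace (tangent_topology A) = tangent_bundle A"
proof
  show "topspace (tangent_topology A) \<subseteq> tangent_bundle A"
    by (auto simp: tangent_topology_def)
  show "tangent_bundle A \<subseteq> topspace (tangent_topology A)"
  proof
    fix p assume p: "p \<in> tangent_bundle A"
    obtain x v where xv: "p = (x, v)" by (cases p)
    from assms obtain c where c: "c \<in> A" "x \<in> dom_chart c"
      unfolding smooth_atlas_def by blast
    have "p \<in> {(x, v). (x, v) \<in> tangent_bundle A \<and> x \<in> dom_chart c \<and> (coord c x, v c) \<in> UNIV}"
      using p xv c by simp
    with c(1) show "p \<in> topspace (tangent_topology A)"
      unfolding tangent_topology_def topology_generated_by_topspace by blast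
  qed
qed


section \<open>Cone fields\<close>

text \<open>Linear forms on a subspace are the restrictions of linear forms on the ambient space, so for
  \<open>C \<subseteq> E\<close> with \<open>E\<close> a subspace, the form \<open>l\<close> may be taken on the ambient space.\<close>

definition cone_in_half_space :: "'a::real_vector set \<Rightarrow> bool" where
  "cone_in_half_space C \<longleftrightarrow> convex C \<and> (\<exists>l::'a \<Rightarrow> real. linear l \<and> C \<subseteq> {x. l x > 0}) \<and>
     (\<forall>t>0. \<forall>x\<in>C. t *\<^sub>R x \<in> C)"

definition fibre :: "('m \<times> 'v) set \<Rightarrow> 'm \<Rightarrow> 'v set" where
  "fibre C x = {v. (x, v) \<in> C}"

definition cone_field ::
  "('m, 'e::euclidean_space) chart set \<Rightarrow> ('m \<times> ('m, 'e) tvec) set \<Rightarrow> bool" where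
  "cone_field A C \<longleftrightarrow> C \<subseteq> tangent_bundle A \<and> (\<forall>x. cone_in_half_space (fibre C x))"

definition closed_cone_field ::
  "('m, 'e::euclidean_space) chart set \<Rightarrow> ('m \<times> ('m, 'e) tvec) set \<Rightarrow> bool" where
  "closed_cone_field A C \<longleftrightarrow>
     cone_field A C \<and> closedin (tangent_topology A) (C \<union> zero_section)"

definition cone_domain :: "('m \<times> 'v) set \<Rightarrow> 'm set" where
  "cone_domain C = {x. fibre C x \<noteq> {}}"

definition enlargement ::
  "('m, 'e::euclidean_space) chart set \<Rightarrow> ('m \<times> ('m, 'e) tvec) set \<Rightarrow>
   ('m \<times> ('m, 'e) tvec) set \<Rightarrow> bool" where
  "enlargement A C C1 \<longleftrightarrow>
     closed_cone_field A C1 \<and> C \<subseteq> (tangent_topology A) interior_of C1"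

definition restrict_field :: "('m \<times> 'v) set \<Rightarrow> 'm set \<Rightarrow> ('m \<times> 'v) set" where
  "restrict_field C F = {(x, v). (x, v) \<in> C \<and> x \<in> F}"

definition closed_neighborhood :: "'m::topological_space set \<Rightarrow> 'm set \<Rightarrow> bool" where
  "closed_neighborhood F D \<longleftrightarrow> closed F \<and> D \<subseteq> interior F"

text \<open>Codimension zero submanifolds with (possibly empty) boundary, through half space charts. Points
  of the manifold interior are covered as well: around them the half space condition holds
  trivially in a translated chart whose image lies in \<open>{z. 0 < z \<bullet> b}\<close>.\<close>

definition smooth_domain ::
  "('m::topological_space, 'e::euclidean_space) chart set \<Rightarrow> 'm set \<Rightarrow> bool" where
  "smooth_domain A S \<longleftrightarrow> (\<forall>x\<in>S. \<exists>c\<in>maximal_atlas A. x \<in> dom_chart c \<and>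
     (\<exists>b\<in>Basis. coord c ` (dom_chart c \<inter> S) = coord c ` dom_chart c \<inter> {z. 0 \<le> z \<bullet> b}))"


section \<open>Causal curves\<close>

definition locally_lipschitz_curve ::
  "('m, 'e::euclidean_space) chart set \<Rightarrow> real set \<Rightarrow> (real \<Rightarrow> 'm) \<Rightarrow> bool" where
  "locally_lipschitz_curve A I \<gamma> \<longleftrightarrow> (\<forall>t\<in>I. \<exists>c\<in>A. \<exists>\<epsilon>>0. \<exists>L.
     \<gamma> ` (I \<inter> ball t \<epsilon>) \<subseteq> dom_chart c \<and> L-lipschitz_on (I \<inter> ball t \<epsilon>) (coord c \<circ> \<gamma>))"

definition has_velocity ::
  "('m, 'e::euclidean_space) chart set \<Rightarrow> real set \<Rightarrow> (real \<Rightarrow> 'm) \<Rightarrow> real \<Rightarrow> ('m, 'e) tvec \<Rightarrow> bool" where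
  "has_velocity A I \<gamma> t v \<longleftrightarrow> v \<in> tangent_space A (\<gamma> t) \<and>
     (\<forall>c\<in>A. \<gamma> t \<in> dom_chart c \<longrightarrow> ((coord c \<circ> \<gamma>) has_vector_derivative v c) (at t within I))"

definition causal_curve ::
  "('m, 'e::euclidean_space) chart set \<Rightarrow> ('m \<times> ('m, 'e) tvec) set \<Rightarrow> real set \<Rightarrow>
   (real \<Rightarrow> 'm) \<Rightarrow> bool" where
  "causal_curve A C I \<gamma> \<longleftrightarrow> is_interval I \<and> locally_lipschitz_curve A I \<gamma> \<and>
     (AE t in lebesgue. t \<in> I \<longrightarrow> (\<exists>v. has_velocity A I \<gamma> t v \<and> v \<in> fibre C (\<gamma> t)))"

definition locally_solvable ::
  "('m, 'e::euclidean_space) chart set \<Rightarrow> ('m \<times> ('m, 'e) tvec) set \<Rightarrow> bool" where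
  "locally_solvable A C \<longleftrightarrow> (\<forall>x\<in>cone_domain C. \<exists>\<gamma>.
     causal_curve A C {-1<..<1} \<gamma> \<and> \<not> \<gamma> constant_on {-1<..<1} \<and> \<gamma> 0 = x)"

end

theory Submission
  imports Defs
begin

text \<open>
  The two ways of thickening the domain \<open>D\<close> of \<open>C\<close> rest on the same remark: near a
  point of \<open>D\<close>, every vector that is close, relative to its length, to a vector of
  \<open>C\<close> belongs to the enlargement \<open>C1\<close>. This is compactness of the set of unit
  vectors of \<open>C\<close> over a coordinate ball (\<open>compact_unit_cones\<close>,
  \<open>cone_at_upper_semicontinuous\<close>). It also provides, over small balls, a covector
  \<open>p\<close> with \<open>p \<bullet> w > \<kappa> * norm w\<close> on all cones
  (\<open>uniform_cone_bound\<close>).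

  An enlargement exists (\<open>ex_enlargement\<close>) because the round cones \<open>{w. p \<bullet> w
  \<ge> \<kappa> * norm w}\<close> contain the cones of \<open>C\<close> in their interior locally, and
  intersecting them over a locally finite cover keeps this property.

  Let \<open>C1\<close> be an enlargement. A \<open>C\<close>-causal curve \<open>\<beta>\<close> through a
  point of \<open>D\<close> can be surrounded by a spindle: the union of the curves \<open>t \<mapsto>
  \<beta> t + \<rho> t *\<^sub>R u\<close>, \<open>norm u \<le> 1\<close>, where the small function
  \<open>\<rho>\<close> is positive inside and vanishes at both ends of the parameter interval. These curves
  are \<open>C1\<close>-causal if \<open>\<rho>\<close> varies slowly along \<open>\<beta>\<close>, and the
  two tips of the spindle lie in \<open>D\<close>, where \<open>C\<close> itself provides curves. So
  \<open>C1\<close> can be solved inside the spindle at each of its points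
  (\<open>solvable_neighborhood\<close>), and \<open>F\<close> is the union of \<open>D\<close> with a
  locally finite family of spindles (\<open>ex_solvable_restriction\<close>).

  Now suppose that \<open>D\<close> has a smooth boundary. At a boundary point \<open>x\<close> a causal
  curve stays on one side of the boundary both in the past and in the future, so \<open>C\<close> cannot
  point strictly to one side: the convex cone at \<open>x\<close> contains a vector tangent to the boundary
  (\<open>tangent_vector_at_boundary\<close>). Thus \<open>D\<close> belongs to the class of closed sets
  with half space charts in which a constant vector with values in the interior of \<open>C1\<close> is
  tangent to the boundary at boundary points (\<open>adapted_domain\<close>). In such a set
  \<open>C1\<close> is solved by straight lines (\<open>adapted_domain_curve\<close>). The class is stable
  under small diffeomorphisms. Pushing the boundary outwards, one chart of \<open>D\<close> at a time, by
  sufficiently small diffeomorphisms (\<open>push_boundary_outward\<close>) gives a locally eventually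
  constant sequence of such sets, whose limit is \<open>F\<close> (\<open>ex_adapted_neighborhood\<close>).
\<close>

section \<open>Calculus of \<open>C\<^sup>k\<close> maps\<close>

lemma Ck_on_cong:
  assumes "open S" "\<And>x. x \<in> S \<Longrightarrow> f x = g x"
  shows "Ck_on k S f \<longleftrightarrow> Ck_on k S g"
  using assms(2)
proof (induction k arbitrary: f g)
  case 0
  then show ?case by (auto intro: continuous_on_eq)
next
  case (Suc k)
  have *: "(f has_derivative D) (at x) \<longleftrightarrow> (g has_derivative D) (at x)" if "x \<in> S" for x D
    using Suc.prems has_derivative_transform_within_open[OF _ assms(1) that]
    by (metis (no_types, lifting))
  have "frechet_derivative f (at x) = frechet_derivative g (at x)" if "x \<in> S" for x
    unfolding frechet_derivative_def using *[OF that] by simp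
  then have "Ck_on k S (\<lambda>x. frechet_derivative f (at x) v)
      \<longleftrightarrow> Ck_on k S (\<lambda>x. frechet_derivative g (at x) v)" for v
    by (intro Suc.IH) auto
  moreover have "f differentiable (at x) \<longleftrightarrow> g differentiable (at x)" if "x \<in> S" for x
    using * that by (auto simp: differentiable_def)
  ultimately show ?case by simp
qed

lemma Ck_on_subset: "Ck_on k S f \<Longrightarrow> T \<subseteq> S \<Longrightarrow> Ck_on k T f"
proof (induction k arbitrary: f)
  case (Suc k)
  then show ?case by (simp add: subset_iff)
qed (auto intro: continuous_on_subset)

text \<open>Derivatives are computed as explicit formulas. On an open set these may replace
  \<open>frechet_derivative\<close> in the recursive clause.\<close>

lemma Ck_on_SucI:
  assumes "open S" "\<And>x. x \<in> S \<Longrightarrow> (f has_derivative f' x) (at x)"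
    and "\<And>v. Ck_on k S (\<lambda>x. f' x v)"
  shows "Ck_on (Suc k) S f"
proof -
  have "Ck_on k S (\<lambda>x. frechet_derivative f (at x) v)" for v
  proof -
    have "Ck_on k S (\<lambda>x. frechet_derivative f (at x) v) \<longleftrightarrow> Ck_on k S (\<lambda>x. f' x v)"
      by (rule Ck_on_cong[OF assms(1)]) (simp add: frechet_derivative_at[OF assms(2), symmetric])
    with assms(3) show ?thesis by blast
  qed
  then show ?thesis using assms(2) by (auto simp: differentiable_def)
qed

lemma Ck_on_has_derivative:
  "Ck_on (Suc k) S f \<Longrightarrow> x \<in> S \<Longrightarrow> (f has_derivative frechet_derivative f (at x)) (at x)"
  by (simp add: frechet_derivative_works[symmetric])

lemma Ck_on_deriv: "Ck_on (Suc k) S f \<Longrightarrow> Ck_on k S (\<lambda>x. frechet_derivative f (at x) v)"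
  by simp

lemma Ck_on_Suc_imp: "Ck_on (Suc k) S f \<Longrightarrow> Ck_on k S f"
proof (induction k arbitrary: f)
  case 0
  then show ?case
    by (auto intro!: continuous_at_imp_continuous_on differentiable_imp_continuous_within)
next
  case (Suc k)
  then have "Ck_on k S (\<lambda>x. frechet_derivative f (at x) v)" for v
    by (intro Suc.IH) simp
  with Suc.prems show ?case by auto
qed

lemma Ck_on_imp_continuous: "Ck_on k S f \<Longrightarrow> continuous_on S f"
proof (induction k)
  case (Suc k)
  then show ?case using Ck_on_Suc_imp by blast
qed simp

lemma Ck_on_local:
  assumes "\<And>x. x \<in> S \<Longrightarrow> \<exists>T. open T \<and> x \<in> T \<and> Ck_on k T f"
  shows "Ck_on k S f"
  using assms
proof (induction k arbitrary: f)
  case 0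
  then show ?case
    by (auto intro!: continuous_at_imp_continuous_on) (meson continuous_on_eq_continuous_at)
next
  case (Suc k)
  have "f differentiable at x" if "x \<in> S" for x
    using Suc.prems[OF that] by auto
  moreover have "Ck_on k S (\<lambda>x. frechet_derivative f (at x) v)" for v
  proof (rule Suc.IH)
    fix x assume "x \<in> S"
    then show "\<exists>T. open T \<and> x \<in> T \<and> Ck_on k T (\<lambda>x. frechet_derivative f (at x) v)"
      using Suc.prems[of x] by auto
  qed
  ultimately show ?case by simp
qed

lemma Ck_on_const:
  assumes "open S"
  shows "Ck_on k S (\<lambda>x. a)"
proof (induction k arbitrary: a)
  case (Suc k)
  show ?case
    by (rule Ck_on_SucI[OF assms has_derivative_const Suc])
qed simp

lemma Ck_on_bounded_linear:
  assumes "bounded_linear f" "open S"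
  shows "Ck_on k S f"
proof (cases k)
  case 0
  then show ?thesis by (simp add: assms(1) linear_continuous_on)
next
  case (Suc m)
  then show ?thesis
    using Ck_on_SucI[OF assms(2) bounded_linear.has_derivative[OF assms(1) has_derivative_ident]
        Ck_on_const[OF assms(2)]]
    by simp
qed

lemma Ck_on_id: "open S \<Longrightarrow> Ck_on k S (\<lambda>x. x)"
  by (rule Ck_on_bounded_linear[OF bounded_linear_ident])

lemma Ck_on_add:
  assumes "open S" "Ck_on k S f" "Ck_on k S g"
  shows "Ck_on k S (\<lambda>x. f x + g x)"
  using assms(2,3)
proof (induction k arbitrary: f g)
  case 0
  then show ?case by (auto intro: continuous_on_add)
next
  case (Suc k)
  show ?case
    by (rule Ck_on_SucI[OF assms(1) has_derivative_add[OF
          Ck_on_has_derivative[OF Suc.prems(1)] Ck_on_has_derivative[OF Suc.prems(2)]]])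
      (use Suc in \<open>auto intro: Suc.IH\<close>)
qed

lemma Ck_on_sum:
  assumes "open S" "finite J" "\<And>j. j \<in> J \<Longrightarrow> Ck_on k S (f j)"
  shows "Ck_on k S (\<lambda>x. \<Sum>j\<in>J. f j x)"
  using assms(2,3)
proof (induction J rule: finite_induct)
  case empty
  then show ?case using Ck_on_const[OF assms(1)] by simp
next
  case (insert j J)
  then show ?case by (simp add: Ck_on_add[OF assms(1)])
qed

lemma Ck_on_bilinear:
  assumes "bounded_bilinear p" "open S" "Ck_on k S f" "Ck_on k S g"
  shows "Ck_on k S (\<lambda>x. p (f x) (g x))"
  using assms(3,4)
proof (induction k arbitrary: f g)
  case 0
  then show ?case by (auto intro: bounded_bilinear.continuous_on[OF assms(1)])
next
  case (Suc k)
  show ?case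
  proof (rule Ck_on_SucI[OF assms(2)])
    fix x assume "x \<in> S"
    then show "((\<lambda>x. p (f x) (g x)) has_derivative (\<lambda>v. p (f x) (frechet_derivative g (at x) v)
         + p (frechet_derivative f (at x) v) (g x))) (at x)"
      using Suc.prems by (intro bounded_bilinear.FDERIV[OF assms(1)] Ck_on_has_derivative)
  next
    fix v
    show "Ck_on k S (\<lambda>x. p (f x) (frechet_derivative g (at x) v)
         + p (frechet_derivative f (at x) v) (g x))"
      by (intro Ck_on_add[OF assms(2)] Suc.IH Suc.prems[THEN Ck_on_deriv] Suc.prems[THEN
          Ck_on_Suc_imp])
  qed
qed

lemmas Ck_on_scaleR = Ck_on_bilinear[OF bounded_bilinear_scaleR]
  and Ck_on_mult = Ck_on_bilinear[OF bounded_bilinear_mult]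
  and Ck_on_inner = Ck_on_bilinear[OF bounded_bilinear_inner]

lemma linear_eq_sum_Basis:
  fixes f :: "'a::euclidean_space \<Rightarrow> 'b::real_vector"
  assumes "linear f"
  shows "f w = (\<Sum>e\<in>Basis. (w \<bullet> e) *\<^sub>R f e)"
proof -
  have "f w = f (\<Sum>e\<in>Basis. (w \<bullet> e) *\<^sub>R e)" by (simp add: euclidean_representation)
  also have "\<dots> = (\<Sum>e\<in>Basis. (w \<bullet> e) *\<^sub>R f e)"
    by (simp add: linear_sum[OF assms] linear_cmul[OF assms])
  finally show ?thesis .
qed

text \<open>Expanding the inner derivative in the basis, the chain rule writes the derivative as a sum of
  products of \<open>C\<^sup>k\<close> functions and compositions to which the induction
  hypothesis applies.\<close>

lemma Ck_on_compose:
  fixes f :: "'b::euclidean_space \<Rightarrow> 'c::real_normed_vector"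
    and g :: "'a::real_normed_vector \<Rightarrow> 'b"
  assumes S: "open S" and "Ck_on k T f" "Ck_on k S g" "g ` S \<subseteq> T"
  shows "Ck_on k S (\<lambda>x. f (g x))"
  using assms(2-)
proof (induction k arbitrary: f)
  case 0
  then show ?case using continuous_on_compose2 by auto
next
  case (Suc k)
  let ?D = "\<lambda>x v. \<Sum>e\<in>Basis. (frechet_derivative g (at x) v \<bullet> e) *\<^sub>R frechet_derivative f (at (g x))
      e"
  show ?case
  proof (rule Ck_on_SucI[OF S])
    fix x assume x: "x \<in> S"
    have f': "(f has_derivative frechet_derivative f (at (g x))) (at (g x))"
      using Ck_on_has_derivative[OF Suc.prems(1)] Suc.prems(3) x by blast
    show "((\<lambda>x. f (g x)) has_derivative ?D x) (at x)"
      by (rule has_derivative_eq_rhs[OF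
            has_derivative_compose[OF Ck_on_has_derivative[OF Suc.prems(2) x] f']])
        (rule ext, rule linear_eq_sum_Basis[OF has_derivative_linear[OF f']])
  next
    fix v
    show "Ck_on k S (\<lambda>x. ?D x v)"
      by (intro Ck_on_sum[OF S] Ck_on_scaleR[OF S] Ck_on_inner[OF S] Ck_on_const[OF S] finite_Basis
          Suc.IH Suc.prems(1,2)[THEN Ck_on_deriv] Suc.prems(2)[THEN Ck_on_Suc_imp] Suc.prems(3))
  qed
qed

lemma Ck_on_inverse:
  fixes f :: "'a::real_normed_vector \<Rightarrow> real"
  assumes S: "open S" and "Ck_on k S f" and nz: "\<And>x. x \<in> S \<Longrightarrow> f x \<noteq> 0"
  shows "Ck_on k S (\<lambda>x. inverse (f x))"
  using assms(2)
proof (induction k)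
  case 0
  then show ?case using nz by (auto intro: continuous_on_inverse)
next
  case (Suc k)
  have inv: "Ck_on k S (\<lambda>x. inverse (f x))"
    using Suc Ck_on_Suc_imp by blast
  show ?case
  proof (rule Ck_on_SucI[OF S])
    fix x assume x: "x \<in> S"
    show "((\<lambda>x. inverse (f x)) has_derivative
       (\<lambda>v. - 1 * ((inverse (f x) * inverse (f x)) * frechet_derivative f (at x) v))) (at x)"
      using nz[OF x] Ck_on_has_derivative[OF Suc.prems x]
      by (auto intro!: derivative_eq_intros simp: algebra_simps)
  next
    fix v
    show "Ck_on k S (\<lambda>x. - 1 * ((inverse (f x) * inverse (f x)) * frechet_derivative f (at x) v))"
      using Suc.prems by (intro Ck_on_mult[OF S] inv Ck_on_const[OF S]) auto
  qed
qed

lemma C1_lipschitz_on_convex: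
  fixes f :: "'a::euclidean_space \<Rightarrow> 'b::real_normed_vector"
  assumes der: "\<And>y. y \<in> T \<Longrightarrow> (f has_derivative f' y) (at y)" and "convex T"
    and bdd: "\<And>e. bounded ((\<lambda>y. f' y e) ` T)"
  obtains L where "L > 0" "L-lipschitz_on T f"
proof -
  have "\<exists>B. \<forall>y\<in>T. norm (f' y e) \<le> B" for e
    using bdd[of e] by (auto simp: bounded_iff)
  then obtain B where B: "\<And>e y. y \<in> T \<Longrightarrow> norm (f' y e) \<le> B e"
    by metis
  let ?L = "1 + (\<Sum>e\<in>Basis. \<bar>B e\<bar>)"
  have pos: "?L > 0" by (simp add: add_pos_nonneg sum_nonneg)
  have on: "onorm (f' y) \<le> ?L" if "y \<in> T" for y
  proof (rule onorm_le)
    fix v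
    have "norm (f' y v) = norm (\<Sum>e\<in>Basis. (v \<bullet> e) *\<^sub>R f' y e)"
      by (rule arg_cong[where f = norm, OF linear_eq_sum_Basis[OF has_derivative_linear[OF der[OF
          that]]]])
    also have "\<dots> \<le> (\<Sum>e\<in>Basis. norm v * \<bar>B e\<bar>)"
    proof (rule sum_norm_le)
      fix e :: 'a assume "e \<in> Basis"
      then have "\<bar>v \<bullet> e\<bar> \<le> norm v" by (simp add: Basis_le_norm)
      moreover have "norm (f' y e) \<le> \<bar>B e\<bar>"
        using B[of y e] that by (simp add: order_trans[OF _ abs_ge_self])
      ultimately show "norm ((v \<bullet> e) *\<^sub>R f' y e) \<le> norm v * \<bar>B e\<bar>"
        by (auto intro: mult_mono)
    qed
    also have "\<dots> = norm v * (\<Sum>e\<in>Basis. \<bar>B e\<bar>)" by (simp add: sum_distrib_left)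
    also have "\<dots> \<le> ?L * norm v" by (simp add: algebra_simps)
    finally show "norm (f' y v) \<le> ?L * norm v" .
  qed
  have "?L-lipschitz_on T f"
  proof (rule lipschitz_onI)
    fix y z assume yz: "y \<in> T" "z \<in> T"
    have "norm (f y - f z) \<le> ?L * norm (y - z)"
      by (rule differentiable_bound[OF assms(2) _ on])
        (auto intro: yz der[THEN has_derivative_at_withinI])
    then show "dist (f y) (f z) \<le> ?L * dist y z" by (simp add: dist_norm)
  qed (use pos in simp)
  then show ?thesis using that pos by blast
qed

lemma C1_locally_lipschitz:
  fixes f :: "'a::euclidean_space \<Rightarrow> 'b::real_normed_vector"
  assumes "Ck_on 1 S f" "open S" "x \<in> S"
  obtains r L where "r > 0" "ball x r \<subseteq> S" "L-lipschitz_on (ball x r) f"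
proof -
  obtain r where r: "r > 0" "cball x r \<subseteq> S"
    using assms open_contains_cball_eq by blast
  have der: "(f has_derivative frechet_derivative f (at y)) (at y)" if "y \<in> cball x r" for y
    by (rule Ck_on_has_derivative[of 0 S]) (use assms(1) that r in auto)
  have "bounded ((\<lambda>y. frechet_derivative f (at y) e) ` cball x r)" for e
  proof -
    have "continuous_on (cball x r) (\<lambda>y. frechet_derivative f (at y) e)"
      by (rule continuous_on_subset[OF _ r(2)]) (use assms(1) in simp)
    then show ?thesis
      by (intro compact_imp_bounded compact_continuous_image compact_cball)
  qed
  from C1_lipschitz_on_convex[OF der convex_cball this]
  obtain L where "L-lipschitz_on (cball x r) f" by metis
  then have "L-lipschitz_on (ball x r) f" by (rule lipschitz_on_subset) auto
  moreover have "ball x r \<subseteq> S" using r by auto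
  ultimately show ?thesis using that r(1) by blast
qed

section \<open>Bump functions and shifts along them\<close>

text \<open>The functions \<open>s ^ (- n) * exp (- 1 / s)\<close>, for \<open>s > 0\<close>, extended by
  \<open>0\<close>. Their linear span is closed under differentiation, so that one induction
  over all \<open>n\<close> at once gives smoothness; the bump functions only use \<open>n =
  0\<close>.\<close>

definition flat_exp :: "nat \<Rightarrow> real \<Rightarrow> real" where
  "flat_exp n s = (if s > 0 then inverse s ^ n * exp (- inverse s) else 0)"

lemma flat_exp_tendsto: "(flat_exp n \<longlongrightarrow> 0) (at 0)"
proof -
  have "((\<lambda>s. inverse s ^ n * exp (- inverse s)) \<longlongrightarrow> 0) (at_right (0::real))"
  proof -
    have "((\<lambda>x::real. x ^ n / exp x) \<longlongrightarrow> 0) at_top" by (rule tendsto_power_div_exp_0)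
    then have "((\<lambda>x::real. x ^ n * exp (- x)) \<longlongrightarrow> 0) at_top"
      by (simp add: exp_minus field_simps)
    from filterlim_compose[OF this filterlim_inverse_at_top_right] show ?thesis by simp
  qed
  then have "(flat_exp n \<longlongrightarrow> 0) (at_right 0)"
    by (rule Lim_transform_eventually)
      (auto simp: flat_exp_def eventually_at_right_less eventually_at_filter)
  moreover have "(flat_exp n \<longlongrightarrow> 0) (at_left 0)"
    by (rule Lim_transform_eventually[OF tendsto_const])
      (auto simp: flat_exp_def eventually_at_filter)
  ultimately show ?thesis by (simp add: filterlim_split_at)
qed

lemma flat_exp_deriv:
  "(flat_exp n has_real_derivative (flat_exp (n + 2) s - n * flat_exp (n + 1) s)) (at s)"
proof -
  consider "s > 0" | "s < 0" | "s = 0" by linarith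
  then show ?thesis
  proof cases
    case 1
    have "((\<lambda>s. inverse s ^ n * exp (- inverse s)) has_real_derivative
        (flat_exp (n + 2) s - n * flat_exp (n + 1) s)) (at s)"
      using 1 by (cases n) (auto intro!: derivative_eq_intros simp: flat_exp_def algebra_simps,
          metis One_nat_def power_eq_if)
    then show ?thesis
      by (rule has_field_derivative_transform_within_open[of _ _ _ "{0<..}"])
        (use 1 in \<open>auto simp: flat_exp_def\<close>)
  next
    case 2
    have "((\<lambda>s. 0) has_real_derivative 0) (at s)" by simp
    then have "(flat_exp n has_real_derivative 0) (at s)"
      by (rule has_field_derivative_transform_within_open[of _ _ _ "{..<0}"])
        (use 2 in \<open>auto simp: flat_exp_def\<close>)
    then show ?thesis using 2 by (simp add: flat_exp_def)
  next
    case 3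
    have "((\<lambda>h. (flat_exp n (0 + h) - flat_exp n 0) / h) \<longlongrightarrow> 0) (at 0)"
      by (rule Lim_transform_eventually[OF flat_exp_tendsto[of "Suc n"]])
        (auto simp: flat_exp_def eventually_at_filter field_simps)
    then show ?thesis using 3 by (simp add: DERIV_def flat_exp_def)
  qed
qed

lemma Ck_on_flat_exp: "Ck_on k UNIV (flat_exp n)"
proof (induction k arbitrary: n)
  case 0
  then show ?case
    using flat_exp_deriv by (auto intro!: continuous_at_imp_continuous_on DERIV_isCont)
next
  case (Suc k)
  show ?case
  proof (rule Ck_on_SucI)
    fix s
    show "(flat_exp n has_derivative (\<lambda>v. v * (flat_exp (n + 2) s + (- real n) * flat_exp (n + 1)
        s))) (at s)"
      using flat_exp_deriv[of n s]
      by (simp add: has_field_derivative_def mult.commute[of _ "_ + _"] mult.commute[of _ "_ - _"])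
  next
    fix v :: real
    show "Ck_on k UNIV (\<lambda>s. v * (flat_exp (n + 2) s + (- real n) * flat_exp (n + 1) s))"
      by (intro Ck_on_mult Ck_on_add Ck_on_const Suc open_UNIV)
  qed simp
qed

text \<open>The function \<open>exp (- 1 / (r\<^sup>2 - dist z z0 ^ 2))\<close> on the ball, extended by
  \<open>0\<close>. Its derivative is continuous and supported in a compact ball, hence bounded,
  which gives the Lipschitz constant.\<close>

lemma ex_smooth_bump:
  fixes z0 :: "'a::euclidean_space"
  assumes "r > 0"
  obtains \<rho> :: "'a \<Rightarrow> real" and L where "smooth_on UNIV \<rho>" "\<And>z. \<rho> z \<ge> 0" "\<And>z. \<rho> z \<le> 1"
    "\<And>z. \<rho> z > 0 \<longleftrightarrow> z \<in> ball z0 r" "L-lipschitz_on UNIV \<rho>" "L > 0"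
proof -
  define \<rho> where "\<rho> z = flat_exp 0 (r\<^sup>2 + (-1) * ((z + - z0) \<bullet> (z + - z0)))" for z :: 'a
  have sm: "Ck_on k UNIV \<rho>" for k
    unfolding \<rho>_def
    by (rule Ck_on_compose[OF _ Ck_on_flat_exp])
      (intro Ck_on_add Ck_on_mult Ck_on_inner Ck_on_const Ck_on_id open_UNIV subset_UNIV)+
  have arg: "r\<^sup>2 + (-1) * ((z + - z0) \<bullet> (z + - z0)) > 0 \<longleftrightarrow> z \<in> ball z0 r" for z
  proof -
    have "(z + - z0) \<bullet> (z + - z0) = (dist z0 z)\<^sup>2"
      by (simp add: dist_norm power2_norm_eq_inner norm_minus_commute[of z0])
    then show ?thesis using assms by (simp add: power2_less_imp_less) (metis abs_le_square_iff
        abs_of_nonneg less_imp_le not_le zero_le_dist)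
  qed
  have pos: "\<rho> z > 0 \<longleftrightarrow> z \<in> ball z0 r" for z
    using arg[of z] by (simp add: \<rho>_def flat_exp_def split: if_splits)
  have nn: "\<rho> z \<ge> 0" for z by (simp add: \<rho>_def flat_exp_def)
  have der: "(\<rho> has_derivative frechet_derivative \<rho> (at z)) (at z)" for z
    using Ck_on_has_derivative[OF sm[of "Suc 0"]] by simp
  have out: "frechet_derivative \<rho> (at z) v = 0" if "z \<notin> cball z0 r" for z v
  proof -
    have "\<rho> y = 0" if "y \<in> - cball z0 r" for y
      using pos[of y] nn[of y] that by (simp add: order.order_iff_strict)
    then have "(\<rho> has_derivative (\<lambda>_. 0)) (at z)"
      by (intro has_derivative_transform_within_open[OF has_derivative_const[of 0] open_Compl[OF
          closed_cball], of z])
        (use that in auto)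
    then show ?thesis using has_derivative_unique[OF der] by metis
  qed
  have "bounded (range (\<lambda>z. frechet_derivative \<rho> (at z) v))" for v
  proof -
    have "continuous_on (cball z0 r) (\<lambda>z. frechet_derivative \<rho> (at z) v)"
      by (rule continuous_on_subset[of UNIV]) (use sm[of "Suc 0"] in simp_all)
    then have "bounded ((\<lambda>z. frechet_derivative \<rho> (at z) v) ` cball z0 r)"
      by (intro compact_imp_bounded compact_continuous_image compact_cball)
    moreover have "range (\<lambda>z. frechet_derivative \<rho> (at z) v)
        \<subseteq> insert 0 ((\<lambda>z. frechet_derivative \<rho> (at z) v) ` cball z0 r)"
      using out by blast
    ultimately show ?thesis using bounded_insert bounded_subset by blast
  qed
  from C1_lipschitz_on_convex[OF der convex_UNIV this]
  obtain L where "L > 0" "L-lipschitz_on UNIV \<rho>" by metis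
  moreover have "\<rho> z \<le> 1" for z by (simp add: \<rho>_def flat_exp_def)
  ultimately show ?thesis using that[of \<rho> L] sm nn pos by (simp add: smooth_on_def)
qed

lemma lipschitz_deriv_bound:
  fixes f :: "'a::real_normed_vector \<Rightarrow> real"
  assumes der: "(f has_derivative f') (at z)" and lip: "L-lipschitz_on UNIV f"
  shows "\<bar>f' v\<bar> \<le> L * norm v"
proof -
  have "((\<lambda>t. z + t *\<^sub>R v) has_derivative (\<lambda>t. t *\<^sub>R v)) (at 0)"
    by (auto intro!: derivative_eq_intros)
  from has_derivative_compose[OF this, of f f'] der
  have "((\<lambda>t. f (z + t *\<^sub>R v)) has_real_derivative f' v) (at 0)"
    by (simp add: has_field_derivative_def linear_cmul[OF has_derivative_linear[OF der]]
        mult_commute_abs)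
  then have "((\<lambda>h. \<bar>(f (z + h *\<^sub>R v) - f z) / h\<bar>) \<longlongrightarrow> \<bar>f' v\<bar>) (at 0)"
    unfolding DERIV_def by (intro tendsto_rabs) simp
  moreover have "\<bar>(f (z + h *\<^sub>R v) - f z) / h\<bar> \<le> L * norm v" if "h \<noteq> 0" for h
    using lipschitz_onD[OF lip, of "z + h *\<^sub>R v" z] that
        by (simp add: dist_norm divide_le_eq mult_ac)
  ultimately show ?thesis
    by (intro tendsto_upperbound[of _ _ "at 0"]) (auto simp: eventually_at_filter)
qed

text \<open>The map \<open>z \<mapsto> z + (\<epsilon> * \<rho> z) *\<^sub>R b\<close> is a perturbation of
  the identity by a contraction, hence bijective with a Lipschitz inverse \<open>\<phi>\<close>.
  Its differential is the identity plus a map of rank one, so the differential of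
  \<open>\<phi>\<close> is given by an explicit formula in \<open>\<phi>\<close> itself; if
  \<open>\<phi>\<close> is \<open>C\<^sup>k\<close>, the formula shows that
  \<open>\<phi>\<close> is \<open>C\<^sup>k\<^sup>+\<^sup>1\<close>.\<close>

lemma bump_shift_diffeo:
  fixes b :: "'a::euclidean_space"
  assumes \<rho>: "smooth_on UNIV \<rho>" "L-lipschitz_on UNIV \<rho>" and b: "norm b = 1"
    and \<epsilon>: "\<epsilon> \<ge> 0" "\<epsilon> * L < 1"
  obtains \<phi> where "\<And>z. \<phi> (z + (\<epsilon> * \<rho> z) *\<^sub>R b) = z" "\<And>y. \<phi> y + (\<epsilon> * \<rho> (\<phi> y)) *\<^sub>R b = y"
    "smooth_on UNIV \<phi>"
proof -
  let ?\<psi> = "\<lambda>z. z + (\<epsilon> * \<rho> z) *\<^sub>R b"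
  define D where "D z = frechet_derivative \<rho> (at z)" for z
  have L0: "L \<ge> 0" using \<rho>(2) lipschitz_on_nonneg by blast
  have der: "(\<rho> has_derivative D z) (at z)" for z
    unfolding D_def using Ck_on_has_derivative[of 0] \<rho>(1) unfolding smooth_on_def by (metis UNIV_I)
  have lin: "linear (D z)" for z using der has_derivative_linear by blast
  have lip: "\<bar>\<rho> y - \<rho> z\<bar> \<le> L * norm (y - z)" for y z
    using lipschitz_onD[OF \<rho>(2), of y z] by (simp add: dist_norm)
  have Db: "\<bar>D z b\<bar> \<le> L" for z using lipschitz_deriv_bound[OF der \<rho>(2), of z b] b by simp
  have pos: "1 + \<epsilon> * D z b > 0" for z
  proof -
    have "\<epsilon> * D z b \<ge> - (\<epsilon> * L)" using Db[of z] \<epsilon>(1)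
      by (metis abs_le_D2 minus_le_iff mult_left_mono mult_minus_right)
    then show ?thesis using \<epsilon> by linarith
  qed
  have "\<exists>!z. y - (\<epsilon> * \<rho> z) *\<^sub>R b = z" for y
  proof (rule banach_fix_type[of "\<epsilon> * L"])
    show "\<forall>x z. dist (y - (\<epsilon> * \<rho> x) *\<^sub>R b) (y - (\<epsilon> * \<rho> z) *\<^sub>R b) \<le> \<epsilon> * L * dist x z"
    proof (intro allI)
      fix x z
      have "dist (y - (\<epsilon> * \<rho> x) *\<^sub>R b) (y - (\<epsilon> * \<rho> z) *\<^sub>R b) = \<epsilon> * \<bar>\<rho> x - \<rho> z\<bar>"
        using b \<epsilon> by (simp add: dist_norm scaleR_diff_left[symmetric] right_diff_distrib[symmetric]
            abs_mult abs_minus_commute)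
      then show "dist (y - (\<epsilon> * \<rho> x) *\<^sub>R b) (y - (\<epsilon> * \<rho> z) *\<^sub>R b) \<le> \<epsilon> * L * dist x z"
        using mult_left_mono[OF lip[of x z] \<epsilon>(1)] by (simp add: dist_norm mult.assoc)
    qed
  qed (use \<epsilon> L0 in auto)
  moreover have "?\<psi> z = y \<longleftrightarrow> y - (\<epsilon> * \<rho> z) *\<^sub>R b = z" for y z
    by (auto simp: algebra_simps)
  ultimately have ex1: "\<exists>!z. ?\<psi> z = y" for y
    by simp
  define \<phi> where "\<phi> y = (THE z. ?\<psi> z = y)" for y
  have \<psi>\<phi>: "?\<psi> (\<phi> y) = y" for y
    unfolding \<phi>_def by (rule theI'[OF ex1])
  have \<phi>\<psi>: "\<phi> (?\<psi> z) = z" for z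
    unfolding \<phi>_def by (rule the1_equality[OF ex1]) simp
  let ?G = "\<lambda>z v. v - (\<epsilon> * D z v / (1 + \<epsilon> * D z b)) *\<^sub>R b"
  have cont: "continuous_on UNIV \<phi>"
  proof -
    have "norm (\<phi> x - \<phi> y) * (1 - \<epsilon> * L) \<le> norm (x - y)" for x y
    proof -
      have "\<phi> x - \<phi> y = (x - y) - (\<epsilon> * (\<rho> (\<phi> x) - \<rho> (\<phi> y))) *\<^sub>R b"
        using \<psi>\<phi>[of x] \<psi>\<phi>[of y] by (simp add: algebra_simps)
      then have "norm (\<phi> x - \<phi> y) \<le> norm (x - y) + \<epsilon> * \<bar>\<rho> (\<phi> x) - \<rho> (\<phi> y)\<bar>"
        using norm_triangle_ineq4[of "x - y" "(\<epsilon> * (\<rho> (\<phi> x) - \<rho> (\<phi> y))) *\<^sub>R b"] b \<epsilon>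
        by (simp add: abs_mult)
      also have "\<dots> \<le> norm (x - y) + \<epsilon> * (L * norm (\<phi> x - \<phi> y))"
        using lip \<epsilon>(1) by (simp add: mult_left_mono)
      finally show ?thesis by (simp add: algebra_simps)
    qed
    then have "(1 / (1 - \<epsilon> * L))-lipschitz_on UNIV \<phi>"
      using \<epsilon> by (intro lipschitz_onI) (auto simp: dist_norm field_simps)
    then show ?thesis by (rule lipschitz_on_continuous_on)
  qed
  have \<phi>der: "(\<phi> has_derivative ?G (\<phi> y)) (at y)" for y
  proof -
    let ?P = "\<lambda>v. v + (\<epsilon> * D (\<phi> y) v) *\<^sub>R b"
    have P: "(?\<psi> has_derivative ?P) (at (\<phi> y))"
      by (auto intro!: derivative_eq_intros der)
    show ?thesis
    proof (rule has_derivative_inverse_basic[where f = ?\<psi> and g = \<phi> and y = y and T = UNIV, OF P])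
      have "bounded_linear (D (\<phi> y))" using der has_derivative_bounded_linear by blast
      then show "bounded_linear (?G (\<phi> y))"
        by (intro bounded_linear_sub bounded_linear_ident bounded_linear_scaleR_const)
          (simp add: bounded_linear_mult_const bounded_linear_const_mult divide_inverse)
      show "?G (\<phi> y) \<circ> ?P = id"
      proof
        fix v
        have "D (\<phi> y) (?P v) = D (\<phi> y) v * (1 + \<epsilon> * D (\<phi> y) b)"
          using lin[of "\<phi> y"] by (simp add: linear_add linear_cmul algebra_simps)
        then show "(?G (\<phi> y) \<circ> ?P) v = id v" using pos[of "\<phi> y"] by simp
      qed
      show "isCont \<phi> y" using cont by (simp add: continuous_on_eq_continuous_at)
    qed (use \<psi>\<phi> in auto)
  qed
  have smD: "Ck_on k UNIV (\<lambda>z. D z v)" for k v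
    using \<rho>(1) Ck_on_deriv unfolding smooth_on_def D_def by blast
  have "Ck_on k UNIV \<phi>" for k
  proof (induction k)
    case 0
    then show ?case using cont by simp
  next
    case (Suc k)
    show ?case
    proof (rule Ck_on_SucI[OF open_UNIV \<phi>der])
      fix v
      have c: "Ck_on k UNIV (\<lambda>y. D (\<phi> y) u)" for u
        by (rule Ck_on_compose[OF open_UNIV smD Suc]) simp
      have "Ck_on k UNIV (\<lambda>y. v + ((- \<epsilon>) * (D (\<phi> y) v * inverse (1 + \<epsilon> * D (\<phi> y) b))) *\<^sub>R b)"
        using pos by (intro Ck_on_add Ck_on_scaleR Ck_on_mult Ck_on_inverse c Ck_on_const open_UNIV)
          (metis less_irrefl)
      then show "Ck_on k UNIV (\<lambda>y. ?G (\<phi> y) v)"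
        by (simp add: divide_inverse mult.assoc)
    qed
  qed
  then have "smooth_on UNIV \<phi>" by (simp add: smooth_on_def)
  then show ?thesis using that[of \<phi>] \<phi>\<psi> \<psi>\<phi> by blast
qed

section \<open>Lipschitz functions with a derivative of known sign\<close>

lemma AE_lebesgue_iff_negligible:
  fixes P :: "'a::euclidean_space \<Rightarrow> bool"
  shows "(AE t in lebesgue. P t) \<longleftrightarrow> negligible {t. \<not> P t}"
proof
  assume "AE t in lebesgue. P t"
  then obtain N where "N \<in> null_sets lebesgue" "{t. \<not> P t} \<subseteq> N"
    by (auto simp: eventually_ae_filter)
  then show "negligible {t. \<not> P t}"
    using negligible_iff_null_sets negligible_subset by blast
next
  assume "negligible {t. \<not> P t}"
  then show "AE t in lebesgue. P t"
    unfolding eventually_ae_filter by (auto simp: negligible_iff_null_sets)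
qed

lemma AE_lebesgue_open_ex:
  fixes P :: "'a::euclidean_space \<Rightarrow> bool"
  assumes "AE t in lebesgue. P t" "open S" "S \<noteq> {}"
  obtains t where "t \<in> S" "P t"
proof -
  have "\<not> S \<subseteq> {t. \<not> P t}"
    using assms open_not_negligible negligible_subset unfolding AE_lebesgue_iff_negligible by blast
  then show ?thesis using that by blast
qed

text \<open>If \<open>f b < f a\<close>, a small linear perturbation \<open>g\<close> of \<open>f\<close>
  has a positive derivative outside a null set \<open>N\<close> and still satisfies \<open>g b <
  g a\<close>. As \<open>g\<close> is Lipschitz, \<open>g ` N\<close> is null, so some value
  \<open>y\<close> between \<open>g b\<close> and \<open>g a\<close> is not attained on
  \<open>N\<close>. At the last point where \<open>g\<close> is at least \<open>y\<close> its
  derivative is positive, although \<open>g\<close> is below \<open>y\<close> to the right of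
  this point.\<close>

lemma lipschitz_AE_deriv_nonneg_imp_le:
  fixes f :: "real \<Rightarrow> real"
  assumes ab: "a \<le> b" and lip: "L-lipschitz_on {a..b} f"
    and ae: "AE t in lebesgue. t \<in> {a..b} \<longrightarrow> (\<exists>D\<ge>0. (f has_real_derivative D) (at t))"
  shows "f a \<le> f b"
proof (rule ccontr)
  assume "\<not> f a \<le> f b"
  then have lt: "f b < f a" and ab': "a < b" using ab by (auto simp: order.order_iff_strict)
  define e where "e = (f a - f b) / (2 * (b - a))"
  have e: "e > 0" using lt ab' by (simp add: e_def)
  define g where "g t = f t + e * (t - a)" for t
  have gab: "g b < g a"
  proof -
    have "e * (2 * (b - a)) = f a - f b" using ab' unfolding e_def by simp
    then have "2 * (e * (b - a)) = f a - f b" by (simp add: algebra_simps)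
    then show ?thesis using lt unfolding g_def by simp
  qed
  have contf: "continuous_on {a..b} f" using lip by (rule lipschitz_on_continuous_on)
  have contg: "continuous_on {a..b} g"
    unfolding g_def by (intro continuous_intros contf)
  define N where "N = {t \<in> {a..b}. \<not> (\<exists>D\<ge>0. (f has_real_derivative D) (at t))}"
  have "negligible N"
    using ae unfolding AE_lebesgue_iff_negligible by (simp add: N_def)
  have "negligible (g ` N)"
  proof (rule negligible_locally_Lipschitz_image[OF _ \<open>negligible N\<close>])
    fix x assume "x \<in> N"
    have "norm (g y - g x) \<le> (L + e) * norm (y - x)" if "y \<in> N" for y
    proof -
      have "norm (f y - f x) \<le> L * norm (y - x)"
        using lipschitz_onD[OF lip, of y x] that \<open>x \<in> N\<close> by (simp add: N_def dist_norm)
      moreover have "norm (g y - g x) \<le> norm (f y - f x) + norm (e * (y - x))"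
        using norm_triangle_ineq[of "f y - f x" "e * (y - x)"] by (simp add: g_def algebra_simps)
      moreover have "norm (e * (y - x)) = e * norm (y - x)" using e by (simp add: abs_mult)
      ultimately have "norm (g y - g x) \<le> L * norm (y - x) + e * norm (y - x)"
        by linarith
      then show ?thesis by (simp only: distrib_right)
    qed
    then show "\<exists>T B. open T \<and> x \<in> T \<and> (\<forall>y\<in>N \<inter> T. norm (g y - g x) \<le> B * norm (y - x))"
      by (intro exI[of _ UNIV] exI[of _ "L + e"]) auto
  qed simp
  moreover have "\<not> negligible {g b<..<g a}"
    using open_not_negligible[of "{g b<..<g a}"] gab by auto
  ultimately obtain y where y: "g b < y" "y < g a" "y \<notin> g ` N"
    using negligible_subset by (metis greaterThanLessThan_iff subsetI)
  define Z where "Z = {t \<in> {a..b}. y \<le> g t}"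
  have Zne: "a \<in> Z" using y ab' by (simp add: Z_def)
  have "closed Z"
    unfolding Z_def using continuous_closed_preimage[OF contg closed_atLeastAtMost, of "{y..}"]
    by (simp add: vimage_def Int_def)
  then have "compact Z"
  proof -
    assume "closed Z"
    have "{a..b} \<inter> Z = Z" by (auto simp: Z_def)
    with compact_Int_closed[OF compact_Icc[of a b] \<open>closed Z\<close>] show ?thesis by simp
  qed
  then obtain s where s: "s \<in> Z" "\<And>t. t \<in> Z \<Longrightarrow> t \<le> s"
    using compact_attains_sup[of Z] Zne by auto
  have sab: "s \<in> {a..b}" "y \<le> g s" "s < b"
    using s(1) y(1) by (auto simp: Z_def order.order_iff_strict)
  have below: "g t < y" if "s < t" "t \<le> b" for t
    using s(2)[of t] that sab by (force simp: Z_def)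
  have "g s \<le> y"
  proof (rule tendsto_upperbound)
    show "(g \<longlongrightarrow> g s) (at_right s)"
    proof -
      have "continuous_on {s..b} g" by (rule continuous_on_subset[OF contg]) (use sab in auto)
      then have "(g \<longlongrightarrow> g s) (at s within {s..b})" using sab(3) by (simp add: continuous_on)
      then show ?thesis using at_within_Icc_at_right[OF sab(3)] by simp
    qed
    show "\<forall>\<^sub>F t in at_right s. g t \<le> y"
      unfolding eventually_at_right_field using sab(3) below
          by (intro exI[of _ b]) (auto intro: less_imp_le)
  qed simp
  with sab have gs: "g s = y" by simp
  then have "s \<notin> N" using y(3) by blast
  then obtain D where D: "D \<ge> 0" "(f has_real_derivative D) (at s)"
    using sab(1) by (auto simp: N_def)
  then have "(g has_real_derivative D + e) (at s)"
    unfolding g_def by (auto intro!: derivative_eq_intros)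
  moreover have "D + e > 0" using D e by simp
  ultimately obtain d where d: "d > 0" "\<And>h. h > 0 \<Longrightarrow> h < d \<Longrightarrow> g s < g (s + h)"
    using DERIV_pos_inc_right by blast
  define h where "h = min (d/2) (b - s)"
  have "h > 0" "h < d" "s + h \<le> b" using d sab by (auto simp: h_def min_def)
  then show False using d(2)[of h] below[of "s + h"] gs by simp
qed

text \<open>By monotonicity, equal end values would make \<open>f\<close> constant, with derivative
  \<open>0\<close>.\<close>

lemma lipschitz_AE_deriv_pos_imp_less:
  fixes f :: "real \<Rightarrow> real"
  assumes ab: "a < b" and lip: "L-lipschitz_on {a..b} f"
    and ae: "AE t in lebesgue. t \<in> {a..b} \<longrightarrow> (\<exists>D>0. (f has_real_derivative D) (at t))"
  shows "f a < f b"
proof -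
  have le: "f s \<le> f t" if "a \<le> s" "s \<le> t" "t \<le> b" for s t
  proof (rule lipschitz_AE_deriv_nonneg_imp_le[OF that(2)])
    show "L-lipschitz_on {s..t} f" by (rule lipschitz_on_subset[OF lip]) (use that in auto)
    show "AE x in lebesgue. x \<in> {s..t} \<longrightarrow> (\<exists>D\<ge>0. (f has_real_derivative D) (at x))"
      using ae by (rule AE_mp, intro AE_I2) (use that in \<open>auto intro: less_imp_le\<close>)
  qed
  have "f a \<noteq> f b"
  proof
    assume "f a = f b"
    then have const: "f t = f a" if "t \<in> {a<..<b}" for t
      using le[of a t] le[of t b] that by auto
    obtain t where t0: "t \<in> {a<..<b}" "t \<in> {a..b} \<longrightarrow> (\<exists>D>0. (f has_real_derivative D) (at t))"
      by (rule AE_lebesgue_open_ex[OF ae, of "{a<..<b}"]) (use ab in auto)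
    then obtain D where t: "t \<in> {a<..<b}" "D > 0" "(f has_real_derivative D) (at t)" by auto
    have "((\<lambda>_. f a) has_real_derivative 0) (at t)" by simp
    then have "(f has_real_derivative 0) (at t)"
      by (rule has_field_derivative_transform_within_open[of _ _ _ "{a<..<b}"]) (use t const in
          auto)
    then show False using DERIV_unique t by fastforce
  qed
  then show ?thesis using le[of a b] ab by simp
qed

lemma AE_lebesgue_affine:
  fixes \<tau> :: real
  assumes "AE t in lebesgue. P t" "\<tau> \<noteq> 0"
  shows "AE s in lebesgue. P (t0 + \<tau> * s)"
proof -
  have N: "negligible {t. \<not> P t}" using assms(1) by (simp only: AE_lebesgue_iff_negligible)
  have "negligible ((\<lambda>t. (t - t0) / \<tau>) ` {t. \<not> P t})"
  proof (rule negligible_locally_Lipschitz_image[OF _ N])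
    fix x
    have "norm ((y - t0) / \<tau> - (x - t0) / \<tau>) \<le> (1 / \<bar>\<tau>\<bar>) * norm (y - x)" for y
      by (simp add: diff_divide_distrib[symmetric])
    then show "\<exists>T B. open T \<and> x \<in> T \<and>
        (\<forall>y\<in>{t. \<not> P t} \<inter> T. norm ((y - t0) / \<tau> - (x - t0) / \<tau>) \<le> B * norm (y - x))"
      by (intro exI[of _ UNIV] exI[of _ "1 / \<bar>\<tau>\<bar>"]) auto
  qed simp
  moreover have "{s. \<not> P (t0 + \<tau> * s)} \<subseteq> (\<lambda>t. (t - t0) / \<tau>) ` {t. \<not> P t}"
  proof
    fix s assume "s \<in> {s. \<not> P (t0 + \<tau> * s)}"
    then show "s \<in> (\<lambda>t. (t - t0) / \<tau>) ` {t. \<not> P t}"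
      using assms(2) by (intro image_eqI[of _ _ "t0 + \<tau> * s"]) auto
  qed
  ultimately show ?thesis unfolding AE_lebesgue_iff_negligible by (rule negligible_subset)
qed

lemma lipschitz_on_inner:
  fixes \<beta> :: "real \<Rightarrow> 'a::real_inner"
  assumes lip: "L-lipschitz_on I \<beta>"
  shows "(norm p * L)-lipschitz_on I (\<lambda>x. p \<bullet> \<beta> x)"
proof (rule lipschitz_onI)
  fix x y assume xy: "x \<in> I" "y \<in> I"
  have "\<bar>p \<bullet> \<beta> x - p \<bullet> \<beta> y\<bar> \<le> norm p * norm (\<beta> x - \<beta> y)"
    using Cauchy_Schwarz_ineq2[of p "\<beta> x - \<beta> y"] by (simp add: inner_diff_right)
  also have "\<dots> \<le> norm p * (L * norm (x - y))"
    using lipschitz_onD[OF lip xy] by (intro mult_left_mono) (auto simp: dist_norm)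
  finally show "dist (p \<bullet> \<beta> x) (p \<bullet> \<beta> y) \<le> norm p * L * dist x y"
      by (simp add: dist_norm mult.assoc)
qed (use lipschitz_on_nonneg[OF lip] in simp)

lemma inner_increasing_along_curve:
  fixes \<beta> :: "real \<Rightarrow> 'a::euclidean_space"
  assumes lip: "L-lipschitz_on {a..b} \<beta>"
    and ae: "AE t in lebesgue. t \<in> {a..b} \<longrightarrow> (\<exists>w. p \<bullet> w > 0 \<and> (\<beta> has_vector_derivative w) (at t))"
    and st: "a \<le> s" "s < t" "t \<le> b"
  shows "p \<bullet> \<beta> s < p \<bullet> \<beta> t"
proof (rule lipschitz_AE_deriv_pos_imp_less[OF st(2)])
  show "(norm p * L)-lipschitz_on {s..t} (\<lambda>x. p \<bullet> \<beta> x)"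
    by (rule lipschitz_on_subset[OF lipschitz_on_inner[OF lip]]) (use st in auto)
  show "AE x in lebesgue. x \<in> {s..t} \<longrightarrow> (\<exists>D>0. ((\<lambda>x. p \<bullet> \<beta> x) has_real_derivative D) (at x))"
    using ae
  proof (rule AE_mp, intro AE_I2 impI)
    fix x assume "x \<in> {a..b} \<longrightarrow> (\<exists>w. p \<bullet> w > 0 \<and> (\<beta> has_vector_derivative w) (at x))" "x \<in> {s..t}"
    then obtain w where w: "p \<bullet> w > 0" "(\<beta> has_vector_derivative w) (at x)" using st by auto
    then have "((\<lambda>x. p \<bullet> \<beta> x) has_real_derivative (p \<bullet> w)) (at x)"
      unfolding has_real_derivative_iff_has_vector_derivative has_vector_derivative_def
      by (auto intro!: derivative_eq_intros)
    then show "\<exists>D>0. ((\<lambda>x. p \<bullet> \<beta> x) has_real_derivative D) (at x)" using w(1) by blast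
  qed
qed



section \<open>Locally finite covers\<close>

lemma exhaustion_by_relatively_compact:
  assumes lc: "\<And>x::'m::{t2_space, second_countable_topology}. \<exists>U K. open U \<and> x \<in> U \<and> U \<subseteq> K
      \<and> compact K"
  obtains G :: "nat \<Rightarrow> 'm::{t2_space, second_countable_topology} set"
      where "\<And>n. open (G n)" "\<And>n. compact (closure (G n))"
    "\<And>n. closure (G n) \<subseteq> G (Suc n)" "(\<Union>n. G n) = UNIV"
proof -
  obtain U K where UK: "\<And>x::'m. open (U x)" "\<And>x. x \<in> U x" "\<And>x. U x \<subseteq> K x" "\<And>x. compact (K x)"
    using lc by metis
  have ccl: "compact (closure S)" if "S \<subseteq> T" "compact T" for S T :: "'m set"
  proof -
    have "T \<inter> closure S = closure S"
      using closure_minimal[OF that(1) compact_imp_closed[OF that(2)]] by blast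
    then show ?thesis using compact_Int_closed[OF that(2) closed_closure[of S]] by simp
  qed
  obtain F where F: "F \<subseteq> range U" "countable F" "\<Union>F = (\<Union>x. U x)"
    using Lindelof[of "range U"] UK(1) by (metis rangeE)
  have "F \<noteq> {}" using F(3) UK(2) by blast
  define V where "V i = from_nat_into F i" for i
  have rV: "range V = F" unfolding V_def using F(2) \<open>F \<noteq> {}\<close> by (simp add: range_from_nat_into)
  have Vo: "open (V i)" and Vc: "compact (closure (V i))" for i
    using rV F(1) UK ccl by (metis rangeE rangeI subsetD)+
  have Vcov: "\<exists>i. x \<in> V i" for x using rV F(3) UK(2) by (metis UNIV_I UN_I UnionE rangeE)
  define W where "W n = (\<Union>i<n. V i)" for n
  have Wo: "open (W n)" for n unfolding W_def using Vo by auto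
  have Wm: "W m \<subseteq> W n" if "m \<le> n" for m n
    unfolding W_def using that by (intro UN_mono) auto
  have Wc: "compact (closure (W n))" for n
  proof -
    have "W n \<subseteq> (\<Union>i<n. closure (V i))" unfolding W_def using closure_subset by blast
    moreover have "compact (\<Union>i<n. closure (V i))" using Vc by auto
    ultimately show ?thesis by (rule ccl)
  qed
  have Wcov: "\<exists>n. x \<in> W n" for x using Vcov[of x] by (auto simp: W_def)
  have "\<exists>m>n. closure (W n) \<subseteq> W m" for n
  proof -
    obtain I where I: "finite I" "closure (W n) \<subseteq> (\<Union>i\<in>I. W i)"
      using compactE_image[OF Wc[of n], of UNIV W] Wo Wcov by (metis UNIV_I UN_I subsetI)
    let ?m = "Suc (Max (insert n I))"
    have "W i \<subseteq> W ?m" if "i \<in> I" for i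
      using I(1) that by (intro Wm) (meson Max_ge finite.insertI insertI2 le_SucI)
    moreover have "?m > n" using I(1) by (meson Max_ge finite.insertI insertI1 le_imp_less_Suc)
    ultimately show ?thesis using I(2) by blast
  qed
  then obtain g where g: "\<And>n. g n > n" "\<And>n. closure (W n) \<subseteq> W (g n)" by metis
  define G where "G k = W ((g ^^ k) 0)" for k
  have gk: "k \<le> (g ^^ k) 0" for k
    by (induction k) (auto intro: Suc_leI le_less_trans g)
  show ?thesis
  proof (rule that)
    show "(\<Union>n. G n) = UNIV"
    proof -
      have "\<exists>n. x \<in> G n" for x using Wcov[of x] Wm[OF gk] unfolding G_def by blast
      then show ?thesis by blast
    qed
  qed (use Wo Wc g(2) in \<open>auto simp: G_def\<close>)
qed

text \<open>Pieces are pairs of an open set \<open>V\<close>, used for covering, and a set \<open>K\<close>,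
  used for local finiteness. They are constrained only by an abstract property \<open>Q\<close>,
  so that the lemma serves cone constraints, spindles around curves and pushes of a boundary
  alike. The part of \<open>D\<close> in the \<open>n\<close>th shell of an exhaustion is
  covered by finitely many pieces that avoid the shells with index below \<open>n - 1\<close>.\<close>

lemma locally_finite_cover:
  fixes D :: "'m::{t2_space, second_countable_topology} set"
  assumes lc: "\<And>x::'m. \<exists>U K. open U \<and> x \<in> U \<and> U \<subseteq> K \<and> compact K"
    and "closed D"
    and loc: "\<And>x W. x \<in> D \<Longrightarrow> open W \<Longrightarrow> x \<in> W \<Longrightarrow> \<exists>V K. Q V K \<and> open V \<and> x \<in> V \<and> K \<subseteq> W"
  obtains \<F> where "countable \<F>" "\<forall>q\<in>\<F>. Q (fst q) (snd q) \<and> open (fst q)" "D \<subseteq> \<Union> (fst ` \<F>)"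
    "\<forall>x. \<exists>N. open N \<and> x \<in> N \<and> finite {p \<in> \<F>. snd p \<inter> N \<noteq> {}}"
proof -
  obtain G :: "nat \<Rightarrow> 'm set" where G: "\<And>n. open (G n)" "\<And>n. compact (closure (G n))"
    "\<And>n. closure (G n) \<subseteq> G (Suc n)" "(\<Union>n. G n) = UNIV"
    using exhaustion_by_relatively_compact[OF lc] by metis
  have Gm: "G m \<subseteq> G n" if "m \<le> n" for m n
    using that by (induction rule: dec_induct) (use G(3) closure_subset in blast)+
  define R where "R n = D \<inter> closure (G n) - (\<Union>m<n. G m)" for n
  have Rc: "compact (R n)" for n
  proof -
    have "R n = closure (G n) \<inter> (D - (\<Union>m<n. G m))" by (auto simp: R_def)
    moreover have "closed (D - (\<Union>m<n. G m))" using \<open>closed D\<close> G(1) by (intro closed_Diff) auto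
    ultimately show ?thesis using G(2)[of n] compact_Int_closed by metis
  qed
  have "\<exists>V K. Q V K \<and> open V \<and> x \<in> V \<and> (\<forall>m<n. Suc m < n \<longrightarrow> K \<inter> G m = {})" if "x \<in> R n" for x n
  proof -
    let ?W = "if n < 2 then UNIV else - closure (G (n - 2))"
    have xW: "x \<in> ?W"
    proof (cases "n < 2")
      case False
      then have "closure (G (n - 2)) \<subseteq> G (n - 1)" using G(3)[of "n - 2"]
          by (simp add: numeral_2_eq_2 Suc_diff_Suc)
      moreover have "x \<notin> G (n - 1)" using that False by (auto simp: R_def)
      ultimately show ?thesis using False by auto
    qed simp
    have oW: "open ?W" by auto
    have "x \<in> D" using that by (simp add: R_def)
    from loc[OF this oW xW] obtain V K where VK: "Q V K" "open V" "x \<in> V" "K \<subseteq> ?W"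
      by (elim exE conjE)
    have "K \<inter> G m = {}" if "Suc m < n" for m
    proof -
      have "G m \<subseteq> closure (G (n - 2))" using Gm[of m "n - 2"] closure_subset that by fastforce
      then show ?thesis using VK(4) that by auto
    qed
    then show ?thesis using VK by blast
  qed
  then obtain V K where VK: "\<And>x n. x \<in> R n \<Longrightarrow> Q (V x n) (K x n) \<and> open (V x n) \<and> x \<in> V x n \<and>
      (\<forall>m<n. Suc m < n \<longrightarrow> K x n \<inter> G m = {})"
    by metis
  have "\<exists>X. finite X \<and> X \<subseteq> R n \<and> R n \<subseteq> (\<Union>x\<in>X. V x n)" for n
  proof -
    have "\<And>x. x \<in> R n \<Longrightarrow> open (V x n)" "R n \<subseteq> (\<Union>x\<in>R n. V x n)" using VK by blast+
    from compactE_image[OF Rc[of n] this] show ?thesis by metis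
  qed
  then obtain X where X: "\<And>n. finite (X n)" "\<And>n. X n \<subseteq> R n" "\<And>n. R n \<subseteq> (\<Union>x\<in>X n. V x n)" by metis
  define \<F> where "\<F> = (\<Union>n. (\<lambda>x. (V x n, K x n)) ` X n)"
  have cov: "\<exists>n. x \<in> R n" if "x \<in> D" for x
  proof -
    have ex: "\<exists>n. x \<in> G n" using G(4) by auto
    define n where "n = (LEAST n. x \<in> G n)"
    have "x \<in> G n" unfolding n_def using ex by (rule LeastI_ex)
    moreover have "x \<notin> G m" if "m < n" for m using that not_less_Least unfolding n_def by blast
    ultimately have "x \<in> R n" using that closure_subset by (auto simp: R_def)
    then show ?thesis by blast
  qed
  show ?thesis
  proof (rule that)
    show "countable \<F>" unfolding \<F>_def using X(1) by (auto intro: countable_finite)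
    show "\<forall>q\<in>\<F>. Q (fst q) (snd q) \<and> open (fst q)"
      using VK X(2) unfolding \<F>_def by fastforce
    show "D \<subseteq> \<Union> (fst ` \<F>)"
    proof
      fix x assume "x \<in> D"
      then obtain n where "x \<in> R n" using cov by blast
      then obtain y where "y \<in> X n" "x \<in> V y n" using X(3) by blast
      then show "x \<in> \<Union> (fst ` \<F>)" unfolding \<F>_def by force
    qed
    show "\<forall>x. \<exists>N. open N \<and> x \<in> N \<and> finite {p \<in> \<F>. snd p \<inter> N \<noteq> {}}"
    proof
    fix x
    obtain m where m: "x \<in> G m" using G(4) by auto
    have "{p \<in> \<F>. snd p \<inter> G m \<noteq> {}} \<subseteq> (\<Union>n\<le>Suc m. (\<lambda>x. (V x n, K x n)) ` X n)"
    proof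
      fix p assume p: "p \<in> {p \<in> \<F>. snd p \<inter> G m \<noteq> {}}"
      then obtain n y where "y \<in> X n" "p = (V y n, K y n)"
        unfolding \<F>_def by blast
      moreover from this p have "K y n \<inter> G m \<noteq> {}" by auto
      moreover have "n \<le> Suc m"
      proof (rule ccontr)
        assume "\<not> n \<le> Suc m"
        then have "m < n" "Suc m < n" by auto
        moreover have "y \<in> R n" using X(2) \<open>y \<in> X n\<close> by blast
        ultimately have "K y n \<inter> G m = {}" using VK[of y n] by blast
        then show False using \<open>K y n \<inter> G m \<noteq> {}\<close> by simp
      qed
      ultimately show "p \<in> (\<Union>n\<le>Suc m. (\<lambda>x. (V x n, K x n)) ` X n)" by blast
    qed
    moreover have "finite (\<Union>n\<le>Suc m. (\<lambda>x. (V x n, K x n)) ` X n)" using X(1) by auto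
    ultimately have "finite {p \<in> \<F>. snd p \<inter> G m \<noteq> {}}" by (rule finite_subset)
    then show "\<exists>N. open N \<and> x \<in> N \<and> finite {p \<in> \<F>. snd p \<inter> N \<noteq> {}}"
      using G(1) m by blast
    qed
  qed
qed

lemma openin_Int_finite_INT:
  assumes "finite J" "openin X T" "\<And>j. j \<in> J \<Longrightarrow> openin X (U j)"
  shows "openin X (T \<inter> (\<Inter>j\<in>J. U j))"
  using assms(1,3)
proof (induction J rule: finite_induct)
  case (insert j J)
  have "openin X ((T \<inter> (\<Inter>j\<in>J. U j)) \<inter> U j)"
    by (rule openin_Int[OF insert.IH]) (use insert.prems in auto)
  moreover have "(T \<inter> (\<Inter>j\<in>J. U j)) \<inter> U j = T \<inter> (\<Inter>j\<in>insert j J. U j)" by auto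
  ultimately show ?case by simp
qed (use assms(2) in simp)



section \<open>Charts and coordinates of tangent vectors\<close>

abbreviation chart_inv :: "('m, 'e) chart \<Rightarrow> 'e \<Rightarrow> 'm" where
  "chart_inv c \<equiv> inv_into (dom_chart c) (coord c)"

abbreviation chart_ran :: "('m, 'e) chart \<Rightarrow> 'e set" where
  "chart_ran c \<equiv> coord c ` dom_chart c"

lemma transition_eq: "transition c d z = coord d (chart_inv c z)"
  by (simp add: transition_def)

lemma chart_inj: "is_chart c \<Longrightarrow> inj_on (coord c) (dom_chart c)"
  unfolding is_chart_def homeomorphism_def by (metis inj_on_inverseI)

lemma chart_inv_coord [simp]: "is_chart c \<Longrightarrow> x \<in> dom_chart c \<Longrightarrow> chart_inv c (coord c x) = x"
  by (simp add: chart_inj)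

lemma chart_continuous: "is_chart c \<Longrightarrow> continuous_on (dom_chart c) (coord c)"
  by (auto simp: is_chart_def homeomorphism_def)

lemma chart_inv_continuous:
  assumes "is_chart c"
  shows "continuous_on (chart_ran c) (chart_inv c)"
proof -
  obtain g where g: "homeomorphism (dom_chart c) (chart_ran c) (coord c) g"
    using assms by (auto simp: is_chart_def)
  have "continuous_on (chart_ran c) g" using g by (simp add: homeomorphism_def)
  moreover have "g z = chart_inv c z" if "z \<in> chart_ran c" for z
    using that g assms by (auto simp: homeomorphism_def)
  ultimately show ?thesis by (rule continuous_on_eq)
qed

lemma coord_in_image_iff:
  assumes "is_chart c" "x \<in> dom_chart c" "U \<subseteq> dom_chart c"
  shows "coord c x \<in> coord c ` U \<longleftrightarrow> x \<in> U"
  using inj_on_image_mem_iff[OF chart_inj] assms by metis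

lemma open_chart_dom: "is_chart c \<Longrightarrow> open (dom_chart c)"
  and open_chart_ran: "is_chart c \<Longrightarrow> open (chart_ran c)"
  by (simp_all add: is_chart_def)

lemma open_coord_image:
  assumes "is_chart c" "open U" "U \<subseteq> dom_chart c"
  shows "open (coord c ` U)"
proof -
  have "coord c ` U = chart_ran c \<inter> chart_inv c -` U"
    using assms by (auto simp: image_iff)
  moreover have "open \<dots>"
    using continuous_open_preimage[OF chart_inv_continuous open_chart_ran] assms by blast
  ultimately show ?thesis by simp
qed

lemma open_coord_vimage:
  assumes "is_chart c" "open W"
  shows "open (dom_chart c \<inter> coord c -` W)"
  using continuous_open_preimage[OF chart_continuous open_chart_dom] assms by blast

lemma is_chart_locally_compact:
  assumes "is_chart c" "x \<in> dom_chart c"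
  shows "\<exists>U K. open U \<and> x \<in> U \<and> U \<subseteq> K \<and> compact K"
proof -
  obtain r where r: "r > 0" "cball (coord c x) r \<subseteq> chart_ran c"
    using open_contains_cball_eq[OF open_chart_ran[OF assms(1)]] assms(2) by blast
  let ?U = "dom_chart c \<inter> coord c -` ball (coord c x) r"
      and ?K = "chart_inv c ` cball (coord c x) r"
  have "compact ?K"
    by (intro compact_continuous_image compact_cball continuous_on_subset[OF chart_inv_continuous]
        assms r)
  moreover have "?U \<subseteq> ?K"
  proof
    fix y assume "y \<in> ?U"
    then have "y = chart_inv c (coord c y)" "coord c y \<in> cball (coord c x) r"
      using assms(1) by auto
    then show "y \<in> ?K" by (rule image_eqI)
  qed
  ultimately show ?thesis using open_coord_vimage[OF assms(1) open_ball] assms(2) r(1)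
    by (intro exI[of _ ?U] exI[of _ ?K]) auto
qed

locale smooth_manifold =
  fixes A :: "('m::{t2_space, second_countable_topology}, 'e::euclidean_space) chart set"
  assumes atlas: "smooth_atlas A"
begin

lemma atlas_cover: obtains d where "d \<in> A" "x \<in> dom_chart d"
  using atlas unfolding smooth_atlas_def by blast

lemma atlas_max: "d \<in> A \<Longrightarrow> d \<in> maximal_atlas A"
  using atlas by (auto simp: smooth_atlas_def maximal_atlas_def)

lemma max_is_chart [simp]: "c \<in> maximal_atlas A \<Longrightarrow> is_chart c"
  by (simp add: maximal_atlas_def)

lemma manifold_locally_compact: "\<exists>U K. open U \<and> (x::'m) \<in> U \<and> U \<subseteq> K \<and> compact K"
  by (metis atlas_cover atlas_max is_chart_locally_compact max_is_chart)

lemma smooth_transition_atlas: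
  assumes "c \<in> maximal_atlas A" "d \<in> A"
  shows "Ck_on k (coord c ` (dom_chart c \<inter> dom_chart d)) (transition c d)"
    and "Ck_on k (coord d ` (dom_chart d \<inter> dom_chart c)) (transition d c)"
proof -
  have "smoothly_compatible c d" using assms unfolding maximal_atlas_def by blast
  then show "Ck_on k (coord c ` (dom_chart c \<inter> dom_chart d)) (transition c d)"
    "Ck_on k (coord d ` (dom_chart d \<inter> dom_chart c)) (transition d c)"
    unfolding smoothly_compatible_def smooth_on_def Int_commute[of "dom_chart d"] by blast+
qed

lemma smooth_transition:
  assumes c: "c \<in> maximal_atlas A" and d: "d \<in> maximal_atlas A"
  shows "Ck_on k (coord c ` (dom_chart c \<inter> dom_chart d)) (transition c d)"
proof (rule Ck_on_local)
  fix z assume "z \<in> coord c ` (dom_chart c \<inter> dom_chart d)"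
  then obtain x where x: "x \<in> dom_chart c" "x \<in> dom_chart d" "z = coord c x" by auto
  obtain e where e: "e \<in> A" "x \<in> dom_chart e" by (rule atlas_cover)
  let ?T = "coord c ` (dom_chart c \<inter> dom_chart d \<inter> dom_chart e)"
  have oT: "open ?T"
    using c d e atlas_max by (intro open_coord_image open_Int open_chart_dom max_is_chart) auto
  have 1: "Ck_on k ?T (transition c e)"
    by (rule Ck_on_subset[OF smooth_transition_atlas(1)[OF c e(1)]]) auto
  note 2 = smooth_transition_atlas(2)[OF d e(1), of k]
  have "Ck_on k ?T (\<lambda>z. transition e d (transition c e z))"
    by (rule Ck_on_compose[OF oT 2 1]) (use c in \<open>auto simp: transition_eq\<close>)
  moreover have "transition e d (transition c e z) = transition c d z" if "z \<in> ?T" for z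
    using that c atlas_max[OF e(1)] by (auto simp: transition_eq)
  ultimately have "Ck_on k ?T (transition c d)" 
    using Ck_on_cong[OF oT, of "\<lambda>z. transition e d (transition c e z)" "transition c d" k] by simp
  then show "\<exists>T. open T \<and> z \<in> T \<and> Ck_on k T (transition c d)" using oT x e by blast
qed

definition tdiff :: "('m, 'e) chart \<Rightarrow> ('m, 'e) chart \<Rightarrow> 'm \<Rightarrow> 'e \<Rightarrow> 'e" where
  "tdiff c d x = frechet_derivative (transition c d) (at (coord c x))"

lemma tdiff_has_derivative:
  assumes "c \<in> maximal_atlas A" "d \<in> maximal_atlas A" "x \<in> dom_chart c" "x \<in> dom_chart d"
  shows "(transition c d has_derivative tdiff c d x) (at (coord c x))"
  unfolding tdiff_def
  by (rule Ck_on_has_derivative[OF smooth_transition[OF assms(1,2), of "Suc 0"]]) (use assms in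
      auto)

lemma tdiff_linear:
  assumes "c \<in> maximal_atlas A" "d \<in> maximal_atlas A" "x \<in> dom_chart c" "x \<in> dom_chart d"
  shows "linear (tdiff c d x)"
  using tdiff_has_derivative[OF assms] has_derivative_linear by blast

lemma tdiff_compose:
  assumes "c \<in> maximal_atlas A" "d \<in> maximal_atlas A" "e \<in> maximal_atlas A"
    and x: "x \<in> dom_chart c" "x \<in> dom_chart d" "x \<in> dom_chart e"
  shows "tdiff d e x (tdiff c d x w) = tdiff c e x w"
proof -
  have cdx: "transition c d (coord c x) = coord d x" using assms by (simp add: transition_eq)
  have "((\<lambda>z. transition d e (transition c d z)) has_derivative (\<lambda>w. tdiff d e x (tdiff c d x w)))
      (at (coord c x))"
    by (rule has_derivative_compose[OF tdiff_has_derivative]) (use assms cdx tdiff_has_derivative in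
        auto)
  moreover have "open (coord c ` (dom_chart c \<inter> dom_chart d))"
    using assms by (intro open_coord_image open_Int open_chart_dom) auto
  ultimately have "(transition c e has_derivative (\<lambda>w. tdiff d e x (tdiff c d x w))) (at (coord c
      x))"
    by (rule has_derivative_transform_within_open) (use assms in \<open>auto simp: transition_eq\<close>)
  from has_derivative_unique[OF this tdiff_has_derivative] assms show ?thesis by metis
qed

lemma tdiff_self:
  assumes "c \<in> maximal_atlas A" "x \<in> dom_chart c"
  shows "tdiff c c x w = w"
proof -
  have "(transition c c has_derivative (\<lambda>w. w)) (at (coord c x))"
    by (rule has_derivative_transform_within_open[OF has_derivative_ident open_chart_ran[of c]])
      (use assms in \<open>auto simp: transition_eq\<close>)
  from has_derivative_unique[OF this tdiff_has_derivative] assms show ?thesis by metis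
qed

text \<open>The tangent vector at \<open>x\<close> with coordinates \<open>w\<close> in the chart
  \<open>c\<close>. Tangent vectors only record their coordinates in charts of \<open>A\<close>,
  while half space charts come from the maximal atlas; \<open>tv\<close> makes both kinds of
  charts available in the same way.\<close>

definition tv :: "('m, 'e) chart \<Rightarrow> 'm \<Rightarrow> 'e \<Rightarrow> ('m, 'e) tvec" where
  "tv c x w = (\<lambda>d. if d \<in> A \<and> x \<in> dom_chart d then tdiff c d x w else 0)"

lemma tv_tangent:
  assumes "c \<in> maximal_atlas A" "x \<in> dom_chart c"
  shows "tv c x w \<in> tangent_space A x"
  using assms tdiff_compose[OF assms(1) atlas_max atlas_max assms(2)]
  by (auto simp: tangent_space_def tv_def tdiff_def)

lemma tv_apply: "d \<in> A \<Longrightarrow> x \<in> dom_chart d \<Longrightarrow> tv c x w d = tdiff c d x w"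
  by (simp add: tv_def)

lemma tangent_space_outside: "v \<in> tangent_space A x \<Longrightarrow> \<not> (d \<in> A \<and> x \<in> dom_chart d) \<Longrightarrow> v d = 0"
  unfolding tangent_space_def by blast

lemma tangent_space_change:
  "v \<in> tangent_space A x \<Longrightarrow> c \<in> A \<Longrightarrow> d \<in> A \<Longrightarrow> x \<in> dom_chart c \<Longrightarrow> x \<in> dom_chart d \<Longrightarrow>
    v d = tdiff c d x (v c)"
  unfolding tangent_space_def tdiff_def by blast

lemma tangent_eq_tv:
  assumes "v \<in> tangent_space A x" "c \<in> A" "x \<in> dom_chart c"
  shows "v = tv c x (v c)"
proof
  fix d
  show "v d = tv c x (v c) d"
  proof (cases "d \<in> A \<and> x \<in> dom_chart d")
    case True
    then show ?thesis using tangent_space_change[OF assms(1,2) _ assms(3)] by (simp add: tv_def)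
  next
    case False
    then show ?thesis using tangent_space_outside[OF assms(1) False] by (auto simp: tv_def)
  qed
qed

lemma tv_change:
  assumes "c \<in> maximal_atlas A" "d \<in> maximal_atlas A" "x \<in> dom_chart c" "x \<in> dom_chart d"
  shows "tv c x w = tv d x (tdiff c d x w)"
  using tdiff_compose[OF assms(1,2) atlas_max assms(3,4)] by (auto simp: tv_def fun_eq_iff)

lemma tangent_eq_tv_max:
  assumes "v \<in> tangent_space A x" "c \<in> maximal_atlas A" "x \<in> dom_chart c"
  obtains w where "v = tv c x w"
proof -
  obtain d where d: "d \<in> A" "x \<in> dom_chart d" by (rule atlas_cover)
  then have "v = tv c x (tdiff d c x (v d))"
    using tangent_eq_tv[OF assms(1) d] tv_change[OF atlas_max[OF d(1)] assms(2) d(2) assms(3)]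
        by simp
  then show ?thesis by (rule that)
qed

lemma tv_linear:
  assumes "c \<in> maximal_atlas A" "x \<in> dom_chart c"
  shows "linear (tv c x)"
  using tdiff_linear[OF assms(1) atlas_max assms(2)]
  by (intro linearI) (auto simp: tv_def fun_eq_iff scaleR_fun_def linear_add linear_cmul)

lemma tv_eq_0_iff:
  assumes "c \<in> maximal_atlas A" "x \<in> dom_chart c"
  shows "tv c x w = 0 \<longleftrightarrow> w = 0"
proof
  assume 0: "tv c x w = 0"
  obtain d where d: "d \<in> A" "x \<in> dom_chart d" by (rule atlas_cover)
  have "tdiff c d x w = 0" using 0 tv_apply[OF d, of c w] by simp
  then have "tdiff c c x w = 0"
    using tdiff_compose[OF assms(1) atlas_max[OF d(1)] assms(1,2) d(2) assms(2), of w]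
      linear_0[OF tdiff_linear[OF atlas_max[OF d(1)] assms(1) d(2) assms(2)]] by simp
  then show "w = 0" using tdiff_self assms by simp
qed (use linear_0[OF tv_linear[OF assms]] in simp)

lemma openin_tangent_chart:
  assumes "c \<in> A" "open W"
  shows "openin (tangent_topology A)
    {(x, v). (x, v) \<in> tangent_bundle A \<and> x \<in> dom_chart c \<and> (coord c x, v c) \<in> W}"
  unfolding tangent_topology_def by (rule topology_generated_by_Basis) (use assms in blast)

lemma openin_tangent_over:
  assumes "open N"
  shows "openin (tangent_topology A) {(x, v). (x, v) \<in> tangent_bundle A \<and> x \<in> N}"
proof -
  let ?B = "\<lambda>c. {(x, v). (x, v) \<in> tangent_bundle A \<and> x \<in> dom_chart c
      \<and> (coord c x, v c) \<in> coord c ` (dom_chart c \<inter> N) \<times> UNIV}"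
  have "openin (tangent_topology A) (?B c)" if "c \<in> A" for c
    using that assms atlas_max
    by (intro openin_tangent_chart open_Times open_coord_image open_Int open_chart_dom) auto
  then have "openin (tangent_topology A) (\<Union>c\<in>A. ?B c)" by blast
  moreover have "(\<Union>c\<in>A. ?B c) = {(x, v). (x, v) \<in> tangent_bundle A \<and> x \<in> N}"
  proof (intro equalityI subsetI)
    fix p
    assume "p \<in> (\<Union>c\<in>A. ?B c)"
    then obtain c x v where "c \<in> A" "x \<in> dom_chart c" "p = (x, v)" "(x, v) \<in> tangent_bundle A"
      "coord c x \<in> coord c ` (dom_chart c \<inter> N)" by blast
    then show "p \<in> {(x, v). (x, v) \<in> tangent_bundle A \<and> x \<in> N}"
      using coord_in_image_iff[of c x "dom_chart c \<inter> N"] atlas_max by auto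
  next
    fix p
    assume "p \<in> {(x, v). (x, v) \<in> tangent_bundle A \<and> x \<in> N}"
    then obtain x v where x: "p = (x, v)" "(x, v) \<in> tangent_bundle A" "x \<in> N" by blast
    obtain c where "c \<in> A" "x \<in> dom_chart c" by (rule atlas_cover)
    then show "p \<in> (\<Union>c\<in>A. ?B c)" using x by auto
  qed
  ultimately show ?thesis by simp
qed

definition param :: "('m, 'e) chart \<Rightarrow> 'e \<times> 'e \<Rightarrow> 'm \<times> ('m, 'e) tvec" where
  "param c = (\<lambda>(z, w). (chart_inv c z, tv c (chart_inv c z) w))"

lemma param_in_bundle:
  "c \<in> maximal_atlas A \<Longrightarrow> z \<in> chart_ran c \<Longrightarrow> param c (z, w) \<in> tangent_bundle A"
  by (auto simp: param_def tangent_bundle_def tv_tangent)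

lemma continuous_on_transition_diff:
  assumes c: "c \<in> maximal_atlas A" and d: "d \<in> maximal_atlas A"
  shows "continuous_on (coord c ` (dom_chart c \<inter> dom_chart d) \<times> UNIV)
    (\<lambda>(z, w). (transition c d z, tdiff c d (chart_inv c z) w))"
proof -
  let ?S = "coord c ` (dom_chart c \<inter> dom_chart d)"
  have *: "continuous_on (?S \<times> UNIV) (\<lambda>(z, w). \<Sum>e\<in>Basis. (w \<bullet> e) *\<^sub>R frechet_derivative (transition
      c d) (at z) e)"
  proof -
    have "continuous_on ?S (\<lambda>z. frechet_derivative (transition c d) (at z) e)" for e
      using smooth_transition[OF c d, of "Suc 0"] by simp
    then show ?thesis
      unfolding case_prod_unfold
      by (intro continuous_intros continuous_on_compose2[OF _ continuous_on_fst[OF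
          continuous_on_id]])
        auto
  qed
  have "tdiff c d (chart_inv c z) w = (\<Sum>e\<in>Basis. (w \<bullet> e) *\<^sub>R frechet_derivative (transition c d) (at
      z) e)"
    if "z \<in> ?S" for z w
  proof -
    from that obtain x where x: "x \<in> dom_chart c" "x \<in> dom_chart d" "z = coord c x" by auto
    show ?thesis
      using linear_eq_sum_Basis[OF tdiff_linear[OF c d x(1,2)], of w] x c by (simp add: tdiff_def)
  qed
  then have "continuous_on (?S \<times> UNIV) (\<lambda>(z, w). tdiff c d (chart_inv c z) w)"
    by (intro continuous_on_eq[OF *]) auto
  moreover have "continuous_on (?S \<times> UNIV) (\<lambda>(z, w::'e). transition c d z)"
    using Ck_on_imp_continuous[OF smooth_transition[OF c d]]
    unfolding case_prod_unfold
    by (intro continuous_on_compose2[OF _ continuous_on_fst[OF continuous_on_id]]) auto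
  ultimately show ?thesis unfolding case_prod_unfold by (intro continuous_on_Pair)
qed

text \<open>Through this lemma, openness in the tangent bundle is only used as openness of sets of pairs of
  coordinates. It holds because the differential of a transition map depends continuously on
  point and vector.\<close>

lemma continuous_map_param:
  assumes c: "c \<in> maximal_atlas A"
  shows "continuous_map (top_of_set (chart_ran c \<times> UNIV)) (tangent_topology A) (param c)"
  unfolding tangent_topology_def
proof (rule continuous_on_generated_topo)
  fix U
  assume "U \<in> {{(x, v). (x, v) \<in> tangent_bundle A \<and> x \<in> dom_chart d \<and> (coord d x, v d) \<in> W}
       |d W. d \<in> A \<and> open W}"
  then obtain d W where dW: "d \<in> A" "open W"
    "U = {(x, v). (x, v) \<in> tangent_bundle A \<and> x \<in> dom_chart d \<and> (coord d x, v d) \<in> W}" by blast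
  let ?S = "coord c ` (dom_chart c \<inter> dom_chart d)"
  let ?f = "\<lambda>(z, w). (transition c d z, tdiff c d (chart_inv c z) w)"
  have dm: "d \<in> maximal_atlas A" using atlas_max dW by blast
  have oS: "open ?S"
    using c dm by (intro open_coord_image open_Int open_chart_dom) auto
  have "param c -` U \<inter> (chart_ran c \<times> UNIV) = (?S \<times> UNIV) \<inter> ?f -` W"
  proof -
    have "(z, w) \<in> param c -` U \<inter> (chart_ran c \<times> UNIV) \<longleftrightarrow> (z, w) \<in> (?S \<times> UNIV) \<inter> ?f -` W" for z w
    proof (cases "z \<in> chart_ran c")
      case True
      then obtain x where x: "x \<in> dom_chart c" "z = coord c x" by auto
      have "param c (z, w) \<in> tangent_bundle A" using param_in_bundle[OF c True] .
      moreover have "z \<in> ?S \<longleftrightarrow> x \<in> dom_chart d"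
        using coord_in_image_iff[of c x "dom_chart c \<inter> dom_chart d"] c x by auto
      ultimately show ?thesis
        using x c dW True by (cases "x \<in> dom_chart d") (simp_all add: param_def transition_eq
            tv_apply)
    qed auto
    then show ?thesis by (intro set_eqI, simp only: split_paired_all)
  qed
  moreover have "open ((?S \<times> UNIV) \<inter> ?f -` W)"
    by (intro continuous_open_preimage[OF continuous_on_transition_diff[OF c dm]] open_Times oS dW
        open_UNIV)
  ultimately have "open (param c -` U \<inter> (chart_ran c \<times> UNIV))" by simp
  from open_subset[OF Int_lower2 this]
  show "openin (top_of_set (chart_ran c \<times> UNIV))
     (param c -` U \<inter> topspace (top_of_set (chart_ran c \<times> UNIV)))" by simp
next
  have "param c ` topspace (top_of_set (chart_ran c \<times> UNIV)) \<subseteq> tangent_bundle A"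
    using param_in_bundle[OF c] by auto
  then show "param c ` topspace (top_of_set (chart_ran c \<times> UNIV))
    \<subseteq> \<Union> {{(x, v). (x, v) \<in> tangent_bundle A \<and> x \<in> dom_chart d \<and> (coord d x, v d) \<in> W}
       |d W. d \<in> A \<and> open W}"
    using topspace_tangent_topology[OF atlas] unfolding tangent_topology_def by simp
qed

lemma open_param_preimage:
  assumes "c \<in> maximal_atlas A" "openin (tangent_topology A) U"
  shows "open {(z, w). z \<in> chart_ran c \<and> param c (z, w) \<in> U}"
proof -
  have "openin (top_of_set (chart_ran c \<times> UNIV)) {p \<in> chart_ran c \<times> UNIV. param c p \<in> U}"
    using openin_continuous_map_preimage[OF continuous_map_param assms(2)] assms(1) by simp
  moreover have "open (chart_ran c \<times> (UNIV :: 'e set))"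
    using assms by (intro open_Times open_chart_ran) auto
  moreover have "{p \<in> chart_ran c \<times> UNIV. param c p \<in> U} = {(z, w). z \<in> chart_ran c
      \<and> param c (z, w) \<in> U}"
    by auto
  ultimately show ?thesis by (simp add: openin_open_trans)
qed


section \<open>Cone fields in coordinates\<close>

definition cone_at :: "('m, 'e) chart \<Rightarrow> ('m \<times> ('m, 'e) tvec) set \<Rightarrow> 'e \<Rightarrow> 'e set" where
  "cone_at c C z = {w. (chart_inv c z, tv c (chart_inv c z) w) \<in> C}"

lemma cone_at_mono: "C \<subseteq> C' \<Longrightarrow> cone_at c C z \<subseteq> cone_at c C' z"
  by (auto simp: cone_at_def)

lemma open_cone_at:
  assumes "c \<in> maximal_atlas A" "openin (tangent_topology A) U"
  shows "open {(z, w). z \<in> chart_ran c \<and> w \<in> cone_at c U z}"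
  using open_param_preimage[OF assms] by (simp add: param_def cone_at_def)

lemma mem_cone_at_coord:
  assumes "c \<in> maximal_atlas A" "x \<in> dom_chart c"
  shows "w \<in> cone_at c C (coord c x) \<longleftrightarrow> tv c x w \<in> fibre C x"
  using assms by (simp add: cone_at_def fibre_def)

lemma cone_domain_iff:
  assumes "cone_field A C" "c \<in> maximal_atlas A" "x \<in> dom_chart c"
  shows "x \<in> cone_domain C \<longleftrightarrow> cone_at c C (coord c x) \<noteq> {}"
proof
  assume "x \<in> cone_domain C"
  then obtain v where v: "(x, v) \<in> C" by (auto simp: cone_domain_def fibre_def)
  then have "v \<in> tangent_space A x" using assms(1) by (auto simp: cone_field_def tangent_bundle_def)
  then obtain w where "v = tv c x w" using tangent_eq_tv_max assms by metis
  then have "w \<in> cone_at c C (coord c x)" using v assms mem_cone_at_coord by (auto simp: fibre_def)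
  then show "cone_at c C (coord c x) \<noteq> {}" by blast
next
  assume "cone_at c C (coord c x) \<noteq> {}"
  then show "x \<in> cone_domain C" using mem_cone_at_coord[OF assms(2,3)]
      by (auto simp: cone_domain_def)
qed

lemma cone_at_convex_cone:
  assumes "cone_field A C" "c \<in> maximal_atlas A" "z \<in> chart_ran c"
  shows cone_at_convex: "convex (cone_at c C z)"
    and cone_at_scale: "\<And>t w. t > 0 \<Longrightarrow> w \<in> cone_at c C z \<Longrightarrow> t *\<^sub>R w \<in> cone_at c C z"
    and cone_at_form: "\<exists>p. \<forall>w\<in>cone_at c C z. p \<bullet> w > 0"
proof -
  let ?x = "chart_inv c z"
  have x: "?x \<in> dom_chart c" using assms by (simp add: inv_into_into)
  have lin: "linear (tv c ?x)" by (rule tv_linear[OF assms(2) x])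
  have cone: "cone_in_half_space (fibre C ?x)" using assms(1) by (simp add: cone_field_def)
  have eq: "cone_at c C z = tv c ?x -` fibre C ?x" by (auto simp: cone_at_def fibre_def)
  show "convex (cone_at c C z)"
    unfolding eq using convex_linear_vimage[OF lin] cone by (simp add: cone_in_half_space_def)
  show "t *\<^sub>R w \<in> cone_at c C z" if "t > 0" "w \<in> cone_at c C z" for t w
    using that cone unfolding eq by (simp add: linear_cmul[OF lin] cone_in_half_space_def)
  obtain l where l: "linear l" "fibre C ?x \<subseteq> {v. l v > (0::real)}"
    using cone unfolding cone_in_half_space_def by blast
  let ?p = "\<Sum>e\<in>Basis. l (tv c ?x e) *\<^sub>R e"
  have "linear (\<lambda>w. l (tv c ?x w))" using linear_compose[OF lin l(1)] by (simp add: o_def)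
  have "?p \<bullet> w = l (tv c ?x w)" for w
    unfolding linear_eq_sum_Basis[OF \<open>linear (\<lambda>w. l (tv c ?x w))\<close>, of w]
    by (simp add: inner_sum_left inner_commute[of w] mult.commute)
  then show "\<exists>p. \<forall>w\<in>cone_at c C z. p \<bullet> w > 0" using l(2) unfolding eq by (intro exI[of _ ?p]) auto
qed

lemma cone_at_nonzero:
  assumes "cone_field A C" "c \<in> maximal_atlas A" "z \<in> chart_ran c" "w \<in> cone_at c C z"
  shows "w \<noteq> 0"
  using cone_at_form[OF assms(1-3)] assms(4) by auto

lemma cone_at_normalize:
  assumes "cone_field A C" "c \<in> maximal_atlas A" "z \<in> chart_ran c" "w \<in> cone_at c C z"
  shows "(1 / norm w) *\<^sub>R w \<in> cone_at c C z" "norm ((1 / norm w) *\<^sub>R w) = 1"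
  using cone_at_nonzero[OF assms] cone_at_scale[OF assms(1-3) _ assms(4), of "1 / norm w"] by auto

lemma openin_complement_cone:
  assumes "closed_cone_field A C"
  shows "openin (tangent_topology A) (tangent_bundle A - (C \<union> zero_section))"
  using assms topspace_tangent_topology[OF atlas] by (simp add: closed_cone_field_def closedin_def)

lemma open_not_cone_at:
  assumes "closed_cone_field A C" "c \<in> maximal_atlas A"
  shows "open {(z, w). z \<in> chart_ran c \<and> w \<noteq> 0 \<and> w \<notin> cone_at c C z}"
proof -
  have "(w \<noteq> 0 \<and> w \<notin> cone_at c C z) \<longleftrightarrow> w \<in> cone_at c (tangent_bundle A - (C \<union> zero_section)) z"
    if "z \<in> chart_ran c" for z w
  proof -
    have "chart_inv c z \<in> dom_chart c" using that by (simp add: inv_into_into)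
    then show ?thesis
      using param_in_bundle[OF assms(2) that, of w] tv_eq_0_iff[OF assms(2), of "chart_inv c z" w]
      by (auto simp: cone_at_def param_def zero_section_def)
  qed
  then have "{(z, w). z \<in> chart_ran c \<and> w \<noteq> 0 \<and> w \<notin> cone_at c C z}
      = {(z, w). z \<in> chart_ran c \<and> w \<in> cone_at c (tangent_bundle A - (C \<union> zero_section)) z}"
          by blast
  then show ?thesis using open_cone_at[OF assms(2) openin_complement_cone[OF assms(1)]] by simp
qed

text \<open>The unit sphere over \<open>z0\<close> is contained in the union of \<open>U\<close> and the
  open complement of the closed cone field, and so is, by the tube lemma, the unit sphere over
  all points near \<open>z0\<close>. The case \<open>U = {}\<close> yields
  \<open>closed_cone_domain\<close>.\<close>

lemma cone_at_upper_semicontinuous: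
  assumes C: "closed_cone_field A C" and c: "c \<in> maximal_atlas A" and z0: "z0 \<in> chart_ran c"
    and "open U" and U: "\<And>w. w \<in> cone_at c C z0 \<Longrightarrow> norm w = 1 \<Longrightarrow> (z0, w) \<in> U"
  obtains r where "r > 0" "cball z0 r \<subseteq> chart_ran c"
    "\<And>z w. z \<in> cball z0 r \<Longrightarrow> w \<in> cone_at c C z \<Longrightarrow> norm w = 1 \<Longrightarrow> (z, w) \<in> U"
proof -
  let ?P = "{(z, w). z \<in> chart_ran c \<and> w \<noteq> 0 \<and> w \<notin> cone_at c C z}"
  have "open (U \<union> ?P)" using \<open>open U\<close> open_not_cone_at[OF C c] by (rule open_Un)
  moreover have "{z0} \<times> sphere 0 1 \<subseteq> U \<union> ?P" using U z0 by auto
  ultimately have "\<exists>X. z0 \<in> X \<and> open X \<and> X \<times> sphere 0 1 \<subseteq> U \<union> ?P"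
    by (rule Elementary_Topology.tube_lemma[OF compact_sphere])
  then obtain X where X: "z0 \<in> X" "open X" "X \<times> sphere 0 1 \<subseteq> U \<union> ?P" by blast
  have "open (X \<inter> chart_ran c)" by (intro open_Int X open_chart_ran max_is_chart c)
  moreover have "z0 \<in> X \<inter> chart_ran c" using X z0 by blast
  ultimately obtain r where r: "r > 0" "cball z0 r \<subseteq> X \<inter> chart_ran c"
    using open_contains_cball_eq by blast
  show ?thesis
  proof (rule that)
    fix z w assume *: "z \<in> cball z0 r" "w \<in> cone_at c C z" "norm w = 1"
    then have "(z, w) \<in> X \<times> sphere 0 1" using r by auto
    then show "(z, w) \<in> U" using X(3) * by blast
  qed (use r in auto)
qed

lemma closed_cone_domain:
  assumes C: "closed_cone_field A C"
  shows "closed (cone_domain C)"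
proof -
  have cf: "cone_field A C" using C by (simp add: closed_cone_field_def)
  have "\<exists>T. open T \<and> x \<in> T \<and> T \<subseteq> - cone_domain C" if x: "x \<in> - cone_domain C" for x
  proof -
    obtain c where c0: "c \<in> A" "x \<in> dom_chart c" by (rule atlas_cover)
    have c: "c \<in> maximal_atlas A" using atlas_max c0 by blast
    have e: "cone_at c C (coord c x) = {}" using cone_domain_iff[OF cf c c0(2)] x by blast
    have "coord c x \<in> chart_ran c" using c0 by blast
    from cone_at_upper_semicontinuous[OF C c this open_empty]
    obtain r where r: "r > 0" 
      "\<And>z w. z \<in> cball (coord c x) r \<Longrightarrow> w \<in> cone_at c C z \<Longrightarrow> norm w = 1 \<Longrightarrow> False"
      using e by (metis empty_iff)
    let ?T = "dom_chart c \<inter> coord c -` ball (coord c x) r"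
    have "y \<notin> cone_domain C" if y: "y \<in> ?T" for y
    proof
      assume "y \<in> cone_domain C"
      then obtain w where w: "w \<in> cone_at c C (coord c y)" using cone_domain_iff[OF cf c] y by blast
      have "coord c y \<in> chart_ran c" using y by blast
      from cone_at_normalize[OF cf c this w] r(2)[of "coord c y"] y show False
        unfolding vimage_def mem_ball mem_cball by (meson IntD2 less_imp_le mem_Collect_eq)
    qed
    moreover have "open ?T" using open_coord_vimage[OF max_is_chart[OF c] open_ball] .
    ultimately show ?thesis using c0 r(1) by (intro exI[of _ ?T]) auto
  qed
  then have "open (- cone_domain C)" by (subst open_subopen) blast
  then show ?thesis by (simp add: closed_def)
qed

section \<open>Causal curves in coordinates\<close>

text \<open>Local Lipschitz continuity is defined through some chart of \<open>A\<close>. Transition maps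
  are \<open>C\<^sup>1\<close>, hence locally Lipschitz, so any chart of the maximal atlas may
  be used instead.\<close>

lemma lipschitz_change_chart:
  assumes d: "d \<in> maximal_atlas A" and c: "c \<in> maximal_atlas A" and t: "t \<in> I"
    and \<epsilon>: "\<epsilon> > 0" "\<gamma> ` (I \<inter> ball t \<epsilon>) \<subseteq> dom_chart d" "L-lipschitz_on (I \<inter> ball t \<epsilon>) (coord d \<circ> \<gamma>)"
    and N: "\<gamma> t \<in> dom_chart c" "open N" "\<gamma> t \<in> N"
  obtains \<epsilon>' L' where "\<epsilon>' > 0" "\<gamma> ` (I \<inter> ball t \<epsilon>') \<subseteq> dom_chart c \<inter> N"
    "L'-lipschitz_on (I \<inter> ball t \<epsilon>') (coord c \<circ> \<gamma>)"
proof -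
  let ?S = "coord d ` (dom_chart d \<inter> dom_chart c \<inter> N)"
  have t': "t \<in> I \<inter> ball t \<epsilon>" using t \<epsilon> by simp
  then have td: "\<gamma> t \<in> dom_chart d" using \<epsilon>(2) by blast
  have oS: "open ?S"
    using c d N by (intro open_coord_image open_Int open_chart_dom) auto
  have C1: "Ck_on 1 ?S (transition d c)"
    by (rule Ck_on_subset[OF smooth_transition[OF d c]]) auto
  have "coord d (\<gamma> t) \<in> ?S" using td N by blast
  from C1_locally_lipschitz[OF C1 oS this]
  obtain r M where r: "r > 0" "ball (coord d (\<gamma> t)) r \<subseteq> ?S"
    "M-lipschitz_on (ball (coord d (\<gamma> t)) r) (transition d c)" by metis
  have L0: "L \<ge> 0" using \<epsilon>(3) lipschitz_on_nonneg by blast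
  define e where "e = min \<epsilon> (r / (L + 1))"
  have e: "e > 0" "e \<le> \<epsilon>" using \<epsilon>(1) r(1) L0 by (auto simp: e_def)
  have near: "coord d (\<gamma> s) \<in> ball (coord d (\<gamma> t)) r" if s: "s \<in> I \<inter> ball t e" for s
  proof -
    have "s \<in> I \<inter> ball t \<epsilon>" using s e by auto
    then have "dist (coord d (\<gamma> t)) (coord d (\<gamma> s)) \<le> L * dist t s"
      using lipschitz_onD[OF \<epsilon>(3) t'] by simp
    also have "\<dots> \<le> (L + 1) * dist t s" by (simp add: mult_right_mono)
    also have "\<dots> < (L + 1) * (r / (L + 1))"
      using s L0 by (intro mult_strict_left_mono) (auto simp: e_def)
    also have "\<dots> = r" using L0 by simp
    finally show ?thesis by simp
  qed
  have sub: "\<gamma> s \<in> dom_chart d \<inter> dom_chart c \<inter> N" if s: "s \<in> I \<inter> ball t e" for s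
  proof -
    have "\<gamma> s \<in> dom_chart d" using s e \<epsilon>(2) by (force simp: subset_iff image_iff)
    moreover have "coord d (\<gamma> s) \<in> ?S" using near[OF s] r(2) by blast
    ultimately show ?thesis
      using coord_in_image_iff[OF max_is_chart[OF d], of "\<gamma> s" "dom_chart d \<inter> dom_chart c \<inter> N"]
          by blast
  qed
  have "L-lipschitz_on (I \<inter> ball t e) (coord d \<circ> \<gamma>)"
    by (rule lipschitz_on_subset[OF \<epsilon>(3)]) (use e in auto)
  moreover have "M-lipschitz_on ((coord d \<circ> \<gamma>) ` (I \<inter> ball t e)) (transition d c)"
    by (rule lipschitz_on_subset[OF r(3)]) (use near in auto)
  ultimately have "(M * L)-lipschitz_on (I \<inter> ball t e) (transition d c \<circ> (coord d \<circ> \<gamma>))"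
    by (rule lipschitz_on_compose)
  then have "(M * L)-lipschitz_on (I \<inter> ball t e) (coord c \<circ> \<gamma>)"
    by (rule lipschitz_on_transform) (use sub d in \<open>auto simp: transition_eq\<close>)
  then show ?thesis using that[OF e(1)] sub by blast
qed

lemma locally_lipschitz_in_chart:
  assumes "locally_lipschitz_curve A I \<gamma>" "t \<in> I" "c \<in> maximal_atlas A" "\<gamma> t \<in> dom_chart c"
    "open N" "\<gamma> t \<in> N"
  obtains \<epsilon> L where "\<epsilon> > 0" "\<gamma> ` (I \<inter> ball t \<epsilon>) \<subseteq> dom_chart c \<inter> N"
    "L-lipschitz_on (I \<inter> ball t \<epsilon>) (coord c \<circ> \<gamma>)"
proof -
  obtain d e L where d: "d \<in> A" and e: "e > 0" "\<gamma> ` (I \<inter> ball t e) \<subseteq> dom_chart d"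
    "L-lipschitz_on (I \<inter> ball t e) (coord d \<circ> \<gamma>)"
    using assms(1,2) unfolding locally_lipschitz_curve_def by blast
  from lipschitz_change_chart[OF atlas_max[OF d] assms(3,2) e assms(4-6)] that show ?thesis by blast
qed

lemma velocity_change_chart:
  assumes "\<epsilon> > 0" "t \<in> I" and sub: "\<gamma> ` (I \<inter> ball t \<epsilon>) \<subseteq> dom_chart c"
    and c: "c \<in> maximal_atlas A" and d: "d \<in> maximal_atlas A" "\<gamma> t \<in> dom_chart d"
    and der: "((coord c \<circ> \<gamma>) has_vector_derivative w) (at t within I)"
  shows "((coord d \<circ> \<gamma>) has_vector_derivative tdiff c d (\<gamma> t) w) (at t within I)"
proof -
  have tc: "\<gamma> t \<in> dom_chart c" using sub assms(1,2) by auto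
  note D = tdiff_has_derivative[OF c d(1) tc d(2)]
  have "((\<lambda>s. transition c d ((coord c \<circ> \<gamma>) s)) has_derivative (\<lambda>h. tdiff c d (\<gamma> t) (h *\<^sub>R w))) (at
      t within I)"
    by (rule has_derivative_compose[OF der[unfolded has_vector_derivative_def]]) (use D in simp)
  then have "((coord d \<circ> \<gamma>) has_derivative (\<lambda>h. tdiff c d (\<gamma> t) (h *\<^sub>R w))) (at t within I)"
  proof (rule has_derivative_transform_within[OF _ assms(1,2)])
    fix s assume "s \<in> I" "dist s t < \<epsilon>"
    then have "\<gamma> s \<in> dom_chart c" using sub by (auto simp: dist_commute)
    then show "transition c d ((coord c \<circ> \<gamma>) s) = (coord d \<circ> \<gamma>) s"
      using c by (simp add: transition_eq)
  qed
  then show ?thesis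
    by (simp add: has_vector_derivative_def linear_cmul[OF tdiff_linear[OF c d(1) tc d(2)]])
qed

lemma has_velocityI:
  assumes "\<epsilon> > 0" "t \<in> I" "\<gamma> ` (I \<inter> ball t \<epsilon>) \<subseteq> dom_chart c" "c \<in> maximal_atlas A"
    and der: "((coord c \<circ> \<gamma>) has_vector_derivative w) (at t within I)"
  shows "has_velocity A I \<gamma> t (tv c (\<gamma> t) w)"
proof -
  have tc: "\<gamma> t \<in> dom_chart c" using assms(1-3) by auto
  show ?thesis
    unfolding has_velocity_def
    using velocity_change_chart[OF assms(1-4) atlas_max _ der] tv_tangent[OF assms(4) tc] tv_apply
    by metis
qed

lemma has_velocity_in_chart:
  assumes ll: "locally_lipschitz_curve A I \<gamma>" and t: "t \<in> I" and v: "has_velocity A I \<gamma> t v"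
    and c: "c \<in> maximal_atlas A" "\<gamma> t \<in> dom_chart c"
  obtains w where "v = tv c (\<gamma> t) w" "((coord c \<circ> \<gamma>) has_vector_derivative w) (at t within I)"
proof -
  obtain d where d: "d \<in> A" "\<gamma> t \<in> dom_chart d" by (rule atlas_cover)
  have dm: "d \<in> maximal_atlas A" using atlas_max d by blast
  obtain e L where e: "e > 0" "\<gamma> ` (I \<inter> ball t e) \<subseteq> dom_chart d \<inter> UNIV"
    using locally_lipschitz_in_chart[OF ll t dm d(2) open_UNIV UNIV_I] by metis
  have e2: "\<gamma> ` (I \<inter> ball t e) \<subseteq> dom_chart d" using e(2) by blast
  have der: "((coord d \<circ> \<gamma>) has_vector_derivative v d) (at t within I)"
    and vt: "v \<in> tangent_space A (\<gamma> t)"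
    using v d unfolding has_velocity_def by auto
  have "v = tv c (\<gamma> t) (tdiff d c (\<gamma> t) (v d))"
    using tangent_eq_tv[OF vt d] tv_change[OF dm c(1) d(2) c(2)] by simp
  then show ?thesis
    using velocity_change_chart[OF e(1) t e2 dm c der] that by blast
qed

text \<open>A causal curve near parameter \<open>0\<close> is thus a Lipschitz curve in Euclidean space with
  a derivative in the coordinate cones almost everywhere. The converse is
  \<open>causal_curve_chart_invI\<close>.\<close>

lemma causal_curve_in_chart:
  assumes \<gamma>: "causal_curve A C {-1<..<1} \<gamma>" and c: "c \<in> maximal_atlas A" "\<gamma> 0 \<in> dom_chart c"
    and N: "open N" "\<gamma> 0 \<in> N"
  obtains \<delta> L where "0 < \<delta>" "\<delta> < 1" "\<gamma> ` {-\<delta>..\<delta>} \<subseteq> dom_chart c \<inter> N"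
    "L-lipschitz_on {-\<delta>..\<delta>} (coord c \<circ> \<gamma>)"
    "AE t in lebesgue. t \<in> {-\<delta>..\<delta>} \<longrightarrow>
      (\<exists>w\<in>cone_at c C ((coord c \<circ> \<gamma>) t). ((coord c \<circ> \<gamma>) has_vector_derivative w) (at t))"
proof -
  let ?I = "{-1<..<1::real}"
  have ll: "locally_lipschitz_curve A ?I \<gamma>" using \<gamma> by (simp add: causal_curve_def)
  have "0 \<in> ?I" by simp
  from locally_lipschitz_in_chart[OF ll this c N]
  obtain e L where e: "e > 0" "\<gamma> ` (?I \<inter> ball 0 e) \<subseteq> dom_chart c \<inter> N"
    "L-lipschitz_on (?I \<inter> ball 0 e) (coord c \<circ> \<gamma>)" by metis
  define \<delta> where "\<delta> = min (e/2) (1/2)"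
  have \<delta>: "0 < \<delta>" "\<delta> < 1" "{-\<delta>..\<delta>} \<subseteq> ?I \<inter> ball 0 e"
    using e(1) by (auto simp: \<delta>_def dist_real_def)
  show ?thesis
  proof (rule that[OF \<delta>(1,2)])
    show sub: "\<gamma> ` {-\<delta>..\<delta>} \<subseteq> dom_chart c \<inter> N" using e(2) \<delta>(3) by blast
    show "L-lipschitz_on {-\<delta>..\<delta>} (coord c \<circ> \<gamma>)" by (rule lipschitz_on_subset[OF e(3) \<delta>(3)])
    have "AE t in lebesgue. t \<in> ?I \<longrightarrow> (\<exists>v. has_velocity A ?I \<gamma> t v \<and> v \<in> fibre C (\<gamma> t))"
      using \<gamma> by (simp add: causal_curve_def)
    then show "AE t in lebesgue. t \<in> {-\<delta>..\<delta>} \<longrightarrow>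
      (\<exists>w\<in>cone_at c C ((coord c \<circ> \<gamma>) t). ((coord c \<circ> \<gamma>) has_vector_derivative w) (at t))"
    proof (rule AE_mp, intro AE_I2 impI)
      fix t assume *: "t \<in> ?I \<longrightarrow> (\<exists>v. has_velocity A ?I \<gamma> t v \<and> v \<in> fibre C (\<gamma> t))" "t \<in> {-\<delta>..\<delta>}"
      have tI: "t \<in> ?I" using *(2) \<delta>(3) by blast
      then obtain v where v: "has_velocity A ?I \<gamma> t v" "v \<in> fibre C (\<gamma> t)" using * by blast
      have tc: "\<gamma> t \<in> dom_chart c" using sub *(2) by blast
      from has_velocity_in_chart[OF ll tI v(1) c(1) tc]
      obtain w where w: "v = tv c (\<gamma> t) w" "((coord c \<circ> \<gamma>) has_vector_derivative w) (at t within
          ?I)" by metis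
      have "w \<in> cone_at c C ((coord c \<circ> \<gamma>) t)"
        using mem_cone_at_coord[OF c(1) tc] w v by simp
      moreover have "((coord c \<circ> \<gamma>) has_vector_derivative w) (at t)"
        using w(2) at_within_open[OF tI] by simp
      ultimately show "\<exists>w\<in>cone_at c C ((coord c \<circ> \<gamma>) t). ((coord c \<circ> \<gamma>) has_vector_derivative w) (at
          t)"
        by blast
    qed
  qed
qed

lemma causal_curve_chart_invI:
  fixes \<beta> :: "real \<Rightarrow> 'e"
  assumes c: "c \<in> maximal_atlas A" and lip: "L-lipschitz_on {-1<..<1} \<beta>"
    and ran: "\<beta> ` {-1<..<1} \<subseteq> chart_ran c"
    and ae: "AE t in lebesgue. t \<in> {-1<..<1} \<longrightarrow>
      (\<exists>w\<in>cone_at c C (\<beta> t). (\<beta> has_vector_derivative w) (at t))"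
  shows "causal_curve A C {-1<..<1} (chart_inv c \<circ> \<beta>)"
proof -
  let ?I = "{-1<..<1::real}" and ?\<gamma> = "chart_inv c \<circ> \<beta>"
  have dom: "?\<gamma> t \<in> dom_chart c" and cg: "coord c (?\<gamma> t) = \<beta> t" if "t \<in> ?I" for t
    using that ran by (auto simp: inv_into_into f_inv_into_f image_subset_iff)
  have lip': "L-lipschitz_on ?I (coord c \<circ> ?\<gamma>)"
    by (rule lipschitz_on_transform[OF lip]) (use cg in auto)
  have "\<exists>d\<in>A. \<exists>\<epsilon>>0. \<exists>L. ?\<gamma> ` (?I \<inter> ball t \<epsilon>) \<subseteq> dom_chart d
      \<and> L-lipschitz_on (?I \<inter> ball t \<epsilon>) (coord d \<circ> ?\<gamma>)"
    if t: "t \<in> ?I" for t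
  proof -
    obtain d where d: "d \<in> A" "?\<gamma> t \<in> dom_chart d" by (rule atlas_cover)
    have 1: "?\<gamma> ` (?I \<inter> ball t 1) \<subseteq> dom_chart c" using dom by blast
    have 2: "L-lipschitz_on (?I \<inter> ball t 1) (coord c \<circ> ?\<gamma>)"
        by (rule lipschitz_on_subset[OF lip']) auto
    from lipschitz_change_chart[OF c atlas_max[OF d(1)] t zero_less_one 1 2 d(2) open_UNIV UNIV_I]
    obtain \<epsilon>' L' where "\<epsilon>' > 0" "?\<gamma> ` (?I \<inter> ball t \<epsilon>') \<subseteq> dom_chart d \<inter> UNIV"
      "L'-lipschitz_on (?I \<inter> ball t \<epsilon>') (coord d \<circ> ?\<gamma>)" by metis
    then show ?thesis using d(1) by (intro bexI[of _ d] exI[of _ \<epsilon>'] exI[of _ L'] conjI) auto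
  qed
  then have ll: "locally_lipschitz_curve A ?I ?\<gamma>" by (simp add: locally_lipschitz_curve_def)
  have "AE t in lebesgue. t \<in> ?I \<longrightarrow> (\<exists>v. has_velocity A ?I ?\<gamma> t v \<and> v \<in> fibre C (?\<gamma> t))"
    using ae
  proof (rule AE_mp, intro AE_I2 impI)
    fix t assume *: "t \<in> ?I \<longrightarrow> (\<exists>w\<in>cone_at c C (\<beta> t). (\<beta> has_vector_derivative w) (at t))" "t \<in> ?I"
    then obtain w where w: "w \<in> cone_at c C (\<beta> t)" "(\<beta> has_vector_derivative w) (at t)" by blast
    have "((coord c \<circ> ?\<gamma>) has_vector_derivative w) (at t)"
      by (rule has_vector_derivative_transform_within_open[OF w(2), of ?I]) (use * cg in auto)
    then have "((coord c \<circ> ?\<gamma>) has_vector_derivative w) (at t within ?I)"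
      by (rule has_vector_derivative_at_within)
    then have "has_velocity A ?I ?\<gamma> t (tv c (?\<gamma> t) w)"
      using *(2) c dom by (intro has_velocityI[OF zero_less_one]) auto
    moreover have "tv c (?\<gamma> t) w \<in> fibre C (?\<gamma> t)"
      using w(1) by (simp add: cone_at_def fibre_def)
    ultimately show "\<exists>v. has_velocity A ?I ?\<gamma> t v \<and> v \<in> fibre C (?\<gamma> t)" by blast
  qed
  with ll show ?thesis by (simp add: causal_curve_def is_interval_oo)
qed

text \<open>A constant curve has velocity \<open>0\<close>, which no cone contains.\<close>

lemma causal_curve_nonconstant:
  assumes cf: "cone_field A C" and \<gamma>: "causal_curve A C {-1<..<1} \<gamma>"
  shows "\<not> \<gamma> constant_on {-1<..<1}"
proof
  let ?I = "{-1<..<1::real}"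
  assume "\<gamma> constant_on ?I"
  then obtain y where y: "\<And>t. t \<in> ?I \<Longrightarrow> \<gamma> t = y" by (auto simp: constant_on_def)
  have "AE t in lebesgue. t \<in> ?I \<longrightarrow> (\<exists>v. has_velocity A ?I \<gamma> t v \<and> v \<in> fibre C (\<gamma> t))"
    using \<gamma> by (simp add: causal_curve_def)
  then obtain t where t: "t \<in> ?I" "t \<in> ?I \<longrightarrow> (\<exists>v. has_velocity A ?I \<gamma> t v \<and> v \<in> fibre C (\<gamma> t))"
    by (rule AE_lebesgue_open_ex[of _ ?I]) auto
  then obtain v where v: "has_velocity A ?I \<gamma> t v" "v \<in> fibre C (\<gamma> t)" by blast
  have "v d = 0" for d
  proof (cases "d \<in> A \<and> \<gamma> t \<in> dom_chart d")
    case True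
    then have "((coord d \<circ> \<gamma>) has_vector_derivative v d) (at t within ?I)"
      using v(1) by (simp add: has_velocity_def)
    then have 1: "((coord d \<circ> \<gamma>) has_vector_derivative v d) (at t)" using at_within_open[OF t(1)]
        by simp
    have "((\<lambda>_. coord d y) has_vector_derivative 0) (at t)" by simp
    then have "((coord d \<circ> \<gamma>) has_vector_derivative 0) (at t)"
      by (rule has_vector_derivative_transform_within_open[of _ _ _ ?I]) (use t y in auto)
    with 1 show ?thesis using vector_derivative_unique_at by blast
  next
    case False
    then show ?thesis using v(1) tangent_space_outside[OF _ False] unfolding has_velocity_def
        by blast
  qed
  then have "v = 0" by auto
  moreover obtain l where "linear l" "fibre C (\<gamma> t) \<subseteq> {v. l v > (0::real)}"
    using cf unfolding cone_field_def cone_in_half_space_def by blast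
  ultimately show False using v(2) linear_0[of l] by auto
qed

end

context smooth_manifold
begin

section \<open>Existence of enlargements\<close>

lemma coordinate_ball:
  assumes c: "c \<in> maximal_atlas A" "x \<in> dom_chart c" and W: "open W" "x \<in> W" and "r0 > 0"
  obtains r where "0 < r" "r \<le> r0" "cball (coord c x) r \<subseteq> coord c ` (dom_chart c \<inter> W)"
    "open (dom_chart c \<inter> coord c -` ball (coord c x) r)"
    "compact (dom_chart c \<inter> coord c -` cball (coord c x) r)"
    "dom_chart c \<inter> coord c -` cball (coord c x) r \<subseteq> W"
proof -
  let ?S = "coord c ` (dom_chart c \<inter> W)"
  have "open ?S" using c W by (intro open_coord_image open_Int open_chart_dom) auto
  moreover have "coord c x \<in> ?S" using c W by blast
  ultimately obtain r' where r': "r' > 0" "cball (coord c x) r' \<subseteq> ?S"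
    using open_contains_cball_eq by blast
  define r where "r = min r' r0"
  have r: "0 < r" "r \<le> r0" using r' \<open>r0 > 0\<close> by (auto simp: r_def)
  have sub: "cball (coord c x) r \<subseteq> ?S" using r'(2) by (auto simp: r_def)
  let ?K = "dom_chart c \<inter> coord c -` cball (coord c x) r"
  have "?K = chart_inv c ` cball (coord c x) r"
  proof (intro equalityI subsetI)
    fix y assume "y \<in> ?K"
    then show "y \<in> chart_inv c ` cball (coord c x) r"
      using c by (intro image_eqI[of _ _ "coord c y"]) auto
  next
    fix y assume "y \<in> chart_inv c ` cball (coord c x) r"
    then obtain z where z: "y = chart_inv c z" "z \<in> cball (coord c x) r" by blast
    then have "z \<in> chart_ran c" using sub by blast
    then show "y \<in> ?K" using z by (auto simp: inv_into_into f_inv_into_f)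
  qed
  moreover have "compact (chart_inv c ` cball (coord c x) r)"
    by (intro compact_continuous_image compact_cball
        continuous_on_subset[OF chart_inv_continuous[OF max_is_chart[OF c(1)]]]) (use sub in blast)
  moreover have "?K \<subseteq> W"
  proof
    fix y assume y: "y \<in> ?K"
    then have "coord c y \<in> ?S" using sub by blast
    then show "y \<in> W"
      using coord_in_image_iff[OF max_is_chart[OF c(1)], of y "dom_chart c \<inter> W"] y by blast
  qed
  ultimately show ?thesis
    using that[OF r sub] open_coord_vimage[OF max_is_chart[OF c(1)] open_ball] by simp
qed

lemma compact_unit_cones:
  assumes "closed_cone_field A C" "c \<in> maximal_atlas A" "cball z0 r \<subseteq> chart_ran c"
  shows "compact {(z, w). z \<in> cball z0 r \<and> norm w = 1 \<and> w \<in> cone_at c C z}"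
proof -
  have "{(z, w). z \<in> cball z0 r \<and> norm w = 1 \<and> w \<in> cone_at c C z}
      = cball z0 r \<times> sphere 0 1 - {(z, w). z \<in> chart_ran c \<and> w \<noteq> 0 \<and> w \<notin> cone_at c C z}"
    using assms(3) by (auto simp del: mem_cball)
  then show ?thesis
    using compact_diff[OF compact_Times[OF compact_cball compact_sphere] open_not_cone_at[OF
        assms(1,2)]]
    by simp
qed

text \<open>The covector \<open>p\<close> is positive on the cone at \<open>z0\<close>, hence on all cones
  over a small ball, and then bounded below on the compact set of unit vectors in these cones.\<close>

lemma uniform_cone_bound:
  assumes C: "closed_cone_field A C" and c: "c \<in> maximal_atlas A" and z0: "z0 \<in> chart_ran c"
  obtains p \<kappa> r where "\<kappa> > 0" "r > 0" "cball z0 r \<subseteq> chart_ran c"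
    "\<And>z w. z \<in> cball z0 r \<Longrightarrow> w \<in> cone_at c C z \<Longrightarrow> p \<bullet> w > \<kappa> * norm w"
proof -
  have cf: "cone_field A C" using C by (simp add: closed_cone_field_def)
  obtain p where p: "\<And>w. w \<in> cone_at c C z0 \<Longrightarrow> p \<bullet> w > 0"
    using cone_at_form[OF cf c z0] by blast
  have "open (UNIV \<times> {w. p \<bullet> w > 0})"
    by (intro open_Times open_UNIV open_halfspace_gt)
  from cone_at_upper_semicontinuous[OF C c z0 this] p
  obtain r where r: "r > 0" "cball z0 r \<subseteq> chart_ran c"
    "\<And>z w. z \<in> cball z0 r \<Longrightarrow> w \<in> cone_at c C z \<Longrightarrow> norm w = 1 \<Longrightarrow> p \<bullet> w > 0"
    by (metis (no_types, lifting) UNIV_I mem_Collect_eq mem_Sigma_iff)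
  let ?K = "{(z, w). z \<in> cball z0 r \<and> norm w = 1 \<and> w \<in> cone_at c C z}"
  have "\<exists>\<kappa>>0. \<forall>k\<in>?K. p \<bullet> snd k > \<kappa>"
  proof (cases "?K = {}")
    case False
    have "continuous_on ?K (\<lambda>k. p \<bullet> snd k)" by (intro continuous_intros)
    from continuous_attains_inf[OF compact_unit_cones[OF C c r(2)] False this]
    obtain k0 where k0: "k0 \<in> ?K" "\<And>k. k \<in> ?K \<Longrightarrow> p \<bullet> snd k0 \<le> p \<bullet> snd k" by blast
    have pos: "p \<bullet> snd k0 > 0" using k0(1) r(3) by (auto simp: case_prod_unfold)
    show ?thesis
    proof (intro exI[of _ "p \<bullet> snd k0 / 2"] conjI ballI)
      fix k assume "k \<in> ?K"
      then show "p \<bullet> snd k0 / 2 < p \<bullet> snd k" using k0(2)[of k] pos by linarith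
    qed (use pos in simp)
  qed (auto intro: exI[of _ 1])
  then obtain \<kappa> where \<kappa>: "\<kappa> > 0" "\<And>k. k \<in> ?K \<Longrightarrow> p \<bullet> snd k > \<kappa>" by blast
  show ?thesis
  proof (rule that[OF \<kappa>(1) r(1,2)])
    fix z w assume z: "z \<in> cball z0 r" and w: "w \<in> cone_at c C z"
    then have zr: "z \<in> chart_ran c" using r(2) by blast
    have "(z, (1 / norm w) *\<^sub>R w) \<in> ?K" using cone_at_normalize[OF cf c zr w] z by auto
    from \<kappa>(2)[OF this] have "\<kappa> < (1 / norm w) * (p \<bullet> w)" by simp
    then show "p \<bullet> w > \<kappa> * norm w"
      using cone_at_nonzero[OF cf c zr w] by (simp add: field_simps)
  qed
qed

lemma subspace_tangent_space: "subspace (tangent_space A x)"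
proof -
  obtain d where d: "d \<in> A" "x \<in> dom_chart d" by (rule atlas_cover)
  have "tangent_space A x = range (tv d x)"
    using tangent_eq_tv[OF _ d] tv_tangent[OF atlas_max[OF d(1)] d(2)] by blast
  then show ?thesis
    using linear_subspace_image[OF tv_linear[OF atlas_max[OF d(1)] d(2)] subspace_UNIV] by simp
qed

lemma openin_nonzero: "openin (tangent_topology A) (tangent_bundle A - zero_section)"
proof -
  let ?B = "\<lambda>d. {(x, v). (x, v) \<in> tangent_bundle A \<and> x \<in> dom_chart d
      \<and> (coord d x, v d) \<in> UNIV \<times> (- {0})}"
  have "openin (tangent_topology A) (\<Union>d\<in>A. ?B d)"
  proof (intro openin_Union, clarify)
    fix d assume "d \<in> A"
    then show "openin (tangent_topology A) (?B d)"
      by (intro openin_tangent_chart open_Times) auto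
  qed
  moreover have "(\<Union>d\<in>A. ?B d) = tangent_bundle A - zero_section"
  proof (intro equalityI subsetI)
    fix p assume p: "p \<in> tangent_bundle A - zero_section"
    then obtain x v where xv: "p = (x, v)" "v \<in> tangent_space A x" "v \<noteq> 0"
      by (auto simp: tangent_bundle_def zero_section_def)
    obtain d where d: "d \<in> A" "x \<in> dom_chart d" by (rule atlas_cover)
    have "v d \<noteq> 0"
      using tangent_eq_tv[OF xv(2) d] tv_eq_0_iff[OF atlas_max[OF d(1)] d(2)] xv(3) by metis
    then show "p \<in> (\<Union>d\<in>A. ?B d)" using xv d by (auto simp: tangent_bundle_def)
  qed (auto simp: zero_section_def)
  ultimately show ?thesis by simp
qed

lemma enlargement_superset: "enlargement A C C1 \<Longrightarrow> C \<subseteq> C1"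
  unfolding enlargement_def using interior_of_subset[of "tangent_topology A" C1] by blast

lemma enlargement_restrict_field:
  assumes C: "cone_field A C" and C1: "enlargement A C C1"
      and F: "closed_neighborhood F (cone_domain C)"
  shows "enlargement A C (restrict_field C1 F)"
proof -
  have c1: "cone_field A C1" "closed_cone_field A C1" using C1
      by (auto simp: enlargement_def closed_cone_field_def)
  have "cone_in_half_space (fibre (restrict_field C1 F) x)" for x
  proof (cases "x \<in> F")
    case True
    then have "fibre (restrict_field C1 F) x = fibre C1 x"
        by (auto simp: restrict_field_def fibre_def)
    then show ?thesis using c1 by (simp add: cone_field_def)
  next
    case False
    then have "fibre (restrict_field C1 F) x = {}" by (auto simp: restrict_field_def fibre_def)
    moreover have "linear (\<lambda>_. 0::real)" by (rule linear_zero)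
    ultimately show ?thesis by (auto simp: cone_in_half_space_def)
  qed
  moreover have "restrict_field C1 F \<subseteq> tangent_bundle A"
    using c1(1) by (auto simp: cone_field_def restrict_field_def)
  ultimately have cf: "cone_field A (restrict_field C1 F)" by (simp add: cone_field_def)
  have "tangent_bundle A - (restrict_field C1 F \<union> zero_section) =
      (tangent_bundle A - (C1 \<union> zero_section)) \<union>
      ({(x, v). (x, v) \<in> tangent_bundle A \<and> x \<in> - F} \<inter> (tangent_bundle A - zero_section))"
    by (auto simp: restrict_field_def)
  moreover have "openin (tangent_topology A) \<dots>"
    using F by (intro openin_Un openin_Int openin_complement_cone[OF c1(2)] openin_tangent_over
        openin_nonzero)
      (auto simp: closed_neighborhood_def)
  moreover have "zero_section \<subseteq> tangent_bundle A"
    using subspace_0[OF subspace_tangent_space] by (auto simp: zero_section_def tangent_bundle_def)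
  ultimately have "closed_cone_field A (restrict_field C1 F)"
    using cf topspace_tangent_topology[OF atlas] unfolding closed_cone_field_def closedin_def
    by (auto simp: cone_field_def)
  moreover have "C \<subseteq> (tangent_topology A) interior_of (restrict_field C1 F)"
  proof -
    let ?T = "((tangent_topology A) interior_of C1) \<inter> {(x, v). (x, v) \<in> tangent_bundle A
        \<and> x \<in> interior F}"
    have "openin (tangent_topology A) ?T"
        by (intro openin_Int openin_interior_of openin_tangent_over open_interior)
    moreover have "?T \<subseteq> restrict_field C1 F"
      using interior_of_subset[of "tangent_topology A" C1] interior_subset[of F]
          by (auto simp: restrict_field_def)
    ultimately have "?T \<subseteq> (tangent_topology A) interior_of (restrict_field C1 F)"
      by (rule interior_of_maximal[rotated])
    moreover have "C \<subseteq> ?T"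
    proof
      fix p assume p: "p \<in> C"
      obtain x v where xv: "p = (x, v)" by (cases p)
      have "x \<in> cone_domain C" using p xv by (auto simp: cone_domain_def fibre_def)
      then show "p \<in> ?T" using p xv C C1 F
          by (auto simp: cone_field_def enlargement_def closed_neighborhood_def)
    qed
    ultimately show ?thesis by blast
  qed
  ultimately show ?thesis by (simp add: enlargement_def)
qed

text \<open>The field of all nonzero vectors that satisfy \<open>p q \<bullet> v \<ge> \<kappa> q * norm
  v\<close> over each set \<open>fst q\<close> of a cover, where the inequality is strict for
  the vectors of \<open>C\<close> over the larger closed set \<open>snd q\<close>. It is closed
  since the sets \<open>fst q\<close> are open, and \<open>C\<close> lies in its interior since
  the sets \<open>snd q\<close> are closed and locally finite.\<close>

lemma ex_enlargement:
  assumes C: "closed_cone_field A C"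
  shows "\<exists>C1. enlargement A C C1"
proof -
  have cf: "cone_field A C" using C by (simp add: closed_cone_field_def)
  define Q where "Q V K \<longleftrightarrow> (\<exists>d p \<kappa>. d \<in> A \<and> \<kappa> > 0 \<and> K \<subseteq> dom_chart d \<and> V \<subseteq> K \<and> closed K \<and>
    (\<forall>x\<in>K. \<forall>v\<in>fibre C x. p \<bullet> v d > \<kappa> * norm (v d)))" for V K :: "'m set"
  have loc: "\<exists>V K. Q V K \<and> open V \<and> x \<in> V \<and> K \<subseteq> W" if "x \<in> UNIV" and W: "open W" "x \<in> W" for x W
  proof -
    obtain d where d: "d \<in> A" "x \<in> dom_chart d" by (rule atlas_cover)
    have dm: "d \<in> maximal_atlas A" by (rule atlas_max[OF d(1)])
    have "coord d x \<in> chart_ran d" using d by blast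
    from uniform_cone_bound[OF C dm this] obtain p \<kappa> r0 where b: "\<kappa> > 0" "r0 > 0"
      "\<And>z w. z \<in> cball (coord d x) r0 \<Longrightarrow> w \<in> cone_at d C z \<Longrightarrow> p \<bullet> w > \<kappa> * norm w" by metis
    from coordinate_ball[OF dm d(2) W b(2)] obtain r where r: "0 < r" "r \<le> r0"
      "open (dom_chart d \<inter> coord d -` ball (coord d x) r)"
      "compact (dom_chart d \<inter> coord d -` cball (coord d x) r)"
      "dom_chart d \<inter> coord d -` cball (coord d x) r \<subseteq> W" by metis
    let ?V = "dom_chart d \<inter> coord d -` ball (coord d x) r"
        and ?K = "dom_chart d \<inter> coord d -` cball (coord d x) r"
    have "p \<bullet> v d > \<kappa> * norm (v d)" if y: "y \<in> ?K" and v: "v \<in> fibre C y" for y v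
    proof -
      have "v \<in> tangent_space A y" using v cf
          by (auto simp: cone_field_def tangent_bundle_def fibre_def)
      then have "tv d y (v d) \<in> fibre C y" using tangent_eq_tv[of v y d] d y v by auto
      then have "v d \<in> cone_at d C (coord d y)" using mem_cone_at_coord[OF dm] y by auto
      then show ?thesis using b(3)[of "coord d y"] y r(2) by auto
    qed
    then have "Q ?V ?K"
      unfolding Q_def using d(1) b(1) compact_imp_closed[OF r(4)] 
      by (intro exI[of _ d] exI[of _ p] exI[of _ \<kappa>]) auto
    then show ?thesis using r(1,3,5) d(2) by (intro exI[of _ ?V] exI[of _ ?K]) auto
  qed
  obtain \<F> where "countable \<F>" and \<F>: "\<forall>q\<in>\<F>. Q (fst q) (snd q) \<and> open (fst q)" "UNIV \<subseteq> \<Union> (fst ` \<F>)"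
    "\<forall>x. \<exists>N. open N \<and> x \<in> N \<and> finite {p \<in> \<F>. snd p \<inter> N \<noteq> {}}"
    by (rule locally_finite_cover[where Q = Q, OF manifold_locally_compact closed_UNIV])
      (rule loc, assumption+)
  have "\<forall>q\<in>\<F>. \<exists>d p \<kappa>. open (fst q) \<and> d \<in> A \<and> \<kappa> > 0 \<and> snd q \<subseteq> dom_chart d \<and> fst q \<subseteq> snd q
      \<and> closed (snd q) \<and>
    (\<forall>x\<in>snd q. \<forall>v\<in>fibre C x. p \<bullet> v d > \<kappa> * norm (v d))"
    using \<F>(1) unfolding Q_def by blast
  then obtain d p \<kappa> where q: "\<And>q. q \<in> \<F> \<Longrightarrow> open (fst q) \<and> d q \<in> A \<and> \<kappa> q > 0 \<and> snd q
      \<subseteq> dom_chart (d q) \<and>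
      fst q \<subseteq> snd q \<and> closed (snd q) \<and> (\<forall>x\<in>snd q. \<forall>v\<in>fibre C x. p q \<bullet> v (d q) > \<kappa> q * norm (v (d
          q)))"
    by metis
  have dom: "x \<in> dom_chart (d q)" if "q \<in> \<F>" "x \<in> fst q" for x q using q[OF that(1)] that(2)
      by blast
  define C1 where "C1 = {(x, v). (x, v) \<in> tangent_bundle A \<and> v \<noteq> 0 \<and>
    (\<forall>q\<in>\<F>. x \<in> fst q \<longrightarrow> p q \<bullet> v (d q) \<ge> \<kappa> q * norm (v (d q)))}"
  have cov: "\<exists>q\<in>\<F>. x \<in> fst q" for x using \<F>(2) by blast
  have cone: "cone_in_half_space (fibre C1 x)" for x
  proof -
    obtain q0 where q0: "q0 \<in> \<F>" "x \<in> fst q0" using cov by blast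
    let ?l = "\<lambda>v :: ('m, 'e) tvec. p q0 \<bullet> v (d q0)"
    have lin: "linear ?l"
      by (intro linearI) (auto simp: inner_add_right scaleR_fun_def)
    have pos: "?l v > 0" if v: "v \<in> fibre C1 x" for v
    proof -
      have vt: "v \<in> tangent_space A x" "v \<noteq> 0" using v
          by (auto simp: fibre_def C1_def tangent_bundle_def)
      have "v (d q0) \<noteq> 0"
        using tangent_eq_tv[OF vt(1), of "d q0"] tv_eq_0_iff[OF atlas_max, of "d q0" x "v (d q0)"]
          q[OF q0(1)] dom[OF q0] vt(2) by auto
      then have "0 < \<kappa> q0 * norm (v (d q0))" using q[OF q0(1)] by simp
      also have "\<dots> \<le> ?l v" using v q0 by (auto simp: fibre_def C1_def)
      finally show ?thesis .
    qed
    have tan: "v \<in> tangent_space A x" if "v \<in> fibre C1 x" for v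
      using that by (auto simp: fibre_def C1_def tangent_bundle_def)
    have ineq: "p q \<bullet> v (d q) \<ge> \<kappa> q * norm (v (d q))" if "v \<in> fibre C1 x" "q \<in> \<F>" "x \<in> fst q"
        for v q
      using that by (auto simp: fibre_def C1_def)
    have memI: "v \<in> fibre C1 x" if "v \<in> tangent_space A x" "?l v > 0"
      "\<And>q. q \<in> \<F> \<Longrightarrow> x \<in> fst q \<Longrightarrow> p q \<bullet> v (d q) \<ge> \<kappa> q * norm (v (d q))" for v
      using that by (auto simp: fibre_def C1_def tangent_bundle_def)
    have scale: "t *\<^sub>R v \<in> fibre C1 x" if "t > 0" "v \<in> fibre C1 x" for t v
    proof (rule memI)
      show "t *\<^sub>R v \<in> tangent_space A x" by (rule subspace_scale[OF subspace_tangent_space tan[OF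
          that(2)]])
      show "?l (t *\<^sub>R v) > 0" using pos[OF that(2)] that(1) by (simp add: scaleR_fun_def)
      fix q assume "q \<in> \<F>" "x \<in> fst q"
      from ineq[OF that(2) this] show "p q \<bullet> (t *\<^sub>R v) (d q) \<ge> \<kappa> q * norm ((t *\<^sub>R v) (d q))"
        using that(1) by (simp add: scaleR_fun_def mult.left_commute)
    qed
    have add: "v + w \<in> fibre C1 x" if v: "v \<in> fibre C1 x" and w: "w \<in> fibre C1 x" for v w
    proof (rule memI)
      show "v + w \<in> tangent_space A x" by (rule subspace_add[OF subspace_tangent_space tan[OF v]
          tan[OF w]])
      show "?l (v + w) > 0" using pos[OF v] pos[OF w] by (simp add: inner_add_right)
      fix q assume q': "q \<in> \<F>" "x \<in> fst q"
      have "\<kappa> q * norm (v (d q) + w (d q)) \<le> \<kappa> q * (norm (v (d q)) + norm (w (d q)))"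
        using q[OF q'(1)] by (intro mult_left_mono norm_triangle_ineq) auto
      also have "\<dots> \<le> p q \<bullet> v (d q) + p q \<bullet> w (d q)"
        using ineq[OF v q'] ineq[OF w q'] by (simp add: distrib_left)
      finally show "p q \<bullet> (v + w) (d q) \<ge> \<kappa> q * norm ((v + w) (d q))"
        by (simp add: inner_add_right)
    qed
    have "convex (fibre C1 x)"
    proof (rule convexI)
      fix v w s t assume *: "v \<in> fibre C1 x" "w \<in> fibre C1 x" "(0::real) \<le> s" "0 \<le> t" "s + t = 1"
      consider "s = 0" "t = 1" | "t = 0" "s = 1" | "s > 0" "t > 0" using * by fastforce
      then show "s *\<^sub>R v + t *\<^sub>R w \<in> fibre C1 x"
        by cases (use * scale add in auto)
    qed
    then show ?thesis
      unfolding cone_in_half_space_def using scale pos lin by blast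
  qed
  then have cf1: "cone_field A C1" by (auto simp: cone_field_def C1_def)
  let ?bad = "\<lambda>q. {(x, v). (x, v) \<in> tangent_bundle A \<and> x \<in> dom_chart (d q) \<and>
      (coord (d q) x, v (d q)) \<in> coord (d q) ` fst q \<times> {u. p q \<bullet> u < \<kappa> q * norm u}}"
  have "tangent_bundle A - (C1 \<union> zero_section) = (\<Union>q\<in>\<F>. ?bad q)"
  proof (intro equalityI subsetI)
    fix y assume y: "y \<in> tangent_bundle A - (C1 \<union> zero_section)"
    obtain x v where xv: "y = (x, v)" by (cases y)
    then obtain q' where "q' \<in> \<F>" "x \<in> fst q'" "p q' \<bullet> v (d q') < \<kappa> q' * norm (v (d q'))"
      using y by (auto simp: C1_def zero_section_def not_le)
    then show "y \<in> (\<Union>q\<in>\<F>. ?bad q)" using y xv dom by blast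
  next
    fix y assume "y \<in> (\<Union>q\<in>\<F>. ?bad q)"
    then obtain q' x v where q': "q' \<in> \<F>" "y
        = (x, v)" "(x, v) \<in> tangent_bundle A" "x \<in> dom_chart (d q')"
      "coord (d q') x \<in> coord (d q') ` fst q'" "p q' \<bullet> v (d q') < \<kappa> q' * norm (v (d q'))" by blast
    have "x \<in> fst q'"
      using coord_in_image_iff[of "d q'" x "fst q'"] q' q[OF q'(1)] atlas_max by auto
    moreover have "v \<noteq> 0" using q'(6) by auto
    ultimately show "y \<in> tangent_bundle A - (C1 \<union> zero_section)"
      using q' by (auto simp: C1_def zero_section_def)
  qed
  moreover have "openin (tangent_topology A) (\<Union>q\<in>\<F>. ?bad q)"
  proof (intro openin_Union, clarify)
    fix a b assume q': "(a, b) \<in> \<F>"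
    have "open {u. p (a, b) \<bullet> u < \<kappa> (a, b) * norm u}" by (intro open_Collect_less continuous_intros)
    then show "openin (tangent_topology A) (?bad (a, b))"
      using q[OF q'] atlas_max by (intro openin_tangent_chart open_Times open_coord_image) auto
  qed
  moreover have "zero_section \<subseteq> tangent_bundle A"
    using subspace_0[OF subspace_tangent_space] by (auto simp: zero_section_def tangent_bundle_def)
  ultimately have "closed_cone_field A C1"
    using cf1 topspace_tangent_topology[OF atlas] unfolding closed_cone_field_def closedin_def
    by (auto simp: cone_field_def)
  moreover have "C \<subseteq> (tangent_topology A) interior_of C1"
  proof
    fix y0 assume y0: "y0 \<in> C"
    obtain x0 v0 where xv0: "y0 = (x0, v0)" by (cases y0)
    obtain N where N: "open N" "x0 \<in> N" "finite {q \<in> \<F>. snd q \<inter> N \<noteq> {}}" using \<F>(3) by blast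
    define J where "J = {q \<in> \<F>. snd q \<inter> N \<noteq> {}}"
    define J' where "J' = {q \<in> J. x0 \<in> snd q}"
    have fin: "finite J" using N(3) by (simp add: J_def)
    have fin': "finite J'" "finite (J - J')" using fin by (auto simp: J'_def)
    define N' where "N' = N \<inter> (\<Inter>q\<in>J - J'. - snd q)"
    have oN': "open N'"
      unfolding N'_def using q fin' N(1) by (intro open_Int open_INT) (auto simp: J_def)
    let ?good = "\<lambda>q. {(x, v). (x, v) \<in> tangent_bundle A \<and> x \<in> dom_chart (d q) \<and>
      (coord (d q) x, v (d q)) \<in> UNIV \<times> {u. p q \<bullet> u > \<kappa> q * norm u}}"
    define T where "T = {(x, v). (x, v) \<in> tangent_bundle A \<and> x \<in> N'} \<inter> (\<Inter>q\<in>J'. ?good q)"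
    have "openin (tangent_topology A) T"
      unfolding T_def
    proof (rule openin_Int_finite_INT[OF fin'(1) openin_tangent_over[OF oN']])
      fix q' assume "q' \<in> J'"
      moreover have "open {u. p q' \<bullet> u > \<kappa> q' * norm u}"
          by (intro open_Collect_less continuous_intros)
      ultimately show "openin (tangent_topology A) (?good q')"
        using q by (intro openin_tangent_chart open_Times open_UNIV) (auto simp: J'_def J_def)
    qed
    moreover have "T \<subseteq> C1"
    proof
      fix y assume y: "y \<in> T"
      obtain x v where xv: "y = (x, v)" by (cases y)
      have x: "x \<in> N'" "(x, v) \<in> tangent_bundle A" using y xv by (auto simp: T_def)
      have gt: "p q' \<bullet> v (d q') > \<kappa> q' * norm (v (d q'))" if "q' \<in> \<F>" "x \<in> fst q'" for q'
      proof -
        have "x \<in> snd q'" using q[OF that(1)] that(2) by blast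
        then have "q' \<in> J'" using x that(1) by (auto simp: N'_def J_def)
        then show ?thesis using y xv by (auto simp: T_def)
      qed
      obtain q' where "q' \<in> \<F>" "x \<in> fst q'" using cov by blast
      from gt[OF this] have "v \<noteq> 0" by auto
      then show "y \<in> C1" using x gt xv by (auto simp: C1_def intro: less_imp_le)
    qed
    moreover have "y0 \<in> T"
    proof -
      have "x0 \<in> N'" using N(2) by (auto simp: N'_def J'_def)
      moreover have "(x0, v0) \<in> tangent_bundle A" using y0 xv0 cf by (auto simp: cone_field_def)
      moreover have "(x0, v0) \<in> ?good q'" if "q' \<in> J'" for q'
      proof -
        have "q' \<in> \<F>" "x0 \<in> snd q'" using that by (auto simp: J'_def J_def)
        moreover have "v0 \<in> fibre C x0" using y0 xv0 by (simp add: fibre_def)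
        ultimately show ?thesis using q[of q'] \<open>(x0, v0) \<in> tangent_bundle A\<close> by auto
      qed
      ultimately show ?thesis using xv0 by (auto simp: T_def)
    qed
    ultimately show "y0 \<in> (tangent_topology A) interior_of C1" unfolding interior_of_def by blast
  qed
  ultimately show ?thesis by (auto simp: enlargement_def)
qed

section \<open>Thickening the domain by spindles around causal curves\<close>

lemma causal_curve_mono:
  assumes "causal_curve A C I \<gamma>" "C \<subseteq> C'"
  shows "causal_curve A C' I \<gamma>"
proof -
  have "AE t in lebesgue. t \<in> I \<longrightarrow> (\<exists>v. has_velocity A I \<gamma> t v \<and> v \<in> fibre C (\<gamma> t))"
    using assms(1) by (simp add: causal_curve_def)
  moreover have "fibre C x \<subseteq> fibre C' x" for x using assms(2) by (auto simp: fibre_def)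
  ultimately have "AE t in lebesgue. t \<in> I \<longrightarrow> (\<exists>v. has_velocity A I \<gamma> t v \<and> v \<in> fibre C' (\<gamma> t))"
    by (elim AE_mp) (intro AE_I2, blast)
  then show ?thesis using assms(1) by (simp add: causal_curve_def)
qed

text \<open>The domain is closed and the curve lies in it for almost all, hence for a dense set of
  parameters.\<close>

lemma causal_curve_in_domain:
  assumes C: "closed_cone_field A C" and \<gamma>: "causal_curve A C {-1<..<1} \<gamma>" and t: "t \<in> {-1<..<1}"
  shows "\<gamma> t \<in> cone_domain C"
proof (rule ccontr)
  let ?I = "{-1<..<1::real}"
  assume out: "\<gamma> t \<notin> cone_domain C"
  obtain c where c: "c \<in> A" "\<gamma> t \<in> dom_chart c" by (rule atlas_cover)
  have ll: "locally_lipschitz_curve A ?I \<gamma>" using \<gamma> by (simp add: causal_curve_def)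
  have "open (- cone_domain C)" using closed_cone_domain[OF C] by blast
  moreover have "\<gamma> t \<in> - cone_domain C" using out by simp
  ultimately obtain e L where e: "e > 0" "\<gamma> ` (?I \<inter> ball t e) \<subseteq> dom_chart c \<inter> - cone_domain C"
    by (rule locally_lipschitz_in_chart[OF ll t atlas_max[OF c(1)] c(2)])
  have "AE s in lebesgue. s \<in> ?I \<longrightarrow> (\<exists>v. has_velocity A ?I \<gamma> s v \<and> v \<in> fibre C (\<gamma> s))"
    using \<gamma> by (simp add: causal_curve_def)
  moreover have "open (?I \<inter> ball t e)" by (intro open_Int open_ball open_greaterThanLessThan)
  moreover have "?I \<inter> ball t e \<noteq> {}" using t e by auto
  ultimately obtain s where "s \<in> ?I \<inter> ball t e"
    "s \<in> ?I \<longrightarrow> (\<exists>v. has_velocity A ?I \<gamma> s v \<and> v \<in> fibre C (\<gamma> s))"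
    by (rule AE_lebesgue_open_ex)
  moreover from this have "\<gamma> s \<in> - cone_domain C" using e(2) by blast
  ultimately show False by (auto simp: cone_domain_def)
qed

text \<open>The set \<open>K\<close> is a spindle around the coordinate expression \<open>\<beta>\<close> of
  the curve. Derivatives along \<open>\<beta>\<close> may be arbitrarily short, so the radius of
  the spindle is not prescribed as a function of the parameter, but as a function
  \<open>\<rho>\<close> of \<open>q t\<close>, the value of the covector \<open>p\<close> along
  the curve. Then the derivative \<open>w\<close> of \<open>\<beta>\<close> changes by at most a
  small multiple of \<open>norm w\<close>, as is needed for staying in the cones of
  \<open>C1\<close>. The value \<open>q t\<close> is strictly increasing, because
  \<open>p\<close> is positive on the cones.\<close>

lemma solvable_neighborhood:
  assumes C: "closed_cone_field A C" and C1: "enlargement A C C1"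
    and \<gamma>: "causal_curve A C {-1<..<1} \<gamma>" "\<gamma> 0 = x0" and W: "open W" "x0 \<in> W"
  obtains V K where "open V" "x0 \<in> V" "V \<subseteq> K" "K \<subseteq> W" "compact K"
    "\<And>y. y \<in> K - cone_domain C \<Longrightarrow> \<exists>\<gamma>. causal_curve A (restrict_field C1 K) {-1<..<1} \<gamma> \<and> \<gamma> 0 = y"
proof -
  obtain c where cA: "c \<in> A" "x0 \<in> dom_chart c" by (rule atlas_cover)
  have c: "c \<in> maximal_atlas A" by (rule atlas_max[OF cA(1)])
  have cf: "cone_field A C" using C by (simp add: closed_cone_field_def)
  have cf1: "cone_field A C1" using C1 by (auto simp: enlargement_def closed_cone_field_def)
  define z0 where "z0 = coord c x0"
  have z0: "z0 \<in> chart_ran c" using cA by (simp add: z0_def)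
  obtain p \<kappa> r where b: "\<kappa> > 0" "r > 0" "cball z0 r \<subseteq> chart_ran c"
    "\<And>z w. z \<in> cball z0 r \<Longrightarrow> w \<in> cone_at c C z \<Longrightarrow> p \<bullet> w > \<kappa> * norm w"
    by (rule uniform_cone_bound[OF C c z0]) blast
  define U where "U = (tangent_topology A) interior_of C1"
  have UC1: "U \<subseteq> C1" unfolding U_def by (rule interior_of_subset)
  have CU: "C \<subseteq> U" using C1 by (simp add: enlargement_def U_def)
  let ?Kc = "{(z, w). z \<in> cball z0 r \<and> norm w = 1 \<and> w \<in> cone_at c C z}"
  let ?O = "{(z, w). z \<in> chart_ran c \<and> w \<in> cone_at c U z}"
  have "open ?O" unfolding U_def by (rule open_cone_at[OF c openin_interior_of])
  moreover have "?Kc \<subseteq> ?O" using b(3) cone_at_mono[OF CU, of c] by blast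
  ultimately obtain \<eta> where \<eta>: "\<eta> > 0" "(\<Union>k\<in>?Kc. cball k \<eta>) \<subseteq> ?O"
    by (rule compact_subset_open_imp_cball_epsilon_subset[OF compact_unit_cones[OF C c b(3)]])
  have pert: "w' \<in> cone_at c C1 z'"
    if z: "z \<in> cball z0 r" and w: "w \<in> cone_at c C z" and z': "norm (z' - z) \<le> \<eta> / 2"
      and w': "norm (w' - w) \<le> \<eta> / 2 * norm w" for z w z' w'
  proof -
    have zr: "z \<in> chart_ran c" using z b(3) by blast
    have nw: "norm w > 0" using cone_at_nonzero[OF cf c zr w] by simp
    let ?u = "(1 / norm w) *\<^sub>R w" and ?u' = "(1 / norm w) *\<^sub>R w'"
    have k: "(z, ?u) \<in> ?Kc" using cone_at_normalize[OF cf c zr w] z by auto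
    have "norm (?u' - ?u) = norm (w' - w) / norm w"
      by (simp add: scaleR_diff_right[symmetric])
    also have "\<dots> \<le> \<eta> / 2" using w' nw by (simp add: divide_le_eq)
    finally have "norm (z' - z) + norm (?u' - ?u) \<le> \<eta>" using z' by simp
    then have "dist (z, ?u) (z', ?u') \<le> \<eta>"
      using norm_Pair_le[of "z' - z" "?u' - ?u"]
      unfolding dist_commute[of "(z, ?u)" "(z', ?u')"] dist_norm[of "(z', ?u')"] by simp
    then have "(z', ?u') \<in> cball (z, ?u) \<eta>" by (simp only: mem_cball)
    then have "(z', ?u') \<in> ?O" by (rule subsetD[OF \<eta>(2) UN_I[OF k]])
    then have z'r: "z' \<in> chart_ran c" and "?u' \<in> cone_at c C1 z'"
      using cone_at_mono[OF UC1, of c] by blast+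
    from cone_at_scale[OF cf1 c z'r nw this(2)] show ?thesis using nw by simp
  qed
  define N where "N = W \<inter> (dom_chart c \<inter> coord c -` ball z0 r)"
  have N: "open N" "x0 \<in> N"
    using W cA b(2) open_coord_vimage[OF max_is_chart[OF c] open_ball] by (auto simp: N_def z0_def)
  have g0: "\<gamma> 0 \<in> dom_chart c" "\<gamma> 0 \<in> N" using \<gamma>(2) cA N by auto
  define \<beta> where "\<beta> = coord c \<circ> \<gamma>"
  obtain \<delta> L where \<delta>: "0 < \<delta>" "\<delta> < 1" and sub: "\<gamma> ` {-\<delta>..\<delta>} \<subseteq> dom_chart c \<inter> N"
    and lip: "L-lipschitz_on {-\<delta>..\<delta>} \<beta>"
    and ae: "AE t in lebesgue. t \<in> {-\<delta>..\<delta>} \<longrightarrow>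
      (\<exists>w\<in>cone_at c C (\<beta> t). (\<beta> has_vector_derivative w) (at t))"
    unfolding \<beta>_def by (rule causal_curve_in_chart[OF \<gamma>(1) c g0(1) N(1) g0(2)])
  have \<beta>b: "\<beta> t \<in> cball z0 r" if "t \<in> {-\<delta>..\<delta>}" for t
    using sub that by (fastforce simp: \<beta>_def N_def)
  have cont\<beta>: "continuous_on {-\<delta>..\<delta>} \<beta>" using lip by (rule lipschitz_on_continuous_on)
  define \<Omega> where "\<Omega> = coord c ` (dom_chart c \<inter> W)"
  have "open \<Omega>" unfolding \<Omega>_def using c W by (intro open_coord_image open_Int open_chart_dom) auto
  moreover have "\<beta> ` {-\<delta>..\<delta>} \<subseteq> \<Omega>" using sub by (auto simp: \<beta>_def \<Omega>_def N_def)
  moreover have "compact (\<beta> ` {-\<delta>..\<delta>})" by (intro compact_continuous_image cont\<beta> compact_Icc)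
  ultimately obtain e2 where e2: "e2 > 0" "(\<Union>z\<in>\<beta> ` {-\<delta>..\<delta>}. cball z e2) \<subseteq> \<Omega>"
    using compact_subset_open_imp_cball_epsilon_subset by metis
  define q where "q t = p \<bullet> (\<beta> t - z0)" for t
  have q_lip: "(norm p * L)-lipschitz_on {-\<delta>..\<delta>} q"
    using lipschitz_on_inner[OF lip, of p]
    by (simp add: lipschitz_on_def q_def inner_diff_right dist_real_def)
  have q_der: "(q has_real_derivative (p \<bullet> w)) (at t)" if "(\<beta> has_vector_derivative w) (at t)"
      for t w
    using that unfolding q_def has_real_derivative_iff_has_vector_derivative
        has_vector_derivative_def
    by (auto intro!: derivative_eq_intros simp: inner_scaleR_right)
  have q_less: "q s < q t" if st: "s < t" "-\<delta> \<le> s" "t \<le> \<delta>" for s t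
  proof -
    have "AE t in lebesgue. t \<in> {-\<delta>..\<delta>} \<longrightarrow> (\<exists>w. p \<bullet> w > 0 \<and> (\<beta> has_vector_derivative w) (at t))"
      using ae
    proof (rule AE_mp, intro AE_I2 impI)
      fix x assume *: "x \<in> {-\<delta>..\<delta>} \<longrightarrow> (\<exists>w\<in>cone_at c C (\<beta> x). (\<beta> has_vector_derivative w) (at x))"
        "x \<in> {-\<delta>..\<delta>}"
      then obtain w where w: "w \<in> cone_at c C (\<beta> x)" "(\<beta> has_vector_derivative w) (at x)" by blast
      have "0 \<le> \<kappa> * norm w" using b(1) by simp
      also have "\<dots> < p \<bullet> w" using b(4)[OF \<beta>b[OF *(2)] w(1)] .
      finally show "\<exists>w. p \<bullet> w > 0 \<and> (\<beta> has_vector_derivative w) (at x)" using w(2) by blast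
    qed
    from inner_increasing_along_curve[OF lip this st(2,1,3)] show ?thesis
      by (simp add: q_def inner_diff_right)
  qed
  have q0: "q 0 = 0" using \<gamma>(2) by (simp add: q_def \<beta>_def z0_def)
  define a where "a = q (-\<delta>)"
  define h where "h = q \<delta>"
  have ah: "a < 0" "0 < h" using q_less[of "-\<delta>" 0] q_less[of 0 \<delta>] \<delta> q0 by (auto simp: a_def h_def)
  have q_le: "a \<le> q t" "q t \<le> h" if "t \<in> {-\<delta>..\<delta>}" for t
    using q_less[of "-\<delta>" t] q_less[of t \<delta>] that by (force simp: a_def h_def)+
  \<comment> \<open>The radius and the relative change of the derivative are bounded by \<open>\<epsilon> * (h - a)\<^sup>2\<close> and
      \<open>\<epsilon> * ((h - a) * norm p)\<close>; the choice of \<open>\<epsilon>\<close> makes both at most \<open>m\<close>.\<close>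
  define m where "m = min (\<eta> / 2) e2"
  define \<epsilon> where "\<epsilon> = m / ((h - a)\<^sup>2 + (h - a) * norm p + 1)"
  have den: "(h - a)\<^sup>2 + (h - a) * norm p + 1 > 0" using ah by (simp add: add_nonneg_pos)
  have m: "m > 0" using \<eta>(1) e2(1) by (simp add: m_def)
  have \<epsilon>: "\<epsilon> > 0" using m den by (simp add: \<epsilon>_def)
  have "\<epsilon> * ((h - a)\<^sup>2 + (h - a) * norm p + 1) = m" using den by (simp add: \<epsilon>_def)
  then have "\<epsilon> * (h - a)\<^sup>2 + \<epsilon> * ((h - a) * norm p) + \<epsilon> = m" by (simp add: algebra_simps)
  moreover have "\<epsilon> * (h - a)\<^sup>2 \<ge> 0" "\<epsilon> * ((h - a) * norm p) \<ge> 0" using \<epsilon> ah by auto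
  ultimately have \<epsilon>1: "\<epsilon> * (h - a)\<^sup>2 \<le> m" and \<epsilon>2: "\<epsilon> * ((h - a) * norm p) \<le> m" using \<epsilon> by linarith+
  define \<rho> where "\<rho> s = \<epsilon> * ((h - s) * (s - a))" for s
  have \<rho>_nonneg: "0 \<le> \<rho> s" and \<rho>_le: "\<rho> s \<le> m" if "a \<le> s" "s \<le> h" for s
  proof -
    show "0 \<le> \<rho> s" using that \<epsilon> by (simp add: \<rho>_def)
    have "(h - s) * (s - a) \<le> (h - a) * (h - a)" using that by (intro mult_mono) auto
    then have "\<rho> s \<le> \<epsilon> * ((h - a) * (h - a))" using \<epsilon> by (simp add: \<rho>_def)
    then show "\<rho> s \<le> m" using \<epsilon>1 by (simp add: power2_eq_square)
  qed
  have \<rho>_lip: "\<bar>\<rho> s - \<rho> s'\<bar> \<le> \<epsilon> * (h - a) * \<bar>s - s'\<bar>" if "a \<le> s" "s \<le> h" "a \<le> s'" "s' \<le> h" for s s'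
  proof -
    have "\<rho> s - \<rho> s' = \<epsilon> * ((h + a - s - s') * (s - s'))" by (simp add: \<rho>_def algebra_simps)
    then have "\<bar>\<rho> s - \<rho> s'\<bar> = \<epsilon> * (\<bar>h + a - s - s'\<bar> * \<bar>s - s'\<bar>)" using \<epsilon> by (simp add: abs_mult)
    moreover have "\<bar>h + a - s - s'\<bar> \<le> h - a" using that by linarith
    then have "\<bar>h + a - s - s'\<bar> * \<bar>s - s'\<bar> \<le> (h - a) * \<bar>s - s'\<bar>" by (rule mult_right_mono) simp
    ultimately show ?thesis using \<epsilon> by (simp add: mult.assoc mult_left_mono)
  qed
  define \<sigma> where "\<sigma> u t = \<beta> t + \<rho> (q t) *\<^sub>R u" for u t
  have \<sigma>\<beta>: "norm (\<sigma> u t - \<beta> t) \<le> m" if "t \<in> {-\<delta>..\<delta>}" "norm u \<le> 1" for u t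
  proof -
    have "norm (\<sigma> u t - \<beta> t) = \<rho> (q t) * norm u" using \<rho>_nonneg[OF q_le[OF that(1)]]
        by (simp add: \<sigma>_def)
    also have "\<dots> \<le> m * 1" using \<rho>_le[OF q_le[OF that(1)]] that(2) m by (intro mult_mono) auto
    finally show ?thesis by simp
  qed
  have \<sigma>\<Omega>: "\<sigma> u t \<in> \<Omega>" if "t \<in> {-\<delta>..\<delta>}" "norm u \<le> 1" for u t
  proof -
    have "\<sigma> u t \<in> cball (\<beta> t) e2" using \<sigma>\<beta>[OF that]
        by (simp add: dist_norm norm_minus_commute m_def)
    then show ?thesis using e2(2) that(1) by blast
  qed
  have \<Omega>r: "\<Omega> \<subseteq> chart_ran c" by (auto simp: \<Omega>_def)
  define K where "K = (\<lambda>(t, u). chart_inv c (\<sigma> u t)) ` ({-\<delta>..\<delta>} \<times> cball 0 1)"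
  have contq: "continuous_on {-\<delta>..\<delta>} q" using q_lip by (rule lipschitz_on_continuous_on)
  have "compact K"
    unfolding K_def
  proof (intro compact_continuous_image compact_Times compact_Icc compact_cball)
    have 1: "continuous_on ({-\<delta>..\<delta>} \<times> cball (0::'e) 1) (\<lambda>x. \<beta> (fst x))"
      by (rule continuous_on_compose2[OF cont\<beta> continuous_on_fst[OF continuous_on_id]]) auto
    have 2: "continuous_on ({-\<delta>..\<delta>} \<times> cball (0::'e) 1) (\<lambda>x. q (fst x))"
      by (rule continuous_on_compose2[OF contq continuous_on_fst[OF continuous_on_id]]) auto
    have "continuous_on ({-\<delta>..\<delta>} \<times> cball (0::'e) 1) (\<lambda>x. \<sigma> (snd x) (fst x))"
      unfolding \<sigma>_def \<rho>_def by (intro continuous_intros 1 2)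
    then show "continuous_on ({-\<delta>..\<delta>} \<times> cball 0 1) (\<lambda>(t, u). chart_inv c (\<sigma> u t))"
      unfolding case_prod_unfold
      by (rule continuous_on_compose2[OF chart_inv_continuous[OF max_is_chart[OF c]]])
        (use \<sigma>\<Omega> \<Omega>r in auto)
  qed
  have KW: "K \<subseteq> W"
  proof
    fix y assume "y \<in> K"
    then obtain t u where tu: "t \<in> {-\<delta>..\<delta>}" "norm u \<le> 1" "y = chart_inv c (\<sigma> u t)"
        by (auto simp: K_def)
    then obtain y' where "y' \<in> dom_chart c \<inter> W" "\<sigma> u t = coord c y'" using \<sigma>\<Omega> by (auto simp: \<Omega>_def)
    then show "y \<in> W" using tu(3) c by auto
  qed
  let ?V = "dom_chart c \<inter> coord c -` ball z0 (\<rho> 0)"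
  have \<rho>0: "\<rho> 0 > 0" unfolding \<rho>_def using ah \<epsilon> by (intro mult_pos_pos) auto
  have "?V \<subseteq> K"
  proof
    fix y assume y: "y \<in> ?V"
    let ?u = "(1 / \<rho> 0) *\<^sub>R (coord c y - z0)"
    have "norm ?u \<le> 1" using y \<rho>0 by (simp add: dist_norm norm_minus_commute)
    moreover have "\<sigma> ?u 0 = coord c y" using \<rho>0 q0 \<gamma>(2) by (simp add: \<sigma>_def \<beta>_def z0_def)
    ultimately show "y \<in> K" using y c \<delta> unfolding K_def
      by (intro image_eqI[of _ _ "(0, ?u)"]) auto
  qed
  have lip\<sigma>: "\<exists>M. M-lipschitz_on {-\<delta>..\<delta>} (\<sigma> u)" if u: "norm u \<le> 1" for u
  proof -
    have "(L + \<epsilon> * (h - a) * (norm p * L))-lipschitz_on {-\<delta>..\<delta>} (\<sigma> u)"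
    proof (rule lipschitz_onI)
      fix s t assume st: "s \<in> {-\<delta>..\<delta>}" "t \<in> {-\<delta>..\<delta>}"
      have "\<bar>\<rho> (q s) - \<rho> (q t)\<bar> \<le> \<epsilon> * (h - a) * \<bar>q s - q t\<bar>" by (intro \<rho>_lip q_le st)
      also have "\<dots> \<le> \<epsilon> * (h - a) * (norm p * L * dist s t)"
        using lipschitz_onD[OF q_lip st] \<epsilon> ah by (intro mult_left_mono) (auto simp: dist_real_def)
      finally have 1: "\<bar>\<rho> (q s) - \<rho> (q t)\<bar> \<le> \<epsilon> * (h - a) * (norm p * L * dist s t)" .
      have "\<sigma> u s - \<sigma> u t = (\<beta> s - \<beta> t) + (\<rho> (q s) - \<rho> (q t)) *\<^sub>R u"
        by (simp add: \<sigma>_def algebra_simps)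
      then have "norm (\<sigma> u s - \<sigma> u t) \<le> norm (\<beta> s - \<beta> t) + \<bar>\<rho> (q s) - \<rho> (q t)\<bar> * norm u"
        by (metis norm_scaleR norm_triangle_ineq)
      also have "\<dots> \<le> L * dist s t + \<epsilon> * (h - a) * (norm p * L * dist s t) * 1"
        using lipschitz_onD[OF lip st] 1 u by (intro add_mono mult_mono) (auto simp: dist_norm)
      finally show "dist (\<sigma> u s) (\<sigma> u t) \<le> (L + \<epsilon> * (h - a) * (norm p * L)) * dist s t"
        by (simp add: dist_norm algebra_simps)
    qed (use lipschitz_on_nonneg[OF lip] \<epsilon> ah in auto)
    then show ?thesis by blast
  qed
  have \<sigma>_der: "\<exists>w'\<in>cone_at c C1 (\<sigma> u t). (\<sigma> u has_vector_derivative w') (at t)"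
    if t: "t \<in> {-\<delta>..\<delta>}" and u: "norm u \<le> 1"
        and w: "w \<in> cone_at c C (\<beta> t)" "(\<beta> has_vector_derivative w) (at t)"
    for t u w
  proof -
    let ?k = "\<epsilon> * ((h + a - 2 * q t) * (p \<bullet> w))"
    have "((\<lambda>t. \<rho> (q t)) has_real_derivative ?k) (at t)"
      unfolding \<rho>_def using q_der[OF w(2)]
          by (auto intro!: derivative_eq_intros simp: algebra_simps)
    then have der: "(\<sigma> u has_vector_derivative (w + ?k *\<^sub>R u)) (at t)"
      unfolding \<sigma>_def using w(2)
      by (auto intro!: derivative_eq_intros simp: has_real_derivative_iff_has_vector_derivative)
    have "\<bar>h + a - 2 * q t\<bar> \<le> h - a" using q_le[OF t] by linarith
    moreover have "\<bar>p \<bullet> w\<bar> \<le> norm p * norm w" by (rule Cauchy_Schwarz_ineq2)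
    ultimately have "\<bar>h + a - 2 * q t\<bar> * \<bar>p \<bullet> w\<bar> \<le> (h - a) * (norm p * norm w)"
      by (intro mult_mono) auto
    then have "\<bar>?k\<bar> \<le> \<epsilon> * ((h - a) * (norm p * norm w))" using \<epsilon> by (simp add: abs_mult)
    also have "\<dots> = \<epsilon> * ((h - a) * norm p) * norm w" by simp
    also have "\<dots> \<le> m * norm w" using \<epsilon>2 by (rule mult_right_mono) simp
    finally have k: "\<bar>?k\<bar> \<le> m * norm w" .
    have "norm (w + ?k *\<^sub>R u - w) \<le> m * norm w * 1"
      using mult_mono[OF k u] m by (simp add: zero_le_mult_iff)
    also have "\<dots> \<le> \<eta> / 2 * norm w" using mult_right_mono[of m "\<eta> / 2" "norm w"] by (simp add: m_def)
    finally have "norm (w + ?k *\<^sub>R u - w) \<le> \<eta> / 2 * norm w" .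
    moreover have "norm (\<sigma> u t - \<beta> t) \<le> \<eta> / 2" using \<sigma>\<beta>[OF t u] by (simp add: m_def)
    ultimately have "w + ?k *\<^sub>R u \<in> cone_at c C1 (\<sigma> u t)" using pert[OF \<beta>b[OF t] w(1)] by blast
    then show ?thesis using der by blast
  qed
  have solv: "\<exists>\<gamma>. causal_curve A (restrict_field C1 K) {-1<..<1} \<gamma> \<and> \<gamma> 0 = y"
    if y: "y \<in> K - cone_domain C" for y
  proof -
    from y obtain t u where tu: "t \<in> {-\<delta>..\<delta>}" "norm u \<le> 1" "y = chart_inv c (\<sigma> u t)"
        by (auto simp: K_def)
    have "t \<noteq> s" if s: "s \<in> {-\<delta>..\<delta>}" "\<rho> (q s) = 0" for s
    proof
      assume "t = s"
      then have "y = chart_inv c (\<beta> s)" using s tu by (simp add: \<sigma>_def)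
      moreover have "\<gamma> s \<in> dom_chart c" using sub s(1) by blast
      ultimately have "y = \<gamma> s" using c by (simp add: \<beta>_def)
      moreover have "s \<in> {-1<..<1}" using s(1) \<delta> by auto
      ultimately show False using causal_curve_in_domain[OF C \<gamma>(1)] y by blast
    qed
    \<comment> \<open>At the two ends the spindle degenerates to points of the curve, which lie in the domain.\<close>
    from this[of \<delta>] this[of "-\<delta>"] tu(1) \<delta>(1) have t: "-\<delta> < t" "t < \<delta>"
      by (auto simp: \<rho>_def a_def h_def)
    define \<tau> where "\<tau> = min (\<delta> - t) (t + \<delta>)"
    have \<tau>: "\<tau> > 0" "\<tau> \<le> \<delta> - t" "\<tau> \<le> t + \<delta>" using t by (auto simp: \<tau>_def)
    have rng: "t + \<tau> * s \<in> {-\<delta><..<\<delta>}" if "s \<in> {-1<..<1}" for s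
    proof -
      have "\<bar>\<tau> * s\<bar> < \<tau>" using that \<tau>(1) by (auto simp: abs_mult)
      then show ?thesis using \<tau>(2,3) by (auto simp: abs_less_iff)
    qed
    define \<alpha> where "\<alpha> s = \<sigma> u (t + \<tau> * s)" for s
    obtain M where M: "M-lipschitz_on {-\<delta>..\<delta>} (\<sigma> u)" using lip\<sigma>[OF tu(2)] by blast
    have lip\<alpha>: "(M * \<tau>)-lipschitz_on {-1<..<1} \<alpha>"
    proof (rule lipschitz_onI)
      fix s s' :: real assume "s \<in> {-1<..<1}" "s' \<in> {-1<..<1}"
      then have "t + \<tau> * s \<in> {-\<delta>..\<delta>}" "t + \<tau> * s' \<in> {-\<delta>..\<delta>}" using rng by (auto intro: less_imp_le)
      from lipschitz_onD[OF M this] show "dist (\<alpha> s) (\<alpha> s') \<le> M * \<tau> * dist s s'"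
        using \<tau>(1) by (simp add: \<alpha>_def dist_real_def right_diff_distrib[symmetric] abs_mult
            mult.assoc)
    qed (use lipschitz_on_nonneg[OF M] \<tau> in simp)
    have "causal_curve A (restrict_field C1 K) {-1<..<1} (chart_inv c \<circ> \<alpha>)"
    proof (rule causal_curve_chart_invI[OF c lip\<alpha>])
      show "\<alpha> ` {-1<..<1} \<subseteq> chart_ran c"
        using \<sigma>\<Omega>[OF _ tu(2)] \<Omega>r rng by (fastforce simp: \<alpha>_def)
      have "AE s in lebesgue. t + \<tau> * s \<in> {-\<delta>..\<delta>} \<longrightarrow>
          (\<exists>w\<in>cone_at c C (\<beta> (t + \<tau> * s)). (\<beta> has_vector_derivative w) (at (t + \<tau> * s)))"
        using AE_lebesgue_affine[OF ae] \<tau>(1) by simp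
      then show "AE s in lebesgue. s \<in> {-1<..<1} \<longrightarrow>
          (\<exists>w\<in>cone_at c (restrict_field C1 K) (\<alpha> s). (\<alpha> has_vector_derivative w) (at s))"
      proof (rule AE_mp, intro AE_I2 impI)
        fix s :: real
        assume *: "t + \<tau> * s \<in> {-\<delta>..\<delta>} \<longrightarrow>
          (\<exists>w\<in>cone_at c C (\<beta> (t + \<tau> * s)). (\<beta> has_vector_derivative w) (at (t + \<tau> * s)))"
          "s \<in> {-1<..<1}"
        have ts: "t + \<tau> * s \<in> {-\<delta>..\<delta>}" using rng[OF *(2)] by auto
        with * obtain w where w: "w \<in> cone_at c C (\<beta> (t + \<tau> * s))"
          "(\<beta> has_vector_derivative w) (at (t + \<tau> * s))" by blast
        from \<sigma>_der[OF ts tu(2) w] obtain w' where w': "w' \<in> cone_at c C1 (\<sigma> u (t + \<tau> * s))"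
          "(\<sigma> u has_vector_derivative w') (at (t + \<tau> * s))" by blast
        have "((\<lambda>s. t + \<tau> * s) has_vector_derivative \<tau>) (at s)"
          by (auto intro!: derivative_eq_intros simp:
              has_real_derivative_iff_has_vector_derivative[symmetric])
        from vector_diff_chain_at[OF this w'(2)] have "(\<alpha> has_vector_derivative \<tau> *\<^sub>R w') (at s)"
          by (simp add: \<alpha>_def[abs_def] o_def)
        moreover have "\<alpha> s \<in> chart_ran c" using \<sigma>\<Omega>[OF ts tu(2)] \<Omega>r by (auto simp: \<alpha>_def)
        then have "\<tau> *\<^sub>R w' \<in> cone_at c C1 (\<alpha> s)"
          using cone_at_scale[OF cf1 c _ \<tau>(1)] w'(1) by (simp add: \<alpha>_def)
        moreover have "chart_inv c (\<alpha> s) \<in> K"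
          unfolding K_def \<alpha>_def using ts tu(2) by (intro image_eqI[of _ _ "(t + \<tau> * s, u)"]) auto
        ultimately show "\<exists>w\<in>cone_at c (restrict_field C1 K) (\<alpha> s). (\<alpha> has_vector_derivative w) (at
            s)"
          by (auto simp: cone_at_def restrict_field_def)
      qed
    qed
    moreover have "(chart_inv c \<circ> \<alpha>) 0 = y" using tu(3) by (simp add: \<alpha>_def)
    ultimately show ?thesis by blast
  qed
  show ?thesis
    by (rule that[OF _ _ \<open>?V \<subseteq> K\<close> KW \<open>compact K\<close> solv])
      (use open_coord_vimage[OF max_is_chart[OF c] open_ball] cA \<rho>0 in \<open>auto simp: z0_def\<close>)
qed

lemma locally_finite_closed_Union:
  fixes \<F> :: "('m set \<times> 'm set) set"
  assumes "closed D" "\<And>q. q \<in> \<F> \<Longrightarrow> closed (snd q)"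
    and "\<And>x. \<exists>N. open N \<and> x \<in> N \<and> finite {q \<in> \<F>. snd q \<inter> N \<noteq> {}}"
  shows "closed (D \<union> \<Union> (snd ` \<F>))"
proof -
  have "\<exists>T. open T \<and> x \<in> T \<and> T \<subseteq> - (D \<union> \<Union> (snd ` \<F>))" if x: "x \<in> - (D \<union> \<Union> (snd ` \<F>))" for x
  proof -
    obtain N where N: "open N" "x \<in> N" "finite {q \<in> \<F>. snd q \<inter> N \<noteq> {}}" using assms(3) by blast
    let ?J = "{q \<in> \<F>. snd q \<inter> N \<noteq> {}}"
    let ?T = "(N - D) \<inter> (\<Inter>q\<in>?J. - snd q)"
    have "open ?T" using N assms(1,2) by (intro open_Int open_INT open_Diff) auto
    moreover have "x \<in> ?T" using x N(2) by auto
    moreover have "?T \<subseteq> - (D \<union> \<Union> (snd ` \<F>))" by blast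
    ultimately show ?thesis by blast
  qed
  then have "open (- (D \<union> \<Union> (snd ` \<F>)))" by (rule topological_space_class.openI)
  then show ?thesis by (simp add: closed_def)
qed

text \<open>Points of the domain are on curves of \<open>C\<close>, and the other points of \<open>F\<close>
  are on curves of \<open>C1\<close> inside a spindle.\<close>

lemma ex_solvable_restriction:
  assumes C: "closed_cone_field A C" and solv: "locally_solvable A C" and C1: "enlargement A C C1"
  shows "\<exists>F. closed_neighborhood F (cone_domain C) \<and> enlargement A C (restrict_field C1 F) \<and>
    locally_solvable A (restrict_field C1 F)"
proof -
  let ?D = "cone_domain C"
  have cf: "cone_field A C" using C by (simp add: closed_cone_field_def)
  define Q where "Q V K \<longleftrightarrow> V \<subseteq> K \<and> compact K \<and> (\<forall>y\<in>K - ?D. \<exists>\<gamma>.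
      causal_curve A (restrict_field C1 K) {-1<..<1} \<gamma> \<and> \<gamma> 0 = y)" for V K :: "'m set"
  have loc: "\<exists>V K. Q V K \<and> open V \<and> x \<in> V \<and> K \<subseteq> W" if x: "x \<in> ?D" and W: "open W" "x \<in> W" for x W
  proof -
    obtain \<gamma> where \<gamma>: "causal_curve A C {-1<..<1} \<gamma>" "\<gamma> 0 = x"
      using solv x unfolding locally_solvable_def by blast
    show ?thesis
      by (rule solvable_neighborhood[OF C C1 \<gamma> W]) (unfold Q_def, blast)
  qed
  obtain \<F> where "countable \<F>" and \<F>: "\<forall>q\<in>\<F>. Q (fst q) (snd q) \<and> open (fst q)" "?D \<subseteq> \<Union> (fst ` \<F>)"
    "\<forall>x. \<exists>N. open N \<and> x \<in> N \<and> finite {p \<in> \<F>. snd p \<inter> N \<noteq> {}}"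
    by (rule locally_finite_cover[where Q
        = Q, OF manifold_locally_compact closed_cone_domain[OF C]])
      (rule loc, assumption+)
  define F where "F = ?D \<union> \<Union> (snd ` \<F>)"
  have q: "open (fst q)" "fst q \<subseteq> snd q" "closed (snd q)"
      "\<And>y. y \<in> snd q - ?D \<Longrightarrow> \<exists>\<gamma>. causal_curve A (restrict_field C1 (snd q)) {-1<..<1} \<gamma> \<and> \<gamma> 0 = y"
    if "q \<in> \<F>" for q
    using \<F>(1)[rule_format, OF that] unfolding Q_def by (auto intro: compact_imp_closed)
  have "closed F" unfolding F_def
    by (rule locally_finite_closed_Union[OF closed_cone_domain[OF C] q(3) \<F>(3)[rule_format]])
  moreover have "?D \<subseteq> interior F"
  proof -
    have "\<Union> (fst ` \<F>) \<subseteq> F" using q(2) by (auto simp: F_def)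
    moreover have "open (\<Union> (fst ` \<F>))" using q(1) by auto
    ultimately have "\<Union> (fst ` \<F>) \<subseteq> interior F" by (rule interior_maximal)
    then show ?thesis using \<F>(2) by blast
  qed
  ultimately have F: "closed_neighborhood F ?D" by (simp add: closed_neighborhood_def)
  note en = enlargement_restrict_field[OF cf C1 F]
  have cfF: "cone_field A (restrict_field C1 F)" using en
      by (simp add: enlargement_def closed_cone_field_def)
  have "\<exists>\<gamma>. causal_curve A (restrict_field C1 F) {-1<..<1} \<gamma> \<and> \<not> \<gamma> constant_on {-1<..<1} \<and> \<gamma> 0 = x"
    if x: "x \<in> cone_domain (restrict_field C1 F)" for x
  proof -
    have "x \<in> F" using x by (auto simp: cone_domain_def fibre_def restrict_field_def)
    then consider "x \<in> ?D" | q where "q \<in> \<F>" "x \<in> snd q - ?D" by (auto simp: F_def)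
    then have "\<exists>\<gamma>. causal_curve A (restrict_field C1 F) {-1<..<1} \<gamma> \<and> \<gamma> 0 = x"
    proof cases
      case 1
      then obtain \<gamma> where \<gamma>: "causal_curve A C {-1<..<1} \<gamma>" "\<gamma> 0 = x"
        using solv unfolding locally_solvable_def by blast
      then show ?thesis using causal_curve_mono[OF _ enlargement_superset[OF en]] by blast
    next
      case 2
      have "restrict_field C1 (snd q) \<subseteq> restrict_field C1 F"
        using 2(1) by (auto simp: restrict_field_def F_def)
      then show ?thesis using q(4)[OF 2] causal_curve_mono by blast
    qed
    then show ?thesis using causal_curve_nonconstant[OF cfF] by blast
  qed
  then have "locally_solvable A (restrict_field C1 F)" by (simp add: locally_solvable_def)
  then show ?thesis using F en by blast
qed

section \<open>Cones at a smooth boundary\<close>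

text \<open>If the convex cone at a boundary point missed the tangent hyperplane, it would lie strictly on
  one side, and so would the cones nearby. Then \<open>\<beta> t \<bullet> b\<close> would be
  strictly monotone along the causal curve. But it vanishes at \<open>0\<close> and is
  nonnegative on both sides of \<open>0\<close>, as the curve stays in the domain.\<close>

lemma tangent_vector_at_boundary:
  assumes C: "closed_cone_field A C" and \<gamma>: "causal_curve A C {-1<..<1} \<gamma>" "\<gamma> 0 = x0"
    and c: "c \<in> maximal_atlas A" "x0 \<in> dom_chart c"
    and half: "\<And>y. y \<in> dom_chart c \<Longrightarrow> y \<in> cone_domain C \<Longrightarrow> 0 \<le> coord c y \<bullet> b"
    and z0: "coord c x0 \<bullet> b = 0"
  shows "\<exists>w\<in>cone_at c C (coord c x0). w \<bullet> b = 0"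
proof (rule ccontr)
  assume none: "\<not> (\<exists>w\<in>cone_at c C (coord c x0). w \<bullet> b = 0)"
  let ?z0 = "coord c x0"
  have cf: "cone_field A C" using C by (simp add: closed_cone_field_def)
  have zr: "?z0 \<in> chart_ran c" using c by blast
  have "\<not> (w1 \<bullet> b < 0 \<and> 0 < w2 \<bullet> b)" if w: "w1 \<in> cone_at c C ?z0" "w2 \<in> cone_at c C ?z0" for w1 w2
  proof
    assume s: "w1 \<bullet> b < 0 \<and> 0 < w2 \<bullet> b"
    let ?a = "(w2 \<bullet> b) / (w2 \<bullet> b - w1 \<bullet> b)"
    have "0 \<le> ?a" "?a \<le> 1" using s by (auto simp: divide_le_eq)
    then have "?a *\<^sub>R w1 + (1 - ?a) *\<^sub>R w2 \<in> cone_at c C ?z0"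
      using convexD_alt[OF cone_at_convex[OF cf c(1) zr] w(2,1), of ?a] by (simp add: add.commute)
    moreover have "(?a *\<^sub>R w1 + (1 - ?a) *\<^sub>R w2) \<bullet> b = 0"
      using s by (simp add: inner_add_left divide_simps) (simp add: algebra_simps)
    ultimately show False using none by blast
  qed
  then obtain s :: real where s: "s = 1 \<or> s = -1" "\<And>w. w \<in> cone_at c C ?z0 \<Longrightarrow> (s *\<^sub>R b) \<bullet> w > 0"
  proof -
    assume *: "\<And>w1 w2. w1 \<in> cone_at c C ?z0 \<Longrightarrow> w2 \<in> cone_at c C ?z0 \<Longrightarrow> \<not> (w1 \<bullet> b < 0 \<and> 0 < w2 \<bullet> b)"
      and th: "\<And>s. s = 1 \<or> s = -1 \<Longrightarrow> (\<And>w. w \<in> cone_at c C ?z0 \<Longrightarrow> (s *\<^sub>R b) \<bullet> w > 0) \<Longrightarrow> thesis"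
    have nz: "w \<bullet> b < 0 \<or> 0 < w \<bullet> b" if "w \<in> cone_at c C ?z0" for w
      using none that by (meson linorder_neqE_linordered_idom)
    show thesis
    proof (cases "\<exists>w\<in>cone_at c C ?z0. w \<bullet> b < 0")
      case True
      then have "w \<bullet> b < 0" if "w \<in> cone_at c C ?z0" for w using * nz that by blast
      then show ?thesis using th[of "-1"] by (simp add: inner_commute)
    next
      case False
      then show ?thesis using th[of 1] nz by (auto simp: inner_commute)
    qed
  qed
  have "open (UNIV \<times> {w. (s *\<^sub>R b) \<bullet> w > 0})" by (intro open_Times open_UNIV open_halfspace_gt)
  from cone_at_upper_semicontinuous[OF C c(1) zr this] s(2)
  obtain r where r: "r > 0"
    "\<And>z w. z \<in> cball ?z0 r \<Longrightarrow> w \<in> cone_at c C z \<Longrightarrow> norm w = 1 \<Longrightarrow> (s *\<^sub>R b) \<bullet> w > 0"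
    by (metis (no_types, lifting) UNIV_I mem_Collect_eq mem_Sigma_iff)
  have pos: "(s *\<^sub>R b) \<bullet> w > 0" if z: "z \<in> cball ?z0 r" "z \<in> chart_ran c" and w: "w \<in> cone_at c C z"
      for z w
  proof -
    have "(s *\<^sub>R b) \<bullet> ((1 / norm w) *\<^sub>R w) > 0"
      using r(2)[OF z(1) cone_at_normalize[OF cf c(1) z(2) w]] .
    then show ?thesis using cone_at_nonzero[OF cf c(1) z(2) w]
      by (simp add: zero_less_divide_iff)
  qed
  define N where "N = dom_chart c \<inter> coord c -` ball ?z0 r"
  have N: "open N" "\<gamma> 0 \<in> N" and g0: "\<gamma> 0 \<in> dom_chart c"
    using open_coord_vimage[OF max_is_chart[OF c(1)] open_ball] c \<gamma>(2) r(1) by (auto simp: N_def)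
  define \<beta> where "\<beta> = coord c \<circ> \<gamma>"
  obtain \<delta> L where \<delta>: "0 < \<delta>" "\<delta> < 1" and sub: "\<gamma> ` {-\<delta>..\<delta>} \<subseteq> dom_chart c \<inter> N"
    and lip: "L-lipschitz_on {-\<delta>..\<delta>} \<beta>"
    and ae: "AE t in lebesgue. t \<in> {-\<delta>..\<delta>} \<longrightarrow>
      (\<exists>w\<in>cone_at c C (\<beta> t). (\<beta> has_vector_derivative w) (at t))"
    unfolding \<beta>_def by (rule causal_curve_in_chart[OF \<gamma>(1) c(1) g0 N])
  have ae': "AE t in lebesgue. t \<in> {-\<delta>..\<delta>} \<longrightarrow>
      (\<exists>w. (s *\<^sub>R b) \<bullet> w > 0 \<and> (\<beta> has_vector_derivative w) (at t))"
    using ae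
  proof (rule AE_mp, intro AE_I2 impI)
    fix t assume *: "t \<in> {-\<delta>..\<delta>} \<longrightarrow> (\<exists>w\<in>cone_at c C (\<beta> t). (\<beta> has_vector_derivative w) (at t))" "t \<in>
        {-\<delta>..\<delta>}"
    have "\<gamma> t \<in> N" using sub *(2) by blast
    then have "\<beta> t \<in> cball ?z0 r" "\<beta> t \<in> chart_ran c" by (auto simp: N_def \<beta>_def)
    then show "\<exists>w. (s *\<^sub>R b) \<bullet> w > 0 \<and> (\<beta> has_vector_derivative w) (at t)" using * pos by blast
  qed
  have nn: "0 \<le> b \<bullet> \<beta> t" if "t \<in> {-\<delta>..\<delta>}" for t
  proof -
    have "t \<in> {-1<..<1}" using that \<delta> by auto
    then have "\<gamma> t \<in> cone_domain C" by (rule causal_curve_in_domain[OF C \<gamma>(1)])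
    moreover have "\<gamma> t \<in> dom_chart c" using sub that by blast
    ultimately show ?thesis using half[of "\<gamma> t"] by (simp add: \<beta>_def inner_commute)
  qed
  have zero: "b \<bullet> \<beta> 0 = 0" using z0 \<gamma>(2) by (simp add: \<beta>_def inner_commute)
  have "(s *\<^sub>R b) \<bullet> \<beta> (-\<delta>) < (s *\<^sub>R b) \<bullet> \<beta> 0" "(s *\<^sub>R b) \<bullet> \<beta> 0 < (s *\<^sub>R b) \<bullet> \<beta> \<delta>"
    using \<delta>(1) by (intro inner_increasing_along_curve[OF lip ae']; simp)+
  then show False using s(1) zero nn[of \<delta>] nn[of "-\<delta>"] \<delta>(1) by auto
qed

section \<open>Half space charts adapted to an enlargement\<close>

text \<open>Composing a chart with a diffeomorphism \<open>h\<close> between open sets of coordinates, with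
  inverse \<open>k\<close>. The charts of pushed domains and, for the identity, the restrictions
  of charts are of this form.\<close>

lemma chart_reparametrize:
  assumes c: "c \<in> maximal_atlas A" and U: "open U" "U \<subseteq> chart_ran c" "open (h ` U)"
    and h: "\<And>n. Ck_on n U h" and k: "\<And>n. Ck_on n (h ` U) k" and kh0: "\<forall>z\<in>U. k (h z) = z"
  defines "c' \<equiv> (dom_chart c \<inter> coord c -` U, \<lambda>x. h (coord c x))"
  shows "c' \<in> maximal_atlas A" and "chart_ran c' = h ` U"
    and "\<And>x u. x \<in> dom_chart c' \<Longrightarrow> tdiff c c' x u = frechet_derivative h (at (coord c x)) u"
proof -
  note kh = kh0[rule_format]
  have [simp]: "dom_chart c' = dom_chart c \<inter> coord c -` U" "coord c' = (\<lambda>x. h (coord c x))"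
    by (simp_all add: c'_def)
  have img: "coord c ` (dom_chart c \<inter> coord c -` U) = U" using U(2) by auto
  show ran: "chart_ran c' = h ` U" using img by (simp add: image_image[symmetric])
  have odom: "open (dom_chart c')" using open_coord_vimage[OF max_is_chart[OF c] U(1)] by simp
  have kU: "k ` h ` U \<subseteq> U" using kh by auto
  have "homeomorphism (dom_chart c') (chart_ran c') (coord c') (\<lambda>z. chart_inv c (k z))"
  proof (rule homeomorphismI)
    show "continuous_on (dom_chart c') (coord c')"
    proof -
      have "continuous_on (dom_chart c \<inter> coord c -` U) (\<lambda>x. h (coord c x))"
        by (rule continuous_on_compose2[OF Ck_on_imp_continuous[OF h[of 0]]
              continuous_on_subset[OF chart_continuous[OF max_is_chart[OF c]]]]) auto
      then show ?thesis by simp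
    qed
    have "continuous_on (h ` U) (\<lambda>z. chart_inv c (k z))"
      by (rule continuous_on_compose2[OF continuous_on_subset[OF chart_inv_continuous[OF
          max_is_chart[OF c]] U(2)]
            Ck_on_imp_continuous[OF k[of 0]] kU])
    then show "continuous_on (chart_ran c') (\<lambda>z. chart_inv c (k z))" unfolding ran .
    show "(\<lambda>z. chart_inv c (k z)) ` chart_ran c' \<subseteq> dom_chart c'"
    proof
      fix x assume "x \<in> (\<lambda>z. chart_inv c (k z)) ` chart_ran c'"
      then obtain z where z: "z \<in> U" "x = chart_inv c z" unfolding ran using kh by auto
      then have "z \<in> chart_ran c" using U(2) by blast
      then show "x \<in> dom_chart c'" using z by (auto simp: inv_into_into f_inv_into_f)
    qed
    show "chart_inv c (k (coord c' x)) = x" if "x \<in> dom_chart c'" for x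
      using that kh c by auto
    show "coord c' (chart_inv c (k z)) = z" if "z \<in> chart_ran c'" for z
    proof -
      from that obtain z' where z': "z' \<in> U" "z = h z'" unfolding ran by blast
      then have "z' \<in> chart_ran c" using U(2) by blast
      then show ?thesis using z' kh by (simp add: f_inv_into_f)
    qed
  qed auto
  then have ic: "is_chart c'" using odom U(3) ran unfolding is_chart_def by metis
  have "smoothly_compatible c' d" if d: "d \<in> A" for d
  proof -
    have dm: "d \<in> maximal_atlas A" by (rule atlas_max[OF d])
    let ?T = "coord c' ` (dom_chart c' \<inter> dom_chart d)"
    have oT: "open ?T"
      using ic dm by (intro open_coord_image open_Int open_chart_dom) auto
    let ?T' = "coord d ` (dom_chart c' \<inter> dom_chart d)"
    have oT': "open ?T'"
      using ic dm by (intro open_coord_image open_Int open_chart_dom) auto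
    have "Ck_on n ?T (transition c' d)" for n
    proof -
      have "Ck_on n ?T (\<lambda>z. transition c d (k z))"
      proof (rule Ck_on_compose[OF oT smooth_transition[OF c dm]])
        show "Ck_on n ?T k" by (rule Ck_on_subset[OF k]) auto
        show "k ` ?T \<subseteq> coord c ` (dom_chart c \<inter> dom_chart d)" using kh by auto
      qed
      moreover have "transition c d (k z) = transition c' d z" if "z \<in> ?T" for z
      proof -
        obtain x where x: "x \<in> dom_chart c'" "x \<in> dom_chart d" "z = coord c' x" using \<open>z \<in> ?T\<close>
            by blast
        then have "chart_inv c' z = x" using ic chart_inv_coord by blast
        moreover have "k z = coord c x" using x kh by simp
        ultimately show ?thesis using x c by (simp add: transition_eq)
      qed
      ultimately show ?thesis using Ck_on_cong[OF oT, of "\<lambda>z. transition c d (k z)" "transition c'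
          d"] by blast
    qed
    moreover have "Ck_on n ?T' (transition d c')" for n
    proof -
      have "Ck_on n ?T' (\<lambda>z. h (transition d c z))"
      proof (rule Ck_on_compose[OF oT' h])
        show "Ck_on n ?T' (transition d c)"
            by (rule Ck_on_subset[OF smooth_transition[OF dm c]]) auto
        show "transition d c ` ?T' \<subseteq> U" using dm by (auto simp: transition_eq)
      qed
      moreover have "h (transition d c z) = transition d c' z" if "z \<in> ?T'" for z
        by (simp add: transition_eq)
      ultimately show ?thesis using Ck_on_cong[OF oT', of "\<lambda>z. h (transition d c z)" "transition d
          c'"] by blast
    qed
    ultimately show ?thesis unfolding smoothly_compatible_def smooth_on_def by blast
  qed
  with ic show cm: "c' \<in> maximal_atlas A" unfolding maximal_atlas_def by blast
  fix x u assume x: "x \<in> dom_chart c'"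
  have hd: "(h has_derivative frechet_derivative h (at (coord c x))) (at (coord c x))"
    using Ck_on_has_derivative[OF h[of "Suc 0"]] x by simp
  have "(transition c c' has_derivative frechet_derivative h (at (coord c x))) (at (coord c x))"
  proof (rule has_derivative_transform_within_open[OF hd U(1)])
    show "h z = transition c c' z" if "z \<in> U" for z
    proof -
      have "z \<in> chart_ran c" using that U(2) by blast
      then show ?thesis by (simp add: transition_eq f_inv_into_f)
    qed
  qed (use x in simp)
  from has_derivative_unique[OF this tdiff_has_derivative[OF c cm]] x
  show "tdiff c c' x u = frechet_derivative h (at (coord c x)) u" by simp
qed

lemma chart_restrict:
  assumes c: "c \<in> maximal_atlas A" and N: "open N"
  shows "(dom_chart c \<inter> N, coord c) \<in> maximal_atlas A"
    and "x \<in> dom_chart c \<inter> N \<Longrightarrow> tv (dom_chart c \<inter> N, coord c) x w = tv c x w"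
proof -
  let ?U = "coord c ` (dom_chart c \<inter> N)" and ?c' = "(dom_chart c \<inter> N, coord c)"
  have U: "open ?U" using c N by (intro open_coord_image open_Int open_chart_dom) auto
  have eq: "(dom_chart c \<inter> coord c -` ?U, \<lambda>x. (\<lambda>z. z) (coord c x)) = ?c'"
    using coord_in_image_iff[OF max_is_chart[OF c], of _ "dom_chart c \<inter> N"] by auto
  have U2: "?U \<subseteq> chart_ran c" "open ((\<lambda>z. z) ` ?U)" using U by auto
  have sm: "Ck_on n ?U (\<lambda>z. z)" "Ck_on n ((\<lambda>z. z) ` ?U) (\<lambda>z. z)" for n
    using Ck_on_id[OF U] by simp_all
  have id: "\<forall>z\<in>?U. (\<lambda>z. z) ((\<lambda>z. z) z) = z" by simp
  note R = chart_reparametrize[OF c U U2 sm id, unfolded eq]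
  show cm: "?c' \<in> maximal_atlas A" by (rule R(1))
  show "tv ?c' x w = tv c x w" if x: "x \<in> dom_chart c \<inter> N"
  proof -
    have "tdiff c ?c' x w = w"
      using R(3)[of x w] x frechet_derivative_ident[of "coord c x"]
          by (simp add: frechet_derivative_at[OF has_derivative_ident, symmetric])
    then show ?thesis using tv_change[OF c cm, of x w] x by simp
  qed
qed

text \<open>The set \<open>S\<close> is a half space in a chart around \<open>y\<close>, and some
  \<open>w\<close>, read as a constant vector field in this chart, takes a value in
  \<open>U\<close> at \<open>y\<close> and is tangent to the boundary of the half space, or
  \<open>y\<close> is not on this boundary. In both cases short segments in direction
  \<open>w\<close> through \<open>y\<close> stay in \<open>S\<close>. The set \<open>U\<close>
  stands for the interior of an enlargement.\<close>

definition adapted_at :: "('m \<times> ('m, 'e) tvec) set \<Rightarrow> 'm set \<Rightarrow> 'm \<Rightarrow> bool" where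
  "adapted_at U S y \<longleftrightarrow> (\<exists>c\<in>maximal_atlas A. y \<in> dom_chart c \<and> (\<exists>b\<in>Basis.
     coord c ` (dom_chart c \<inter> S) = chart_ran c \<inter> {z. 0 \<le> z \<bullet> b} \<and>
     (\<exists>w. (y, tv c y w) \<in> U \<and> (w \<bullet> b = 0 \<or> 0 < coord c y \<bullet> b))))"

definition adapted_domain :: "('m \<times> ('m, 'e) tvec) set \<Rightarrow> 'm set \<Rightarrow> bool" where
  "adapted_domain U S \<longleftrightarrow> closed S \<and> (\<forall>y\<in>S. adapted_at U S y)"

lemma half_space_chart_iff:
  assumes "c \<in> maximal_atlas A" "coord c ` (dom_chart c \<inter> S) = chart_ran c \<inter> {z. 0 \<le> z \<bullet> b}"
    "x \<in> dom_chart c"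
  shows "x \<in> S \<longleftrightarrow> 0 \<le> coord c x \<bullet> b"
  using coord_in_image_iff[OF max_is_chart[OF assms(1)] assms(3), of "dom_chart c \<inter> S"] assms
      by auto

lemma half_space_chartI:
  assumes "\<And>x. x \<in> dom_chart c \<Longrightarrow> x \<in> S \<longleftrightarrow> 0 \<le> coord c x \<bullet> b"
  shows "coord c ` (dom_chart c \<inter> S) = chart_ran c \<inter> {z. 0 \<le> z \<bullet> b}"
  using assms by auto

lemma adapted_at_local:
  assumes "adapted_at U S y" "open N" "y \<in> N" "S \<inter> N = S' \<inter> N"
  shows "adapted_at U S' y"
proof -
  obtain c b w where c: "c \<in> maximal_atlas A" "y \<in> dom_chart c" "b \<in> Basis"
    "coord c ` (dom_chart c \<inter> S) = chart_ran c \<inter> {z. 0 \<le> z \<bullet> b}"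
    "(y, tv c y w) \<in> U" "w \<bullet> b = 0 \<or> 0 < coord c y \<bullet> b"
    using assms(1) unfolding adapted_at_def by blast
  let ?c' = "(dom_chart c \<inter> N, coord c)"
  have "coord ?c' ` (dom_chart ?c' \<inter> S') = chart_ran ?c' \<inter> {z. 0 \<le> z \<bullet> b}"
    by (rule half_space_chartI) (use half_space_chart_iff[OF c(1,4)] assms(4) in auto)
  moreover have "(y, tv ?c' y w) \<in> U" using chart_restrict(2)[OF c(1) assms(2), of y w] c assms(3)
      by simp
  ultimately show ?thesis
    unfolding adapted_at_def using c(2,3,6) assms(3)
        by (intro bexI[OF _ chart_restrict(1)[OF c(1) assms(2)]]) auto
qed

lemma adapted_domain_smooth: "adapted_domain U S \<Longrightarrow> smooth_domain A S"
  unfolding adapted_domain_def adapted_at_def smooth_domain_def by blast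

text \<open>Since \<open>U\<close> is open, a short segment in direction \<open>w\<close> keeps its velocity
  in \<open>U\<close>.\<close>

lemma adapted_domain_curve:
  assumes cf: "cone_field A C1" and U: "openin (tangent_topology A) U" "U \<subseteq> C1"
    and S: "adapted_domain U S" and y: "y \<in> S"
  shows "\<exists>\<gamma>. causal_curve A (restrict_field C1 S) {-1<..<1} \<gamma> \<and> \<gamma> 0 = y"
proof -
  obtain c b w where c: "c \<in> maximal_atlas A" "y \<in> dom_chart c" "b \<in> Basis"
    "coord c ` (dom_chart c \<inter> S) = chart_ran c \<inter> {z. 0 \<le> z \<bullet> b}"
    "(y, tv c y w) \<in> U" "w \<bullet> b = 0 \<or> 0 < coord c y \<bullet> b"
    using S y unfolding adapted_domain_def adapted_at_def by blast
  let ?z = "coord c y"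
  let ?l = "\<lambda>t. ?z + t *\<^sub>R w"
  let ?P = "{(z, w). z \<in> chart_ran c \<and> w \<in> cone_at c U z}"
  have "open ?P" by (rule open_cone_at[OF c(1) U(1)])
  moreover have cl: "continuous_on UNIV ?l" by (intro continuous_intros)
  then have "continuous_on UNIV (\<lambda>t. (?l t, w))" by (intro continuous_intros)
  ultimately have "open ((\<lambda>t. (?l t, w)) -` ?P)" by (rule open_vimage)
  moreover have "open {t. 0 < ?l t \<bullet> b}" by (intro open_Collect_less continuous_intros)
  moreover have "0 \<in> (\<lambda>t. (?l t, w)) -` ?P"
    using c mem_cone_at_coord[OF c(1,2)] by (simp add: fibre_def)
  moreover have "0 \<le> ?z \<bullet> b" using half_space_chart_iff[OF c(1,4,2)] y by simp
  ultimately obtain \<tau> where \<tau>: "\<tau> > 0" "\<And>t. \<bar>t\<bar> < \<tau> \<Longrightarrow> (?l t, w) \<in> ?P \<and> 0 \<le> ?l t \<bullet> b"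
  proof -
    assume o: "open ((\<lambda>t. (?l t, w)) -` ?P)" "open {t. 0 < ?l t \<bullet> b}" "0 \<in> (\<lambda>t. (?l t, w)) -` ?P"
      and th: "\<And>\<tau>. \<tau> > 0 \<Longrightarrow> (\<And>t. \<bar>t\<bar> < \<tau> \<Longrightarrow> (?l t, w) \<in> ?P \<and> 0 \<le> ?l t \<bullet> b) \<Longrightarrow> thesis"
          and nn: "0 \<le> ?z \<bullet> b"
    show thesis
    proof (cases "w \<bullet> b = 0")
      case True
      obtain \<tau> where "\<tau> > 0" "ball 0 \<tau> \<subseteq> (\<lambda>t. (?l t, w)) -` ?P" using o(1,3) open_contains_ball
          by blast
      then show thesis using th[of \<tau>] True nn by (auto simp: subset_iff inner_add_left)
    next
      case False
      then have "0 \<in> (\<lambda>t. (?l t, w)) -` ?P \<inter> {t. 0 < ?l t \<bullet> b}" using o(3) c(6) by auto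
      then obtain \<tau> where "\<tau> > 0" "ball 0 \<tau> \<subseteq> (\<lambda>t. (?l t, w)) -` ?P \<inter> {t. 0 < ?l t \<bullet> b}"
        using open_Int[OF o(1,2)] open_contains_ball by blast
      then show thesis using th[of \<tau>] by (auto simp: subset_iff intro: less_imp_le)
    qed
  qed
  define \<alpha> where "\<alpha> s = ?z + (\<tau> * s) *\<^sub>R w" for s :: real
  have \<alpha>: "\<alpha> s \<in> chart_ran c" "w \<in> cone_at c U (\<alpha> s)" "0 \<le> \<alpha> s \<bullet> b" if "s \<in> {-1<..<1}" for s
  proof -
    have "\<bar>\<tau> * s\<bar> < \<tau>" using that \<tau>(1) by (auto simp: abs_mult)
    from \<tau>(2)[OF this] show "\<alpha> s \<in> chart_ran c" "w \<in> cone_at c U (\<alpha> s)" "0 \<le> \<alpha> s \<bullet> b"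
      by (auto simp: \<alpha>_def)
  qed
  have "causal_curve A (restrict_field C1 S) {-1<..<1} (chart_inv c \<circ> \<alpha>)"
  proof (rule causal_curve_chart_invI[OF c(1)])
    show "(\<tau> * norm w)-lipschitz_on {-1<..<1} \<alpha>"
      using \<tau>(1) by (intro lipschitz_onI)
        (auto simp: \<alpha>_def dist_norm scaleR_diff_left[symmetric] right_diff_distrib[symmetric]
            abs_mult)
    show "\<alpha> ` {-1<..<1} \<subseteq> chart_ran c" using \<alpha> by blast
    have "\<exists>w\<in>cone_at c (restrict_field C1 S) (\<alpha> s). (\<alpha> has_vector_derivative w) (at s)"
      if s: "s \<in> {-1<..<1}" for s
    proof
      have "(\<alpha> has_derivative (\<lambda>h. (\<tau> * h) *\<^sub>R w)) (at s)"
        unfolding \<alpha>_def[abs_def] by (auto intro!: derivative_eq_intros)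
      then show "(\<alpha> has_vector_derivative \<tau> *\<^sub>R w) (at s)"
        by (simp add: has_vector_derivative_def mult.commute)
      have "w \<in> cone_at c C1 (\<alpha> s)" using \<alpha>(2)[OF s] cone_at_mono[OF U(2), of c] by blast
      then have "\<tau> *\<^sub>R w \<in> cone_at c C1 (\<alpha> s)" by (rule cone_at_scale[OF cf c(1) \<alpha>(1)[OF s] \<tau>(1)])
      moreover have "chart_inv c (\<alpha> s) \<in> S"
        using half_space_chart_iff[OF c(1,4), of "chart_inv c (\<alpha> s)"] \<alpha>[OF s]
        by (simp add: inv_into_into f_inv_into_f)
      ultimately show "\<tau> *\<^sub>R w \<in> cone_at c (restrict_field C1 S) (\<alpha> s)"
        by (simp add: cone_at_def restrict_field_def)
    qed
    then show "AE s in lebesgue. s \<in> {-1<..<1} \<longrightarrow>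
      (\<exists>w\<in>cone_at c (restrict_field C1 S) (\<alpha> s). (\<alpha> has_vector_derivative w) (at s))"
      by (intro AE_I2) blast
  qed
  moreover have "(chart_inv c \<circ> \<alpha>) 0 = y" using c by (simp add: \<alpha>_def)
  ultimately show ?thesis by blast
qed

lemma adapted_cone_domain:
  assumes C: "closed_cone_field A C" and solv: "locally_solvable A C" and U: "C \<subseteq> U"
    and sd: "smooth_domain A (cone_domain C)"
  shows "adapted_domain U (cone_domain C)"
  unfolding adapted_domain_def
proof (intro conjI ballI closed_cone_domain[OF C])
  fix y assume y: "y \<in> cone_domain C"
  have cf: "cone_field A C" using C by (simp add: closed_cone_field_def)
  obtain c b where c: "c \<in> maximal_atlas A" "y \<in> dom_chart c" "b \<in> Basis"
    "coord c ` (dom_chart c \<inter> cone_domain C) = chart_ran c \<inter> {z. 0 \<le> z \<bullet> b}"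
    using sd y unfolding smooth_domain_def by blast
  have "\<exists>w\<in>cone_at c C (coord c y). w \<bullet> b = 0 \<or> 0 < coord c y \<bullet> b"
  proof (cases "coord c y \<bullet> b = 0")
    case True
    obtain \<gamma> where \<gamma>: "causal_curve A C {-1<..<1} \<gamma>" "\<gamma> 0 = y"
      using solv y unfolding locally_solvable_def by blast
    have "0 \<le> coord c x \<bullet> b" if "x \<in> dom_chart c" "x \<in> cone_domain C" for x
      using half_space_chart_iff[OF c(1,4) that(1)] that(2) by simp
    from tangent_vector_at_boundary[OF C \<gamma> c(1,2) this True] show ?thesis by blast
  next
    case False
    then have "0 < coord c y \<bullet> b" using half_space_chart_iff[OF c(1,4,2)] y by simp
    then show ?thesis using cone_domain_iff[OF cf c(1,2)] y by blast
  qed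
  then obtain w where w: "w \<in> cone_at c C (coord c y)" "w \<bullet> b = 0 \<or> 0 < coord c y \<bullet> b" by blast
  have "(y, tv c y w) \<in> U" using mem_cone_at_coord[OF c(1,2)] w(1) U by (auto simp: fibre_def)
  then show "adapted_at U (cone_domain C) y"
    unfolding adapted_at_def using c w(2)
        by (intro bexI[OF _ c(1)] conjI bexI[OF _ c(3)] exI[of _ w])
qed


section \<open>Pushing a smooth boundary outwards\<close>

text \<open>The set \<open>S'\<close> is the preimage of \<open>S\<close> under a diffeomorphism
  \<open>\<Psi> \<epsilon>\<close> that, in the half space chart \<open>c0\<close> of
  \<open>D\<close>, moves the points of a ball in the inner normal direction \<open>b0\<close>.
  It maps points of \<open>D\<close> in the ball into the interior of \<open>D\<close>, which is
  contained in \<open>S\<close>; so these points are interior to \<open>S'\<close>. As the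
  inclusion \<open>D \<subseteq> S\<close> is preserved, the step can be iterated with charts of
  \<open>D\<close>, whatever the charts of \<open>S\<close> are. The charts of \<open>S'\<close>
  are those of \<open>S\<close> composed with \<open>\<Psi> \<epsilon>\<close>, with the same
  vectors \<open>w\<close>; compactness gives an \<open>\<epsilon>\<close> for which these
  vectors still have values in \<open>U\<close>.\<close>

lemma push_boundary_outward:
  assumes U: "openin (tangent_topology A) U"
    and c0: "c0 \<in> maximal_atlas A" "x0 \<in> dom_chart c0" and b0: "b0 \<in> Basis"
    and D: "coord c0 ` (dom_chart c0 \<inter> D) = chart_ran c0 \<inter> {z. 0 \<le> z \<bullet> b0}"
    and W: "open W" "x0 \<in> W"
  obtains V K where "open V" "x0 \<in> V" "K \<subseteq> W"
    "\<And>S. adapted_domain U S \<Longrightarrow> D \<subseteq> S \<Longrightarrow> \<exists>S'. adapted_domain U S' \<and> D \<subseteq> S' \<and>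
       S' - K = S - K \<and> V \<inter> D \<subseteq> interior S' \<and> D \<inter> interior S \<subseteq> interior S'"
proof -
  define z0 where "z0 = coord c0 x0"
  obtain r where r: "0 < r" "cball z0 r \<subseteq> coord c0 ` (dom_chart c0 \<inter> W)"
    "open (dom_chart c0 \<inter> coord c0 -` ball z0 r)"
    "compact (dom_chart c0 \<inter> coord c0 -` cball z0 r)"
    "dom_chart c0 \<inter> coord c0 -` cball z0 r \<subseteq> W"
    unfolding z0_def using coordinate_ball[OF c0 W zero_less_one] by metis
  define V where "V = dom_chart c0 \<inter> coord c0 -` ball z0 r"
  define K where "K = dom_chart c0 \<inter> coord c0 -` cball z0 r"
  have cr: "cball z0 r \<subseteq> chart_ran c0" using r(2) by blast
  have ic0: "is_chart c0" using c0(1) by simp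
  obtain \<rho> :: "'e \<Rightarrow> real" and L where \<rho>: "smooth_on UNIV \<rho>" "\<And>z. \<rho> z \<ge> 0" "\<And>z. \<rho> z \<le> 1"
    "\<And>z. \<rho> z > 0 \<longleftrightarrow> z \<in> ball z0 r" "L-lipschitz_on UNIV \<rho>" "L > 0"
    using ex_smooth_bump[OF r(1), of z0] by metis
  have \<rho>0: "\<rho> z = 0" if "z \<notin> ball z0 r" for z using \<rho>(2,4)[of z] that by force
  have nb0: "norm b0 = 1" using b0 by simp
  define D\<rho> where "D\<rho> z = frechet_derivative \<rho> (at z)" for z
  have \<rho>der: "(\<rho> has_derivative D\<rho> z) (at z)" for z
    unfolding D\<rho>_def using Ck_on_has_derivative[of 0] \<rho>(1) unfolding smooth_on_def by (metis UNIV_I)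
  have D\<rho>L: "\<bar>D\<rho> z v\<bar> \<le> L * norm v" for z v by (rule lipschitz_deriv_bound[OF \<rho>der \<rho>(5)])
  have step: "\<exists>S'. adapted_domain U S' \<and> D \<subseteq> S' \<and>
       S' - K = S - K \<and> V \<inter> D \<subseteq> interior S' \<and> D \<inter> interior S \<subseteq> interior S'"
    if S: "adapted_domain U S" and DS: "D \<subseteq> S" for S
  proof -
    define \<psi> where "\<psi> \<epsilon> z = z + (\<epsilon> * \<rho> z) *\<^sub>R b0" for \<epsilon> z
    define \<Psi> where "\<Psi> \<epsilon> x = (if x \<in> dom_chart c0 then chart_inv c0 (\<psi> \<epsilon> (coord c0 x)) else x)"
        for \<epsilon> x
    define good where "good \<epsilon> \<longleftrightarrow> 0 < \<epsilon> \<and> \<epsilon> * L \<le> 1/2" for \<epsilon>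
    have \<psi>_out: "\<psi> \<epsilon> z = z" if "z \<notin> ball z0 r" for \<epsilon> z using \<rho>0[OF that] by (simp add: \<psi>_def)
    have inj\<psi>: "z = z'" if "good \<epsilon>" "\<psi> \<epsilon> z = \<psi> \<epsilon> z'" for \<epsilon> z z'
    proof -
      have "0 \<le> \<epsilon>" "\<epsilon> * L < 1" using that(1) by (auto simp: good_def)
      from bump_shift_diffeo[OF \<rho>(1,5) nb0 this] obtain \<phi> where "\<And>z. \<phi> (z + (\<epsilon> * \<rho> z) *\<^sub>R b0) = z"
          by metis
      then show ?thesis using that(2) unfolding \<psi>_def by metis
    qed
    have \<psi>_cball: "\<psi> \<epsilon> z \<in> cball z0 r \<longleftrightarrow> z \<in> cball z0 r" if "good \<epsilon>" for \<epsilon> z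
    proof (cases "z \<in> cball z0 r")
      case True
      have "\<psi> \<epsilon> z \<in> cball z0 r"
      proof (rule ccontr)
        assume n: "\<psi> \<epsilon> z \<notin> cball z0 r"
        then have "\<psi> \<epsilon> z \<notin> ball z0 r" by auto
        then have "z = \<psi> \<epsilon> z" using inj\<psi>[OF that] \<psi>_out by metis
        then show False using n True by simp
      qed
      then show ?thesis using True by simp
    next
      case False
      then have "z \<notin> ball z0 r" by auto
      then show ?thesis using \<psi>_out by simp
    qed
    have \<psi>_ran: "\<psi> \<epsilon> z \<in> chart_ran c0 \<longleftrightarrow> z \<in> chart_ran c0" if "good \<epsilon>" for \<epsilon> z
    proof (cases "z \<in> cball z0 r")
      case True
      then show ?thesis using \<psi>_cball[OF that, of z] cr by blast
    next
      case False
      then have "z \<notin> ball z0 r" by auto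
      then show ?thesis using \<psi>_out by simp
    qed
    have \<Psi>_dom: "\<Psi> \<epsilon> x \<in> dom_chart c0 \<longleftrightarrow> x \<in> dom_chart c0"
      and \<Psi>_coord: "x \<in> dom_chart c0 \<Longrightarrow> coord c0 (\<Psi> \<epsilon> x) = \<psi> \<epsilon> (coord c0 x)" if "good \<epsilon>" for \<epsilon> x
      using \<psi>_ran[OF that, of "coord c0 x"]
      by (auto simp: \<Psi>_def inv_into_into f_inv_into_f)
    have \<Psi>_out: "\<Psi> \<epsilon> x = x" if "x \<notin> V" for \<epsilon> x
      using that \<psi>_out[of "coord c0 x" \<epsilon>] ic0 by (auto simp: \<Psi>_def V_def)
    have \<Psi>_K: "\<Psi> \<epsilon> x \<in> K \<longleftrightarrow> x \<in> K" if "good \<epsilon>" for \<epsilon> x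
      using \<Psi>_dom[OF that] \<Psi>_coord[OF that] \<psi>_cball[OF that] unfolding K_def
          by (metis IntD1 IntD2 IntI vimageD vimageI2)
    have VK: "V \<subseteq> K" by (auto simp: V_def K_def)
    have closedK: "closed K" using r(4) unfolding K_def by (rule compact_imp_closed)
    have cont\<psi>: "continuous_on UNIV (\<psi> \<epsilon>)" for \<epsilon>
      unfolding \<psi>_def by (intro continuous_intros lipschitz_on_continuous_on[OF \<rho>(5)])
    have cont\<Psi>: "continuous_on UNIV (\<Psi> \<epsilon>)" if g: "good \<epsilon>" for \<epsilon>
    proof -
      have "continuous_on (dom_chart c0) (\<lambda>x. chart_inv c0 (\<psi> \<epsilon> (coord c0 x)))"
      proof (rule continuous_on_compose2[OF chart_inv_continuous[OF ic0]])
        show "continuous_on (dom_chart c0) (\<lambda>x. \<psi> \<epsilon> (coord c0 x))"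
          by (rule continuous_on_compose2[OF cont\<psi> chart_continuous[OF ic0]]) simp
        show "(\<lambda>x. \<psi> \<epsilon> (coord c0 x)) ` dom_chart c0 \<subseteq> chart_ran c0" using \<psi>_ran[OF g] by blast
      qed
      then have 1: "continuous_on (dom_chart c0) (\<Psi> \<epsilon>)"
        by (rule continuous_on_eq) (simp add: \<Psi>_def)
      have 2: "continuous_on (- K) (\<Psi> \<epsilon>)"
        by (rule continuous_on_eq[OF continuous_on_id], rule \<Psi>_out[symmetric]) (use VK in blast)
      have "continuous_on (dom_chart c0 \<union> - K) (\<Psi> \<epsilon>)"
        by (rule continuous_on_open_Un[OF open_chart_dom[OF ic0] _ 1 2]) (use closedK in auto)
      moreover have "dom_chart c0 \<union> - K = UNIV" by (auto simp: K_def)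
      ultimately show ?thesis by simp
    qed
    \<comment> \<open>Around \<open>y0\<close> one chart of \<open>S\<close> yields charts of the pushed set, for all small \<open>\<epsilon>\<close> and all nearby points.\<close>
    have locl: "\<exists>N e. open N \<and> y0 \<in> N \<and> 0 < e \<and>
        (\<forall>\<epsilon> x. good \<epsilon> \<longrightarrow> \<epsilon> < e \<longrightarrow> \<Psi> \<epsilon> x \<in> N \<longrightarrow> \<Psi> \<epsilon> x \<in> S \<longrightarrow> adapted_at U (\<Psi> \<epsilon> -` S) x)"
      if y0: "y0 \<in> K \<inter> S" for y0
    proof -
      have y00: "y0 \<in> dom_chart c0" using y0 by (simp add: K_def)
      obtain c b w where c: "c \<in> maximal_atlas A" "y0 \<in> dom_chart c" "b \<in> Basis"
        "coord c ` (dom_chart c \<inter> S) = chart_ran c \<inter> {z. 0 \<le> z \<bullet> b}"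
        "(y0, tv c y0 w) \<in> U" "w \<bullet> b = 0 \<or> 0 < coord c y0 \<bullet> b"
        using S y0 unfolding adapted_domain_def adapted_at_def by blast
      define w0 where "w0 y = tdiff c c0 y w" for y
      let ?zc = "coord c0 y0"
      let ?P = "{(z, u). z \<in> chart_ran c0 \<and> u \<in> cone_at c0 U z}"
      have "(?zc, w0 y0) \<in> ?P"
        using c(5) tv_change[OF c(1) c0(1) c(2) y00] mem_cone_at_coord[OF c0(1) y00] y00
        by (simp add: w0_def fibre_def)
      then obtain \<eta> where \<eta>: "\<eta> > 0" "ball (?zc, w0 y0) \<eta> \<subseteq> ?P"
        using open_cone_at[OF c0(1) U] open_contains_ball by blast
      have P: "u \<in> cone_at c0 U z" if "norm (z - ?zc) < \<eta> / 2" "norm (u - w0 y0) < \<eta> / 2" for z u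
      proof -
        have "norm (z - ?zc) + norm (u - w0 y0) < \<eta>" using that by simp
        then have "dist (z, u) (?zc, w0 y0) < \<eta>"
          using norm_Pair_le[of "z - ?zc" "u - w0 y0"] unfolding dist_norm by simp
        then have "(z, u) \<in> ball (?zc, w0 y0) \<eta>" by (simp only: mem_ball dist_commute)
        then show ?thesis using \<eta>(2) by blast
      qed
      let ?M = "dom_chart c \<inter> dom_chart c0"
      have contc0: "continuous_on ?M (coord c0)"
          by (rule continuous_on_subset[OF chart_continuous[OF ic0]]) auto
      have contc: "continuous_on ?M (coord c)"
        by (rule continuous_on_subset[OF chart_continuous[OF max_is_chart[OF c(1)]]]) auto
      have contw0: "continuous_on ?M w0"
      proof -
        have 1: "continuous_on (coord c ` ?M \<times> UNIV) (\<lambda>p. tdiff c c0 (chart_inv c (fst p)) (snd p))"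
          using continuous_on_snd[OF continuous_on_transition_diff[OF c(1) c0(1)]]
              by (simp add: case_prod_unfold)
        have "continuous_on ?M (\<lambda>y. tdiff c c0 (chart_inv c (fst (coord c y, w))) (snd (coord c y,
            w)))"
          by (rule continuous_on_compose2[OF 1]) (auto intro!: continuous_intros contc)
        then show ?thesis by (rule continuous_on_eq) (use c(1) in \<open>simp add: w0_def\<close>)
      qed
      have oM: "open ?M" using c(1) ic0 by (intro open_Int open_chart_dom) auto
      define N where "N = ?M \<inter> coord c0 -` ball ?zc (\<eta> / 4) \<inter> (?M \<inter> w0 -` ball (w0 y0) (\<eta> / 4)) \<inter>
          (if 0 < coord c y0 \<bullet> b then ?M \<inter> coord c -` {z. 0 < z \<bullet> b} else UNIV)"
      have half_open: "open {z. 0 < z \<bullet> b}" by (intro open_Collect_less continuous_intros)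
      have "open (if 0 < coord c y0 \<bullet> b then ?M \<inter> coord c -` {z. 0 < z \<bullet> b} else UNIV)"
        by (cases "0 < coord c y0 \<bullet> b")
          (simp_all only: if_True if_False open_UNIV continuous_open_preimage[OF contc oM
              half_open])
      then have N: "open N"
        unfolding N_def
        by (intro open_Int continuous_open_preimage[OF contc0 oM open_ball]
            continuous_open_preimage[OF contw0 oM open_ball])
      have yN: "y0 \<in> N" using c(2) y00 \<eta>(1) by (simp add: N_def)
      have NM: "N \<subseteq> dom_chart c" "N \<subseteq> dom_chart c0" by (auto simp: N_def)
      \<comment> \<open>\<open>B\<close> bounds \<open>w0\<close> near \<open>y0\<close>. A shift below \<open>e\<close> moves points by less than \<open>\<eta> / 4\<close> and changes
          \<open>w0\<close> by at most \<open>2 * e * L * B \<le> \<eta> / 4\<close>.\<close>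
      define B where "B = norm (w0 y0) + \<eta>"
      define e where "e = min (\<eta> / 4) (\<eta> / (8 * (L * B + 1)))"
      have B: "B > 0" using \<eta>(1) by (simp add: B_def add_nonneg_pos)
      have LB: "L * B > 0" using B \<rho>(6) by simp
      have e: "e > 0" using \<eta>(1) LB by (simp add: e_def)
      have "adapted_at U (\<Psi> \<epsilon> -` S) x" if g: "good \<epsilon>" and \<epsilon>e: "\<epsilon> < e" and xN: "\<Psi> \<epsilon> x \<in> N"
          and xS: "\<Psi> \<epsilon> x \<in> S" for \<epsilon> x
      proof -
        have \<epsilon>: "0 < \<epsilon>" "\<epsilon> * L \<le> 1/2" "0 \<le> \<epsilon>" "\<epsilon> * L < 1" using g by (auto simp: good_def)
        obtain \<phi> where \<phi>: "\<And>z. \<phi> (\<psi> \<epsilon> z) = z" "\<And>y. \<psi> \<epsilon> (\<phi> y) = y" "smooth_on UNIV \<phi>"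
          using bump_shift_diffeo[OF \<rho>(1,5) nb0 \<epsilon>(3,4)] unfolding \<psi>_def by metis
        let ?N0 = "coord c0 ` N"
        have oN0: "open ?N0" by (rule open_coord_image[OF ic0 N NM(2)])
        define R where "R = \<psi> \<epsilon> -` ?N0"
        have oR: "open R" unfolding R_def by (rule open_vimage[OF oN0 cont\<psi>])
        have Rran: "R \<subseteq> chart_ran c0"
        proof
          fix z assume "z \<in> R"
          then have "\<psi> \<epsilon> z \<in> chart_ran c0" using NM(2) by (auto simp: R_def)
          then show "z \<in> chart_ran c0" using \<psi>_ran[OF g] by blast
        qed
        have \<psi>R: "\<psi> \<epsilon> ` R = ?N0"
        proof (intro equalityI subsetI)
          fix z assume "z \<in> ?N0"
          then show "z \<in> \<psi> \<epsilon> ` R" using \<phi>(2)[of z]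
              by (intro image_eqI[of _ _ "\<phi> z"]) (auto simp: R_def)
        qed (auto simp: R_def)
        define h where "h z = transition c0 c (\<psi> \<epsilon> z)" for z
        define k where "k z = \<phi> (transition c c0 z)" for z
        have h_coord: "h (coord c0 x) = coord c (\<Psi> \<epsilon> x)" if "x \<in> dom_chart c0" for x
          using that unfolding h_def transition_eq by (simp add: \<Psi>_def)
        have hR: "h ` R = coord c ` N"
        proof -
          have "h ` R = transition c0 c ` (\<psi> \<epsilon> ` R)" by (simp add: h_def image_image)
          also have "\<dots> = coord c ` N"
            unfolding \<psi>R image_image using NM(2) ic0
                by (intro image_cong refl) (auto simp: transition_eq)
          finally show ?thesis .
        qed
        have ohR: "open (h ` R)" unfolding hR
            by (rule open_coord_image[OF max_is_chart[OF c(1)] N NM(1)])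
        have sm\<psi>: "Ck_on n UNIV (\<psi> \<epsilon>)" for n
          unfolding \<psi>_def using \<rho>(1)
          by (intro Ck_on_add Ck_on_scaleR Ck_on_mult Ck_on_const Ck_on_id open_UNIV) (simp add:
              smooth_on_def)
        have smh: "Ck_on n R h" for n
          unfolding h_def
        proof (rule Ck_on_compose[OF oR smooth_transition[OF c0(1) c(1)]])
          show "Ck_on n R (\<psi> \<epsilon>)" by (rule Ck_on_subset[OF sm\<psi>]) simp
          show "\<psi> \<epsilon> ` R \<subseteq> coord c0 ` (dom_chart c0 \<inter> dom_chart c)" unfolding \<psi>R using NM by blast
        qed
        have smk: "Ck_on n (h ` R) k" for n
          unfolding k_def
        proof (rule Ck_on_compose[where f = \<phi> and g = "transition c c0" and T = UNIV, OF ohR])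
          show "Ck_on n UNIV \<phi>" using \<phi>(3) by (simp add: smooth_on_def)
          show "Ck_on n (h ` R) (transition c c0)"
            unfolding hR by (rule Ck_on_subset[OF smooth_transition[OF c(1) c0(1)]]) (use NM in
                blast)
        qed simp
        have kh: "\<forall>z\<in>R. k (h z) = z"
        proof
          fix z assume "z \<in> R"
          then obtain y where y: "y \<in> N" "\<psi> \<epsilon> z = coord c0 y" by (auto simp: R_def)
          then have "h z = coord c y" using NM(2) ic0 by (auto simp: h_def transition_eq)
          then have "transition c c0 (h z) = \<psi> \<epsilon> z" using y NM(1) c(1) by (auto simp: transition_eq)
          then show "k (h z) = z" using \<phi>(1) by (simp add: k_def)
        qed
        define c' where "c' = (dom_chart c0 \<inter> coord c0 -` R, \<lambda>x. h (coord c0 x))"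
        note R' = chart_reparametrize[OF c0(1) oR Rran ohR smh smk kh, folded c'_def]
        have dc': "dom_chart c' = dom_chart c0 \<inter> coord c0 -` R"
            and cc': "coord c' = (\<lambda>x. h (coord c0 x))"
          by (simp_all add: c'_def)
        have mem_dc': "x' \<in> dom_chart c' \<longleftrightarrow> \<Psi> \<epsilon> x' \<in> N" for x'
        proof (cases "x' \<in> dom_chart c0")
          case True
          then show ?thesis
            using coord_in_image_iff[OF ic0, of "\<Psi> \<epsilon> x'" N] NM(2) \<Psi>_dom[OF g, of x'] \<Psi>_coord[OF g
                True]
            by (simp add: dc' R_def)
        next
          case False
          then show ?thesis using \<Psi>_dom[OF g, of x'] NM(2) by (auto simp: dc')
        qed
        have cc'_eq: "coord c' x' = coord c (\<Psi> \<epsilon> x')" if "x' \<in> dom_chart c'" for x'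
          using that h_coord by (simp add: dc' cc')
        have xd: "x \<in> dom_chart c'" using mem_dc' xN by blast
        have xc0: "x \<in> dom_chart c0" using xd by (simp add: dc')
        have half: "coord c' ` (dom_chart c' \<inter> \<Psi> \<epsilon> -` S) = chart_ran c' \<inter> {z. 0 \<le> z \<bullet> b}"
        proof (rule half_space_chartI)
          fix x' assume x': "x' \<in> dom_chart c'"
          then have "\<Psi> \<epsilon> x' \<in> dom_chart c" using mem_dc' NM(1) by blast
          from half_space_chart_iff[OF c(1,4) this] show "x' \<in> \<Psi> \<epsilon> -` S \<longleftrightarrow> 0 \<le> coord c' x' \<bullet> b"
            using cc'_eq[OF x'] by simp
        qed
        let ?y = "\<Psi> \<epsilon> x" and ?z = "coord c0 x"
        have yd: "?y \<in> dom_chart c" "?y \<in> dom_chart c0" using xN NM by blast+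
        have yz: "coord c0 ?y = \<psi> \<epsilon> ?z" by (rule \<Psi>_coord[OF g xc0])
        let ?q = "1 + \<epsilon> * D\<rho> ?z b0"
        let ?w0 = "w0 ?y"
        \<comment> \<open>\<open>u\<close> is the preimage of \<open>w0\<close> under the differential of \<open>\<psi> \<epsilon>\<close>, the identity plus a map of rank one; it
            represents the vector \<open>w\<close> of the new chart in \<open>c0\<close>.\<close>
        define u where "u = ?w0 - (\<epsilon> * D\<rho> ?z ?w0 / ?q) *\<^sub>R b0"
        have "\<bar>\<epsilon> * D\<rho> ?z b0\<bar> \<le> \<epsilon> * L" using D\<rho>L[of ?z b0] nb0 \<epsilon>(1) by (simp add: abs_mult)
        then have q: "?q \<ge> 1/2" using \<epsilon>(2) by linarith
        have D\<psi>: "(\<psi> \<epsilon> has_derivative (\<lambda>v. v + (\<epsilon> * D\<rho> ?z v) *\<^sub>R b0)) (at ?z)"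
          unfolding \<psi>_def by (auto intro!: derivative_eq_intros \<rho>der)
        have lin: "linear (D\<rho> ?z)" using \<rho>der has_derivative_linear by blast
        have "D\<rho> ?z u = D\<rho> ?z ?w0 - (\<epsilon> * D\<rho> ?z ?w0 / ?q) * D\<rho> ?z b0"
          unfolding u_def by (simp add: linear_diff[OF lin] linear_cmul[OF lin])
        also have "\<dots> = D\<rho> ?z ?w0 / ?q" using q by (simp add: field_simps)
        finally have Du: "u + (\<epsilon> * D\<rho> ?z u) *\<^sub>R b0 = ?w0" by (simp add: u_def)
        have "tdiff c0 c' x u = w"
        proof -
          have "(transition c0 c has_derivative tdiff c0 c ?y) (at (\<psi> \<epsilon> ?z))"
            using tdiff_has_derivative[OF c0(1) c(1) yd(2,1)] yz by simp
          from has_derivative_compose[OF D\<psi> this]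
          have "(h has_derivative (\<lambda>v. tdiff c0 c ?y (v + (\<epsilon> * D\<rho> ?z v) *\<^sub>R b0))) (at ?z)"
            by (simp add: h_def[abs_def])
          then have "frechet_derivative h (at ?z) u = tdiff c0 c ?y (u + (\<epsilon> * D\<rho> ?z u) *\<^sub>R b0)"
            by (simp add: frechet_derivative_at[symmetric])
          also have "\<dots> = tdiff c0 c ?y (tdiff c c0 ?y w)" unfolding Du w0_def ..
          also have "\<dots> = w" using tdiff_compose[OF c(1) c0(1) c(1) yd(1,2,1)] tdiff_self[OF c(1)
              yd(1)] by simp
          finally show ?thesis using R'(3)[OF xd] by simp
        qed
        then have tvx: "tv c' x w = tv c0 x u"
          using tv_change[OF c0(1) R'(1) xc0 xd, of u] by simp
        have "u \<in> cone_at c0 U ?z"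
        proof (rule P)
          have "\<epsilon> * \<rho> ?z \<le> \<epsilon>" using \<epsilon>(1) \<rho>(3)[of ?z] by (simp add: mult_left_le)
          moreover have "norm (\<psi> \<epsilon> ?z - ?z) = \<epsilon> * \<rho> ?z" using \<epsilon>(1) \<rho>(2)[of ?z] nb0
              by (simp add: \<psi>_def)
          ultimately have "norm (?z - \<psi> \<epsilon> ?z) < \<eta> / 4" using \<epsilon>e
              by (simp add: e_def norm_minus_commute)
          moreover have "norm (\<psi> \<epsilon> ?z - ?zc) < \<eta> / 4"
            using xN yz by (simp add: N_def dist_norm norm_minus_commute)
          ultimately show "norm (?z - ?zc) < \<eta> / 2"
            using norm_triangle_ineq[of "?z - \<psi> \<epsilon> ?z" "\<psi> \<epsilon> ?z - ?zc"] by simp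
          have w0n: "norm (?w0 - w0 y0) < \<eta> / 4" using xN
              by (simp add: N_def dist_norm norm_minus_commute)
          then have "norm ?w0 \<le> B"
            using norm_triangle_ineq[of "?w0 - w0 y0" "w0 y0"] \<eta>(1) by (simp add: B_def)
          then have "\<bar>D\<rho> ?z ?w0\<bar> \<le> L * B"
            using D\<rho>L[of ?z ?w0] \<rho>(6) by (meson less_imp_le mult_left_mono order_trans)
          have "norm (u - ?w0) = \<epsilon> * \<bar>D\<rho> ?z ?w0\<bar> / ?q"
            using q \<epsilon>(1) nb0 by (simp add: u_def abs_mult)
          also have "\<dots> \<le> (\<epsilon> * \<bar>D\<rho> ?z ?w0\<bar>) / (1/2)" using q \<epsilon>(1) by (intro divide_left_mono) auto
          also have "\<dots> \<le> 2 * (\<epsilon> * (L * B))"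
            using \<open>\<bar>D\<rho> ?z ?w0\<bar> \<le> L * B\<close> \<epsilon>(1) by simp
          also have "\<dots> \<le> 2 * (e * (L * B + 1))" using \<epsilon>e \<epsilon>(1) LB
              by (intro mult_left_mono mult_mono) auto
          also have "\<dots> \<le> 2 * (\<eta> / (8 * (L * B + 1)) * (L * B + 1))"
            using LB by (intro mult_left_mono mult_right_mono) (auto simp: e_def)
          also have "\<dots> = \<eta> / 4" using LB by (simp add: field_simps)
          finally have "norm (u - ?w0) \<le> \<eta> / 4" .
          then show "norm (u - w0 y0) < \<eta> / 2"
            using w0n norm_triangle_ineq[of "u - ?w0" "?w0 - w0 y0"] by simp
        qed
        then have "(x, tv c' x w) \<in> U" using mem_cone_at_coord[OF c0(1) xc0] tvx
            by (simp add: fibre_def)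
        moreover have "w \<bullet> b = 0 \<or> 0 < coord c' x \<bullet> b"
          using c(6) xN cc'_eq[OF xd] by (auto simp: N_def split: if_splits)
        ultimately show ?thesis
          unfolding adapted_at_def using R'(1) xd c(3) half by blast
      qed
      then show ?thesis using N yN e by blast
    qed
    have "compact (K \<inter> S)" 
      using compact_Int_closed[OF r(4), of S] S by (simp add: K_def adapted_domain_def)
    obtain N e where Ne: "\<And>y. y \<in> K \<inter> S \<Longrightarrow> open (N y) \<and> y \<in> N y \<and> 0 < e y \<and>
        (\<forall>\<epsilon> x. good \<epsilon> \<longrightarrow> \<epsilon> < e y \<longrightarrow> \<Psi> \<epsilon> x \<in> N y \<longrightarrow> \<Psi> \<epsilon> x \<in> S \<longrightarrow> adapted_at U (\<Psi> \<epsilon> -` S) x)"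
      using locl by metis
    have cov: "K \<inter> S \<subseteq> (\<Union>y\<in>K \<inter> S. N y)" and oN: "\<And>y. y \<in> K \<inter> S \<Longrightarrow> open (N y)" using Ne by blast+
    obtain Y where Y: "Y \<subseteq> K \<inter> S" "finite Y" "K \<inter> S \<subseteq> (\<Union>y\<in>Y. N y)"
      using compactE_image[OF \<open>compact (K \<inter> S)\<close> oN cov] by metis
    define m where "m = Min (insert (1 / (2 * L)) (e ` Y))"
    have m: "m > 0" "m \<le> 1 / (2 * L)" "\<And>y. y \<in> Y \<Longrightarrow> m \<le> e y"
      using Y Ne \<rho>(6) by (auto simp: m_def)
    define \<epsilon> where "\<epsilon> = m / 2"
    have \<epsilon>: "0 < \<epsilon>" "\<And>y. y \<in> Y \<Longrightarrow> \<epsilon> < e y" using m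
        by (auto simp: \<epsilon>_def) (smt (verit) field_sum_of_halves m(1))
    have g: "good \<epsilon>"
    proof -
      have "\<epsilon> \<le> 1 / (2 * L)" using m(1,2) by (simp add: \<epsilon>_def)
      then have "\<epsilon> * L \<le> 1 / (2 * L) * L" using \<rho>(6) by (intro mult_right_mono) auto
      then show ?thesis using \<epsilon>(1) \<rho>(6) by (simp add: good_def)
    qed
    let ?S' = "\<Psi> \<epsilon> -` S"
    have closedS: "closed S" using S by (simp add: adapted_domain_def)
    have out: "?S' - K = S - K"
    proof (intro set_eqI)
      fix x
      show "x \<in> ?S' - K \<longleftrightarrow> x \<in> S - K"
      proof (cases "x \<in> K")
        case False
        then have "x \<notin> V" using VK by blast
        then show ?thesis using \<Psi>_out[of x \<epsilon>] by simp
      qed simp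
    qed
    have "adapted_at U ?S' x" if x: "x \<in> ?S'" for x
    proof (cases "x \<in> K")
      case True
      then have "\<Psi> \<epsilon> x \<in> K \<inter> S" using \<Psi>_K[OF g] x by blast
      then obtain y where "y \<in> Y" "\<Psi> \<epsilon> x \<in> N y" using Y(3) by blast
      then show ?thesis using Ne[of y] Y(1) \<epsilon>(2) g x by blast
    next
      case False
      then have "x \<in> S" using out x by blast
      then have "adapted_at U S x" using S by (simp add: adapted_domain_def)
      moreover have "open (- K)" using closedK by blast
      ultimately show ?thesis by (rule adapted_at_local) (use False out in auto)
    qed
    moreover have "closed ?S'" by (rule closed_vimage[OF closedS cont\<Psi>[OF g]])
    ultimately have ad: "adapted_domain U ?S'" by (simp add: adapted_domain_def)
    have half0: "y \<in> D \<longleftrightarrow> 0 \<le> coord c0 y \<bullet> b0" if "y \<in> dom_chart c0" for y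
      by (rule half_space_chart_iff[OF c0(1) D that])
    have up: "\<psi> \<epsilon> z \<bullet> b0 = z \<bullet> b0 + \<epsilon> * \<rho> z" for z
      using b0 by (simp add: \<psi>_def inner_add_left)
    have DS': "D \<subseteq> ?S'"
    proof
      fix x assume x: "x \<in> D"
      show "x \<in> ?S'"
      proof (cases "x \<in> V")
        case True
        then have xd: "x \<in> dom_chart c0" by (simp add: V_def)
        have "0 \<le> \<epsilon> * \<rho> (coord c0 x)" using \<epsilon>(1) \<rho>(2) by simp
        then have "0 \<le> coord c0 (\<Psi> \<epsilon> x) \<bullet> b0"
          using up[of "coord c0 x"] half0[OF xd] x \<Psi>_coord[OF g xd] by simp
        then show ?thesis using half0[of "\<Psi> \<epsilon> x"] \<Psi>_dom[OF g] xd DS by blast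
      next
        case False
        then show ?thesis using \<Psi>_out x DS by auto
      qed
    qed
    have VD: "x \<in> interior ?S'" if x: "x \<in> V" "x \<in> D" for x
    proof -
      define P where "P = dom_chart c0 \<inter> coord c0 -` {z. 0 < z \<bullet> b0}"
      have "open {z. 0 < z \<bullet> b0}" by (intro open_Collect_less continuous_intros)
      then have "open P" unfolding P_def by (rule open_coord_vimage[OF ic0])
      then have oP: "open (\<Psi> \<epsilon> -` P)" by (rule open_vimage[OF _ cont\<Psi>[OF g]])
      have "P \<subseteq> S"
      proof
        fix y assume "y \<in> P"
        then show "y \<in> S" using half0[of y] DS by (auto simp: P_def)
      qed
      then have "\<Psi> \<epsilon> -` P \<subseteq> ?S'" by blast
      moreover have "x \<in> \<Psi> \<epsilon> -` P"
      proof -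
        have xd: "x \<in> dom_chart c0" "coord c0 x \<in> ball z0 r" using x(1) by (auto simp: V_def)
        then have "0 < \<epsilon> * \<rho> (coord c0 x)" using \<rho>(4) \<epsilon>(1) by simp
        then have "0 < coord c0 (\<Psi> \<epsilon> x) \<bullet> b0"
          using up[of "coord c0 x"] half0[OF xd(1)] x(2) \<Psi>_coord[OF g xd(1)] by simp
        then show ?thesis using \<Psi>_dom[OF g, of x] xd(1) by (simp add: P_def)
      qed
      ultimately show ?thesis using oP interiorI by blast
    qed
    have "D \<inter> interior S \<subseteq> interior ?S'"
    proof
      fix x assume x: "x \<in> D \<inter> interior S"
      show "x \<in> interior ?S'"
      proof (cases "x \<in> V")
        case True
        then show ?thesis using VD x by blast
      next
        case False
        have "open (\<Psi> \<epsilon> -` interior S)" by (rule open_vimage[OF open_interior cont\<Psi>[OF g]])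
        moreover have "x \<in> \<Psi> \<epsilon> -` interior S" using \<Psi>_out[OF False] x by simp
        moreover have "\<Psi> \<epsilon> -` interior S \<subseteq> ?S'" using interior_subset by blast
        ultimately show ?thesis using interiorI by blast
      qed
    qed
    then show ?thesis using ad DS' out VD by (intro exI[of _ ?S']) blast
  qed
  show ?thesis
  proof (rule that)
    show "open V" unfolding V_def by (rule r(3))
    show "x0 \<in> V" using c0(2) r(1) by (simp add: V_def z0_def)
    show "K \<subseteq> W" unfolding K_def by (rule r(5))
  qed (rule step)
qed

text \<open>The boundary is pushed once for each piece of a locally finite cover of \<open>D\<close> by half
  space charts. A point of \<open>D\<close> becomes interior when its piece is treated and
  remains so afterwards. Near each point the sets \<open>S n\<close> are eventually constant, so
  that closedness and adapted charts pass to the limit \<open>F\<close>.\<close>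

lemma ex_adapted_neighborhood:
  assumes U: "openin (tangent_topology A) U" and D: "adapted_domain U D"
  shows "\<exists>F. adapted_domain U F \<and> D \<subseteq> interior F"
proof -
  define Q where "Q V K \<longleftrightarrow> (\<forall>S. adapted_domain U S \<longrightarrow> D \<subseteq> S \<longrightarrow> (\<exists>S'. adapted_domain U S' \<and> D \<subseteq> S' \<and>
     S' - K = S - K \<and> V \<inter> D \<subseteq> interior S' \<and> D \<inter> interior S \<subseteq> interior S'))" for V K
  have closedD: "closed D" using D by (simp add: adapted_domain_def)
  have loc: "\<exists>V K. Q V K \<and> open V \<and> x \<in> V \<and> K \<subseteq> W" if x: "x \<in> D" and W: "open W" "x \<in> W" for x W
  proof -
    obtain c b where c: "c \<in> maximal_atlas A" "x \<in> dom_chart c" "b \<in> Basis"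
      "coord c ` (dom_chart c \<inter> D) = chart_ran c \<inter> {z. 0 \<le> z \<bullet> b}"
      using D x unfolding adapted_domain_def adapted_at_def by blast
    from push_boundary_outward[OF U c W] show ?thesis unfolding Q_def by metis
  qed
  obtain \<F> where c\<F>: "countable \<F>" and \<F>: "\<forall>q\<in>\<F>. Q (fst q) (snd q) \<and> open (fst q)" "D \<subseteq> \<Union> (fst ` \<F>)"
    "\<forall>x. \<exists>N. open N \<and> x \<in> N \<and> finite {p \<in> \<F>. snd p \<inter> N \<noteq> {}}"
    by (rule locally_finite_cover[where Q = Q, OF manifold_locally_compact closedD])
      (rule loc, assumption+)
  \<comment> \<open>The cover is enumerated without repetitions, with empty pieces at unused indices, so that the
      pieces meeting a small neighborhood have finitely many indices.\<close>
  define P where "P n = (if n \<in> to_nat_on \<F> ` \<F> then from_nat_into \<F> n else ({}, {}))" for n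
  have P_to_nat: "P (to_nat_on \<F> q) = q" if "q \<in> \<F>" for q
    using that c\<F> by (auto simp: P_def)
  have P_cases: "P n \<in> \<F> \<and> to_nat_on \<F> (P n) = n \<or> P n = ({}, {})" for n
    using c\<F> by (auto simp: P_def)
  have QP: "Q (fst (P n)) (snd (P n))" for n
    using P_cases[of n] \<F>(1) by (auto simp: Q_def)
  have "\<exists>S. \<forall>n. (adapted_domain U (S n) \<and> D \<subseteq> S n) \<and> (S (Suc n) - snd (P n) = S n - snd (P n) \<and>
      fst (P n) \<inter> D \<subseteq> interior (S (Suc n)) \<and> D \<inter> interior (S n) \<subseteq> interior (S (Suc n)))"
  proof (rule dependent_nat_choice)
    show "\<exists>S. adapted_domain U S \<and> D \<subseteq> S" using D by blast
    fix S n assume "adapted_domain U S \<and> D \<subseteq> S"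
    then show "\<exists>S'. (adapted_domain U S' \<and> D \<subseteq> S') \<and> S' - snd (P n) = S - snd (P n) \<and>
      fst (P n) \<inter> D \<subseteq> interior S' \<and> D \<inter> interior S \<subseteq> interior S'"
      using QP[of n] unfolding Q_def by blast
  qed
  then obtain S where S0: "\<forall>n. (adapted_domain U (S n) \<and> D \<subseteq> S n) \<and>
      (S (Suc n) - snd (P n) = S n - snd (P n) \<and>
      fst (P n) \<inter> D \<subseteq> interior (S (Suc n)) \<and> D \<inter> interior (S n) \<subseteq> interior (S (Suc n)))" ..
  have S: "adapted_domain U (S n)" "D \<subseteq> S n" "S (Suc n) - snd (P n) = S n - snd (P n)"
    "fst (P n) \<inter> D \<subseteq> interior (S (Suc n))" "D \<inter> interior (S n) \<subseteq> interior (S (Suc n))" for n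
    using S0[rule_format, of n] by simp_all
  have stable: "\<exists>N n. open N \<and> x \<in> N \<and> (\<forall>k\<ge>n. S k \<inter> N = S n \<inter> N)" for x
  proof -
    obtain N where N: "open N" "x \<in> N" "finite {p \<in> \<F>. snd p \<inter> N \<noteq> {}}" using \<F>(3) by blast
    let ?B = "to_nat_on \<F> ` {p \<in> \<F>. snd p \<inter> N \<noteq> {}}"
    define n where "n = Suc (Max (insert 0 ?B))"
    have miss: "snd (P k) \<inter> N = {}" if "k \<ge> n" for k
    proof (rule ccontr)
      assume *: "snd (P k) \<inter> N \<noteq> {}"
      then have "P k \<in> \<F>" "to_nat_on \<F> (P k) = k" using P_cases[of k] by auto
      then have "k \<in> ?B" using * by (metis (mono_tags, lifting) image_eqI mem_Collect_eq)
      then have "k \<le> Max (insert 0 ?B)" using N(3) by (intro Max_ge) auto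
      then show False using that by (simp add: n_def)
    qed
    have "S k \<inter> N = S n \<inter> N" if "k \<ge> n" for k
      using that
    proof (induction rule: dec_induct)
      case (step k)
      then show ?case using S(3)[of k] miss[of k] by blast
    qed simp
    then show ?thesis using N by blast
  qed
  define F where "F = {x. \<exists>n. \<forall>k\<ge>n. x \<in> S k}"
  have FN: "F \<inter> N = S n \<inter> N" if "\<forall>k\<ge>n. S k \<inter> N = S n \<inter> N" for N n
  proof (intro equalityI subsetI)
    fix x assume x: "x \<in> F \<inter> N"
    then obtain m where "\<forall>k\<ge>m. x \<in> S k" by (auto simp: F_def)
    then have "x \<in> S (max m n)" by simp
    then show "x \<in> S n \<inter> N" using that[rule_format, of "max m n"] x by auto
  next
    fix x assume "x \<in> S n \<inter> N"
    moreover from this have "x \<in> S k" if "k \<ge> n" for k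
      using \<open>\<forall>k\<ge>n. S k \<inter> N = S n \<inter> N\<close>[rule_format, OF that] by blast
    ultimately show "x \<in> F \<inter> N" unfolding F_def by blast
  qed
  have "adapted_at U F x" if x: "x \<in> F" for x
  proof -
    obtain N n where N: "open N" "x \<in> N" "\<forall>k\<ge>n. S k \<inter> N = S n \<inter> N" using stable by metis
    have "x \<in> S n" using FN[OF N(3)] x N(2) by blast
    then have "adapted_at U (S n) x" using S(1) by (simp add: adapted_domain_def)
    then show ?thesis by (rule adapted_at_local[OF _ N(1,2)]) (use FN[OF N(3)] in simp)
  qed
  moreover have "closed F"
  proof -
    have "open (- F)"
    proof (rule topological_space_class.openI)
      fix x assume x: "x \<in> - F"
      obtain N n where N: "open N" "x \<in> N" "\<forall>k\<ge>n. S k \<inter> N = S n \<inter> N" using stable by metis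
      have "open (N - S n)" using N(1) S(1) by (intro open_Diff) (auto simp: adapted_domain_def)
      moreover have "x \<in> N - S n" "N - S n \<subseteq> - F" using FN[OF N(3)] x N(2) by blast+
      ultimately show "\<exists>T. open T \<and> x \<in> T \<and> T \<subseteq> - F" by blast
    qed
    then show ?thesis by (simp add: closed_def)
  qed
  moreover have "D \<subseteq> interior F"
  proof
    fix x assume x: "x \<in> D"
    then obtain q where q: "q \<in> \<F>" "x \<in> fst q" using \<F>(2) by blast
    let ?k = "Suc (to_nat_on \<F> q)"
    have base: "x \<in> interior (S ?k)" using S(4)[of "to_nat_on \<F> q"] P_to_nat[OF q(1)] q(2) x by auto
    have int: "x \<in> interior (S j)" if "j \<ge> ?k" for j
      using that
    proof (induction rule: dec_induct)
      case (step i)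
      then show ?case using S(5)[of i] x by blast
    qed (rule base)
    obtain N n where N: "open N" "x \<in> N" "\<forall>k\<ge>n. S k \<inter> N = S n \<inter> N" using stable by metis
    let ?j = "max n ?k"
    have "S ?j \<inter> N = F \<inter> N" using FN[OF N(3)] N(3)[rule_format, of ?j] by simp
    then have "interior (S ?j) \<inter> N \<subseteq> F" using interior_subset by blast
    moreover have "open (interior (S ?j) \<inter> N)" using N(1) by auto
    moreover have "x \<in> interior (S ?j) \<inter> N" using int[of ?j] N(2) by simp
    ultimately show "x \<in> interior F" using interiorI by blast
  qed
  ultimately show ?thesis unfolding adapted_domain_def by blast
qed

lemma ex_smooth_solvable_restriction:
  assumes C: "closed_cone_field A C" and solv: "locally_solvable A C" and C1: "enlargement A C C1"
    and sd: "smooth_domain A (cone_domain C)"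
  shows "\<exists>F. closed_neighborhood F (cone_domain C) \<and> smooth_domain A F \<and>
    enlargement A C (restrict_field C1 F) \<and> locally_solvable A (restrict_field C1 F)"
proof -
  let ?U = "(tangent_topology A) interior_of C1"
  have cf: "cone_field A C" using C by (simp add: closed_cone_field_def)
  have cf1: "cone_field A C1" and CU: "C \<subseteq> ?U" using C1
      by (auto simp: enlargement_def closed_cone_field_def)
  obtain F where F: "adapted_domain ?U F" "cone_domain C \<subseteq> interior F"
    using ex_adapted_neighborhood[OF openin_interior_of adapted_cone_domain[OF C solv CU sd]]
        by blast
  have nb: "closed_neighborhood F (cone_domain C)"
    using F by (simp add: closed_neighborhood_def adapted_domain_def)
  have en: "enlargement A C (restrict_field C1 F)" by (rule enlargement_restrict_field[OF cf C1 nb])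
  then have cfF: "cone_field A (restrict_field C1 F)"
      by (simp add: enlargement_def closed_cone_field_def)
  have "\<exists>\<gamma>. causal_curve A (restrict_field C1 F) {-1<..<1} \<gamma> \<and> \<not> \<gamma> constant_on {-1<..<1} \<and> \<gamma> 0 = x"
    if x: "x \<in> cone_domain (restrict_field C1 F)" for x
  proof -
    have "x \<in> F" using x by (auto simp: cone_domain_def fibre_def restrict_field_def)
    from adapted_domain_curve[OF cf1 openin_interior_of interior_of_subset F(1) this]
    show ?thesis using causal_curve_nonconstant[OF cfF] by blast
  qed
  then have "locally_solvable A (restrict_field C1 F)" by (simp add: locally_solvable_def)
  then show ?thesis using nb en adapted_domain_smooth[OF F(1)] by blast
qed

end

theorem lemma1p4:
  fixes A :: "('m::{t2_space, second_countable_topology}, 'e::euclidean_space) chart set"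
    and C :: "('m \<times> ('m, 'e) tvec) set"
  assumes "smooth_atlas A"
    and "closed_cone_field A C"
    and "locally_solvable A C"
  shows "(\<exists>C'. enlargement A C C' \<and> locally_solvable A C') \<and>
    (\<forall>C1. enlargement A C C1 \<longrightarrow>
      (\<exists>F. closed_neighborhood F (cone_domain C) \<and>
         enlargement A C (restrict_field C1 F) \<and>
         locally_solvable A (restrict_field C1 F))) \<and>
    (smooth_domain A (cone_domain C) \<longrightarrow>
      (\<forall>C1. enlargement A C C1 \<longrightarrow>
        (\<exists>F. closed_neighborhood F (cone_domain C) \<and> smooth_domain A F \<and>
           enlargement A C (restrict_field C1 F) \<and>
           locally_solvable A (restrict_field C1 F))))"
proof -
  interpret smooth_manifold A by standard (rule assms(1))
  show ?thesis
    using ex_enlargement[OF assms(2)] ex_solvable_restriction[OF assms(2,3)]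
      ex_smooth_solvable_restriction[OF assms(2,3)] by blast
qed

end
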